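(* Let $k$ be an algebraically closed field of characteristic $p>0$, let $n$ be a positive integer with $p\mid n$, and write $n=pr$. Then the variety $$\mathcal{C}=\{(A,B)\in\mathfrak{gl}_n\times\mathfrak{gl}_n \mid [A,B]=I\}$$ is irreducible of dimension $n^2+r$.
   Context: Here $\mathfrak{gl}_n=\mathfrak{gl}_n(k)$ is the Lie algebra of all $n\times n$ matrices over $k$, $[A,B]=AB-BA$, and $I$ is the $n\times n$ identity matrix. $\mathcal{C}$ is regarded as a Zariski closed subset of the affine space $\mathfrak{gl}_n\times\mathfrak{gl}_n\cong\mathbb{A}_k^{2n^2}$. *)

theory Defs
  imports
    "HOL-Analysis.Abstract_Topology"
    "HOL-Library.Extended_Nat"
    "HOL-Computational_Algebra.Polynomial"
    "Jordan_Normal_Form.Matrix"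
begin

definition irreducible_space :: "'x topology \<Rightarrow> bool" where
  "irreducible_space T \<longleftrightarrow>
     topspace T \<noteq> {} \<and>
     (\<forall>Z1 Z2. closedin T Z1 \<and> closedin T Z2 \<and> topspace T = Z1 \<union> Z2
        \<longrightarrow> Z1 = topspace T \<or> Z2 = topspace T)"

text \<open>
  A chain \<open>Z 0 \<subset> \<dots> \<subset> Z m\<close> has length \<open>m\<close>.  The supremum is taken in \<^typ>\<open>enat\<close>, so the
  dimension may be \<open>\<infinity>\<close>, and the empty space gets the junk value \<open>0\<close>.
\<close>

definition krull_dim :: "'x topology \<Rightarrow> enat" where
  "krull_dim T = Sup {enat m | m. \<exists>Z :: nat \<Rightarrow> 'x set.
     (\<forall>i\<le>m. closedin T (Z i) \<and> irreducible_space (subtopology T (Z i))) \<and>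
     (\<forall>i<m. Z i \<subset> Z (Suc i))}"


text \<open>
  An affine space is given by its set \<open>V\<close> of points and the set \<open>X\<close> of its coordinate functions;
  \<open>poly_funs X\<close> is the algebra of polynomials in these coordinates, viewed as functions.
\<close>

inductive_set poly_funs :: "('x \<Rightarrow> 'k::comm_ring_1) set \<Rightarrow> ('x \<Rightarrow> 'k) set"
  for X :: "('x \<Rightarrow> 'k) set" where
  const: "(\<lambda>_. c) \<in> poly_funs X"
| coord: "f \<in> X \<Longrightarrow> f \<in> poly_funs X"
| add: "f \<in> poly_funs X \<Longrightarrow> g \<in> poly_funs X \<Longrightarrow> (\<lambda>x. f x + g x) \<in> poly_funs X"
| mult: "f \<in> poly_funs X \<Longrightarrow> g \<in> poly_funs X \<Longrightarrow> (\<lambda>x. f x * g x) \<in> poly_funs X"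

definition zero_locus :: "'x set \<Rightarrow> ('x \<Rightarrow> 'k::zero) set \<Rightarrow> 'x set" where
  "zero_locus V S = {x \<in> V. \<forall>f\<in>S. f x = 0}"

definition zariski :: "'x set \<Rightarrow> ('x \<Rightarrow> 'k::idom) set \<Rightarrow> 'x topology" where
  "zariski V X = topology (\<lambda>U. \<exists>S. S \<subseteq> poly_funs X \<and> U = V - zero_locus V S)"

lemma zero_locus_Un:
  "zero_locus V S \<inter> zero_locus V T = zero_locus V (S \<union> T)"
  by (auto simp: zero_locus_def)

lemma zero_locus_mult:
  fixes S T :: "('x \<Rightarrow> 'k::idom) set"
  shows "zero_locus V S \<union> zero_locus V T
       = zero_locus V {(\<lambda>x. f x * g x) | f g. f \<in> S \<and> g \<in> T}"
  unfolding zero_locus_def by (auto 4 4)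

lemma istopology_zariski:
  fixes X :: "('x \<Rightarrow> 'k::idom) set"
  shows "istopology (\<lambda>U. \<exists>S. S \<subseteq> poly_funs X \<and> U = V - zero_locus V S)"
  unfolding istopology_def
proof (intro conjI allI impI)
  fix U W
  assume "\<exists>S. S \<subseteq> poly_funs X \<and> U = V - zero_locus V S"
    and "\<exists>S. S \<subseteq> poly_funs X \<and> W = V - zero_locus V S"
  then obtain S T where ST: "S \<subseteq> poly_funs X" "T \<subseteq> poly_funs X"
    "U = V - zero_locus V S" "W = V - zero_locus V T" by blast
  let ?P = "{(\<lambda>x. f x * g x) | f g. f \<in> S \<and> g \<in> T}"
  have "?P \<subseteq> poly_funs X" using ST by (auto intro: poly_funs.mult)
  moreover have "U \<inter> W = V - zero_locus V ?P"
    using ST zero_locus_mult[of V S T] by blast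
  ultimately show "\<exists>S. S \<subseteq> poly_funs X \<and> U \<inter> W = V - zero_locus V S" by blast
next
  fix K
  assume "\<forall>U\<in>K. \<exists>S. S \<subseteq> poly_funs X \<and> U = V - zero_locus V S"
  then obtain S where S: "\<And>U. U \<in> K \<Longrightarrow> S U \<subseteq> poly_funs X"
    "\<And>U. U \<in> K \<Longrightarrow> U = V - zero_locus V (S U)" by metis
  have "\<Union>K = V - zero_locus V (\<Union>(S ` K))"
  proof -
    have "x \<in> \<Union>K \<longleftrightarrow> x \<in> V - zero_locus V (\<Union>(S ` K))" for x
    proof -
      have "x \<in> \<Union>K \<longleftrightarrow> (\<exists>U\<in>K. x \<in> V - zero_locus V (S U))" using S(2) by auto
      also have "\<dots> \<longleftrightarrow> x \<in> V - zero_locus V (\<Union>(S ` K))" by (auto simp: zero_locus_def)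
      finally show ?thesis .
    qed
    then show ?thesis by blast
  qed
  moreover have "\<Union>(S ` K) \<subseteq> poly_funs X" using S(1) by blast
  ultimately show "\<exists>S. S \<subseteq> poly_funs X \<and> \<Union>K = V - zero_locus V S" by blast
qed

lemma openin_zariski:
  "openin (zariski V X) U \<longleftrightarrow> (\<exists>S. S \<subseteq> poly_funs X \<and> U = V - zero_locus V S)"
  unfolding zariski_def by (simp add: topology_inverse'[OF istopology_zariski])

lemma topspace_zariski [simp]:
  fixes X :: "('x \<Rightarrow> 'k::idom) set"
  shows "topspace (zariski V X) = V"
proof
  show "topspace (zariski V X) \<subseteq> V"
    using openin_topspace[of "zariski V X"] unfolding openin_zariski by blast
  have "V = V - zero_locus V {\<lambda>_. 1 :: 'k}" by (auto simp: zero_locus_def)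
  moreover have "{\<lambda>_. 1 :: 'k} \<subseteq> poly_funs X" by (simp add: poly_funs.const)
  ultimately have "openin (zariski V X) V" unfolding openin_zariski by blast
  then show "V \<subseteq> topspace (zariski V X)" by (rule openin_subset)
qed

lemma closedin_zariski:
  fixes X :: "('x \<Rightarrow> 'k::idom) set"
  shows "closedin (zariski V X) Z \<longleftrightarrow> (\<exists>S. S \<subseteq> poly_funs X \<and> Z = zero_locus V S)"
proof -
  have *: "zero_locus V S \<subseteq> V" for S :: "('x \<Rightarrow> 'k) set" by (auto simp: zero_locus_def)
  have "closedin (zariski V X) Z \<longleftrightarrow>
      Z \<subseteq> V \<and> (\<exists>S. S \<subseteq> poly_funs X \<and> V - Z = V - zero_locus V S)"
    by (simp add: closedin_def openin_zariski)
  also have "\<dots> \<longleftrightarrow> (\<exists>S. S \<subseteq> poly_funs X \<and> Z = zero_locus V S)"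
  proof -
    have "Z \<subseteq> V \<and> V - Z = V - zero_locus V S \<longleftrightarrow> Z = zero_locus V S" for S :: "('x \<Rightarrow> 'k) set"
      using *[of S] by auto
    then show ?thesis by (metis (no_types, lifting))
  qed
  finally show ?thesis .
qed


definition gl_pairs :: "nat \<Rightarrow> ('k mat \<times> 'k mat) set" where
  "gl_pairs n = carrier_mat n n \<times> carrier_mat n n"

definition gl_pairs_coords :: "nat \<Rightarrow> ('k mat \<times> 'k mat \<Rightarrow> 'k) set" where
  "gl_pairs_coords n =
     {(\<lambda>(A, B). A $$ (i, j)) | i j. i < n \<and> j < n} \<union>
     {(\<lambda>(A, B). B $$ (i, j)) | i j. i < n \<and> j < n}"

definition lie_bracket :: "'k::ring mat \<Rightarrow> 'k mat \<Rightarrow> 'k mat" where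
  "lie_bracket A B = A * B - B * A"

definition bracket_one_pairs :: "nat \<Rightarrow> ('k::ring_1 mat \<times> 'k mat) set" where
  "bracket_one_pairs n = {(A, B) \<in> gl_pairs n. lie_bracket A B = 1\<^sub>m n}"

lemma poly_funs_sum:
  assumes "\<And>i. i \<in> I \<Longrightarrow> f i \<in> poly_funs X"
  shows "(\<lambda>x. \<Sum>i\<in>I. f i x) \<in> poly_funs X"
  using assms by (induction I rule: infinite_finite_induct) (auto intro: poly_funs.intros)

lemma closedin_bracket_one_pairs:
  "closedin (zariski (gl_pairs n) (gl_pairs_coords n))
     (bracket_one_pairs n :: ('k::idom mat \<times> 'k mat) set)"
proof -
  define e :: "nat \<Rightarrow> nat \<Rightarrow> 'k mat \<times> 'k mat \<Rightarrow> 'k" where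
    "e i j = (\<lambda>x. (\<Sum>l<n. (case x of (A, B) \<Rightarrow> A $$ (i, l)) * (case x of (A, B) \<Rightarrow> B $$ (l, j)))
        + (- 1 * (\<Sum>l<n. (case x of (A, B) \<Rightarrow> B $$ (i, l)) * (case x of (A, B) \<Rightarrow> A $$ (l, j)))
        + (if i = j then - 1 else 0)))" for i j
  let ?S = "{e i j | i j. i < n \<and> j < n}"
  have "e i j \<in> poly_funs (gl_pairs_coords n)" if "i < n" "j < n" for i j
    unfolding e_def using that
    by (intro poly_funs.add poly_funs.mult poly_funs_sum poly_funs.const poly_funs.coord)
       (auto simp: gl_pairs_coords_def)
  then have "?S \<subseteq> poly_funs (gl_pairs_coords n)" by auto
  moreover have "bracket_one_pairs n = zero_locus (gl_pairs n) ?S"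
  proof -
    have "lie_bracket A B = 1\<^sub>m n \<longleftrightarrow> (\<forall>i<n. \<forall>j<n. e i j (A, B) = 0)"
      if AB: "A \<in> carrier_mat n n" "B \<in> carrier_mat n n" for A B
    proof -
      have "lie_bracket A B $$ (i, j) - 1\<^sub>m n $$ (i, j) = e i j (A, B)" if "i < n" "j < n" for i j
        using AB that by (simp add: lie_bracket_def e_def scalar_prod_def lessThan_atLeast0)
      then have "(\<forall>i<n. \<forall>j<n. e i j (A, B) = 0) \<longleftrightarrow>
          (\<forall>i<n. \<forall>j<n. lie_bracket A B $$ (i, j) = 1\<^sub>m n $$ (i, j))"
        by (metis eq_iff_diff_eq_0)
      also have "\<dots> \<longleftrightarrow> lie_bracket A B = 1\<^sub>m n"
      proof
        assume *: "\<forall>i<n. \<forall>j<n. lie_bracket A B $$ (i, j) = 1\<^sub>m n $$ (i, j)"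
        show "lie_bracket A B = 1\<^sub>m n"
        proof (rule eq_matI)
          show "lie_bracket A B $$ (i, j) = 1\<^sub>m n $$ (i, j)"
            if "i < dim_row (1\<^sub>m n)" "j < dim_col (1\<^sub>m n)" for i j
            using * that by simp
        qed (use AB in \<open>auto simp: lie_bracket_def\<close>)
      qed simp
      finally show ?thesis by simp
    qed
    moreover have "(A, B) \<in> zero_locus (gl_pairs n) ?S \<longleftrightarrow>
        A \<in> carrier_mat n n \<and> B \<in> carrier_mat n n \<and> (\<forall>i<n. \<forall>j<n. e i j (A, B) = 0)" for A B
      unfolding zero_locus_def gl_pairs_def by blast
    ultimately have "x \<in> bracket_one_pairs n \<longleftrightarrow> x \<in> zero_locus (gl_pairs n) ?S" for x
      by (cases x) (auto simp only: bracket_one_pairs_def gl_pairs_def mem_Collect_eq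
          prod.case mem_Times_iff fst_conv snd_conv)
    then show ?thesis by blast
  qed
  ultimately show ?thesis unfolding closedin_zariski by (intro exI[of _ ?S] conjI)
qed

definition bracket_one_variety :: "nat \<Rightarrow> ('k::idom mat \<times> 'k mat) topology" where
  "bracket_one_variety n =
     subtopology (zariski (gl_pairs n) (gl_pairs_coords n)) (bracket_one_pairs n)"

end

theory Submission
  imports Defs "Jordan_Normal_Form.Jordan_Normal_Form_Existence"
begin

text \<open>
  Let \<open>e\<close> be the first unit vector, and consider the pairs \<open>(A, B)\<close> in the variety for which \<open>e\<close> is
  a cyclic vector of \<open>B\<close>.  If \<open>f\<close> is the characteristic polynomial of such a \<open>B\<close>, then
  \<open>f'(B) = [A, f(B)] = 0\<close>, so \<open>f' = 0\<close> because \<open>B\<close> satisfies no relation of degree below \<open>n\<close>.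
  Hence \<open>f\<close> is a polynomial in \<open>x\<^sup>p\<close> and has \<open>r\<close> free coefficients.  The pair is determined by \<open>f\<close>,
  the Krylov basis \<open>e, B e, B\<^sup>2 e, \<dots>\<close> and the vector \<open>A e\<close>, since \<open>A\<close> acts on powers of \<open>B\<close> as the
  derivation \<open>d/dx\<close>.  Conversely these data can be prescribed freely as long as the basis is one
  (\<open>cyclic_pair_in_chart\<close>, \<open>chart_in_variety\<close>).  They amount to \<open>r + n (n - 1) + n\<close> coordinates, and
  the correspondence is rational in both directions, so these pairs form an open set in affine
  space of dimension \<open>n\<^sup>2 + r\<close>.

  Such pairs are dense (\<open>chart_dense\<close>).  This is the deformation argument of Motzkin and Taussky for
  commuting pairs: \<open>A\<close> commutes with some matrix \<open>R\<close> that has a cyclic vector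
  (\<open>exists_commuting_cyclic\<close>), the pairs \<open>(A, B + t R)\<close> stay in the variety, and \<open>B + t R\<close> has a
  cyclic vector for almost all \<open>t\<close>.  A conjugation that also depends on \<open>t\<close> moves it to \<open>e\<close>.

  It remains to see that a closed set with a dense chart of this kind is irreducible of the expected
  dimension (locale \<open>rational_chart\<close>).  Irreducibility is tested on lines of the parameter space,
  where all functions become polynomials in one variable.  A chain of irreducible closed sets yields
  as many algebraically independent functions (\<open>prime_chain_algebraically_independent\<close>), and their
  number is bounded by counting monomials (\<open>fractions_algebraically_dependent\<close>); a chain of the
  maximal length comes from fixing the parameters one by one.
\<close>

section \<open>Polynomial functions and fractions\<close>

lemma poly_funs_prod:
  assumes "\<And>i. i \<in> I \<Longrightarrow> f i \<in> poly_funs X"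
  shows "(\<lambda>x. \<Prod>i\<in>I. f i x) \<in> poly_funs X"
  using assms by (induction I rule: infinite_finite_induct) (auto intro: poly_funs.intros)

lemma poly_funs_power:
  assumes "f \<in> poly_funs X"
  shows "(\<lambda>x. f x ^ e) \<in> poly_funs X"
  using assms by (induction e) (auto intro: poly_funs.intros)

lemma poly_funs_uminus:
  fixes f :: "'x \<Rightarrow> 'k::comm_ring_1"
  assumes "f \<in> poly_funs X"
  shows "(\<lambda>x. - f x) \<in> poly_funs X"
  using poly_funs.mult[OF poly_funs.const[of "-1" X] assms] by simp

lemma poly_funs_diff:
  fixes f :: "'x \<Rightarrow> 'k::comm_ring_1"
  assumes "f \<in> poly_funs X" "g \<in> poly_funs X"
  shows "(\<lambda>x. f x - g x) \<in> poly_funs X"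
  using poly_funs.add[OF assms(1) poly_funs_uminus[OF assms(2)]] by simp

lemma poly_funs_compose:
  assumes "f \<in> poly_funs Y" "\<And>y. y \<in> Y \<Longrightarrow> (\<lambda>x. y (\<gamma> x)) \<in> poly_funs X"
  shows "(\<lambda>x. f (\<gamma> x)) \<in> poly_funs X"
  using assms by (induction rule: poly_funs.induct) (auto intro: poly_funs.intros)

lemma poly_funs_id_imp_poly:
  fixes f :: "'k::comm_ring_1 \<Rightarrow> 'k"
  assumes "f \<in> poly_funs {\<lambda>t. t}"
  shows "\<exists>P. f = poly P"
  using assms
proof (induction rule: poly_funs.induct)
  case (const c)
  have "(\<lambda>_. c) = poly [:c:]" by auto
  then show ?case by blast
next
  case (coord f)
  then have "f = poly [:0, 1:]" by auto
  then show ?case by blast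
next
  case (add f g)
  then obtain P Q where "f = poly P" "g = poly Q" by blast
  then have "(\<lambda>x. f x + g x) = poly (P + Q)" by auto
  then show ?case by blast
next
  case (mult f g)
  then obtain P Q where "f = poly P" "g = poly Q" by blast
  then have "(\<lambda>x. f x * g x) = poly (P * Q)" by auto
  then show ?case by blast
qed

lemma poly_funs_id_finite_zeros:
  fixes f :: "'k::idom \<Rightarrow> 'k"
  assumes "f \<in> poly_funs {\<lambda>t. t}" "f s \<noteq> 0"
  shows "finite {t. f t = 0}"
proof -
  obtain P where P: "f = poly P" using poly_funs_id_imp_poly[OF assms(1)] by blast
  then have "P \<noteq> 0" using assms(2) by auto
  then show ?thesis using P poly_roots_finite by auto
qed

lemma finite_zeros_imp_common_nonzero:
  assumes "infinite (UNIV :: 'k set)" "finite {t. f t = 0}" "finite {t. g t = 0}"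
  shows "\<exists>t :: 'k. f t \<noteq> 0 \<and> g t \<noteq> 0"
proof -
  have "{t. f t = 0} \<union> {t. g t = 0} \<noteq> UNIV" using assms by (metis finite_Un)
  then show ?thesis by blast
qed

lemma infinite_UNIV_alg_closed: "infinite (UNIV :: 'k::alg_closed_field set)"
proof
  assume fin: "finite (UNIV :: 'k set)"
  define P where "P = (\<Prod>a\<in>(UNIV :: 'k set). [:- a, 1:])"
  have zero: "poly P x = 0" for x :: 'k
    unfolding P_def poly_prod using fin by (simp add: prod_zero_iff)
  have "degree P = card (UNIV :: 'k set)"
    unfolding P_def by (subst degree_prod_eq_sum_degree) auto
  then have "degree P > 0" using fin by (simp add: finite_UNIV_card_ge_0)
  then have "degree (P + 1) > 0"
    by (simp add: degree_add_eq_left)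
  then obtain x where "poly (P + 1) x = 0" using alg_closed_imp_poly_has_root by blast
  then show False using zero[of x] by simp
qed

text \<open>
  If \<open>\<delta>\<close> has no zeros on \<open>D\<close>, these are the functions that agree on \<open>D\<close> with a quotient \<open>P / \<delta>\<^sup>e\<close>.
  Clearing the denominator in the definition reduces sums and products to ring arithmetic.
\<close>

definition fractions :: "('x \<Rightarrow> 'k::comm_ring_1) set \<Rightarrow> ('x \<Rightarrow> 'k) \<Rightarrow> 'x set \<Rightarrow> ('x \<Rightarrow> 'k) set" where
  "fractions X \<delta> D = {u. \<exists>e. \<exists>P\<in>poly_funs X. \<forall>x\<in>D. u x * \<delta> x ^ e = P x}"

lemma fractionsI:
  assumes "P \<in> poly_funs X" "\<And>x. x \<in> D \<Longrightarrow> u x * \<delta> x ^ e = P x"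
  shows "u \<in> fractions X \<delta> D"
  using assms unfolding fractions_def by blast

lemma poly_funs_in_fractions: "f \<in> poly_funs X \<Longrightarrow> f \<in> fractions X \<delta> D"
  by (rule fractionsI[where e = 0]) auto

lemma fractions_add:
  assumes "\<delta> \<in> poly_funs X" "u \<in> fractions X \<delta> D" "v \<in> fractions X \<delta> D"
  shows "(\<lambda>x. u x + v x) \<in> fractions X \<delta> D"
proof -
  obtain e P f Q where eP: "P \<in> poly_funs X" "\<forall>x\<in>D. u x * \<delta> x ^ e = P x"
    and fQ: "Q \<in> poly_funs X" "\<forall>x\<in>D. v x * \<delta> x ^ f = Q x"
    using assms(2,3) unfolding fractions_def by blast
  show ?thesis
  proof (rule fractionsI)
    show "(\<lambda>x. P x * \<delta> x ^ f + Q x * \<delta> x ^ e) \<in> poly_funs X"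
      by (intro poly_funs.add poly_funs.mult poly_funs_power eP fQ assms)
    fix x assume x: "x \<in> D"
    then have "P x = u x * \<delta> x ^ e" "Q x = v x * \<delta> x ^ f" using eP fQ by auto
    then show "(u x + v x) * \<delta> x ^ (e + f) = P x * \<delta> x ^ f + Q x * \<delta> x ^ e"
      by (simp add: algebra_simps power_add)
  qed
qed

lemma fractions_mult:
  assumes "u \<in> fractions X \<delta> D" "v \<in> fractions X \<delta> D"
  shows "(\<lambda>x. u x * v x) \<in> fractions X \<delta> D"
proof -
  obtain e P f Q where eP: "P \<in> poly_funs X" "\<forall>x\<in>D. u x * \<delta> x ^ e = P x"
    and fQ: "Q \<in> poly_funs X" "\<forall>x\<in>D. v x * \<delta> x ^ f = Q x"
    using assms unfolding fractions_def by blast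
  show ?thesis
  proof (rule fractionsI)
    show "(\<lambda>x. P x * Q x) \<in> poly_funs X"
      by (intro poly_funs.mult eP fQ)
    fix x assume x: "x \<in> D"
    then have "P x = u x * \<delta> x ^ e" "Q x = v x * \<delta> x ^ f" using eP fQ by auto
    then show "(u x * v x) * \<delta> x ^ (e + f) = P x * Q x"
      by (simp add: algebra_simps power_add)
  qed
qed

lemma fractions_inverse:
  fixes \<delta> :: "'x \<Rightarrow> 'k::field"
  assumes "\<And>x. x \<in> D \<Longrightarrow> \<delta> x \<noteq> 0"
  shows "(\<lambda>x. 1 / \<delta> x) \<in> fractions X \<delta> D"
  using assms by (intro fractionsI[where e = 1 and P = "\<lambda>_. 1"] poly_funs.const) auto

lemma fractions_compose:
  assumes "\<delta> \<in> poly_funs X" "f \<in> poly_funs Y"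
    and "\<And>y. y \<in> Y \<Longrightarrow> (\<lambda>x. y (\<gamma> x)) \<in> fractions X \<delta> D"
  shows "(\<lambda>x. f (\<gamma> x)) \<in> fractions X \<delta> D"
  using assms(2,3)
  by (induction rule: poly_funs.induct)
     (auto intro: poly_funs_in_fractions poly_funs.const fractions_add[OF assms(1)] fractions_mult)

section \<open>Irreducible subsets and their chains\<close>

text \<open>
  The vanishing ideal is prime.  For closed sets this is irreducibility, but it also makes sense for
  sets that are not closed, such as the image of a parametrisation.
\<close>

definition prime_locus :: "('x \<Rightarrow> 'k::idom) set \<Rightarrow> 'x set \<Rightarrow> bool" where
  "prime_locus X S \<longleftrightarrow> S \<noteq> {} \<and>
     (\<forall>f\<in>poly_funs X. \<forall>g\<in>poly_funs X.
        (\<forall>s\<in>S. f s * g s = 0) \<longrightarrow> (\<forall>s\<in>S. f s = 0) \<or> (\<forall>s\<in>S. g s = 0))"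

lemma prime_locusD:
  assumes "prime_locus X S" "f \<in> poly_funs X" "g \<in> poly_funs X" "\<forall>s\<in>S. f s * g s = 0"
  shows "(\<forall>s\<in>S. f s = 0) \<or> (\<forall>s\<in>S. g s = 0)"
  using assms unfolding prime_locus_def by blast

definition zariski_closure :: "'x set \<Rightarrow> ('x \<Rightarrow> 'k::idom) set \<Rightarrow> 'x set \<Rightarrow> 'x set" where
  "zariski_closure V X S = zero_locus V {f \<in> poly_funs X. \<forall>s\<in>S. f s = 0}"

lemma closedin_zariski_closure: "closedin (zariski V X) (zariski_closure V X S)"
  unfolding closedin_zariski zariski_closure_def by (rule exI, rule conjI[OF _ refl]) simp

lemma zariski_closure_superset: "S \<subseteq> V \<Longrightarrow> S \<subseteq> zariski_closure V X S"
  by (auto simp: zariski_closure_def zero_locus_def)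

lemma vanish_on_zariski_closure:
  assumes "S \<subseteq> V" "f \<in> poly_funs X"
  shows "(\<forall>z\<in>zariski_closure V X S. f z = 0) \<longleftrightarrow> (\<forall>s\<in>S. f s = 0)"
  using assms by (auto simp: zariski_closure_def zero_locus_def)

lemma prime_locus_zariski_closure:
  assumes "S \<subseteq> V" "prime_locus X S"
  shows "prime_locus X (zariski_closure V X S)"
proof -
  note van = vanish_on_zariski_closure[OF assms(1)]
  show ?thesis
    unfolding prime_locus_def
  proof (intro conjI ballI impI)
    show "zariski_closure V X S \<noteq> {}"
      using assms zariski_closure_superset[OF assms(1), of X] unfolding prime_locus_def by blast
    fix f g assume fg: "f \<in> poly_funs X" "g \<in> poly_funs X"
      "\<forall>z\<in>zariski_closure V X S. f z * g z = 0"
    then have "\<forall>s\<in>S. f s * g s = 0" using van[OF poly_funs.mult[OF fg(1,2)]] by blast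
    then show "(\<forall>z\<in>zariski_closure V X S. f z = 0) \<or> (\<forall>z\<in>zariski_closure V X S. g z = 0)"
      using prime_locusD[OF assms(2) fg(1,2)] van[OF fg(1)] van[OF fg(2)] by blast
  qed
qed

lemma closedin_zariski_subset: "closedin (zariski V X) Z \<Longrightarrow> Z \<subseteq> V"
  using closedin_subset by fastforce

lemma closedin_zariski_cut:
  assumes "closedin (zariski V X) Z" "f \<in> poly_funs X"
  shows "closedin (zariski V X) {z \<in> Z. f z = 0}"
proof -
  obtain S where S: "S \<subseteq> poly_funs X" "Z = zero_locus V S"
    using assms(1) unfolding closedin_zariski by blast
  have "{z \<in> Z. f z = 0} = zero_locus V (insert f S)"
    unfolding S by (auto simp: zero_locus_def)
  moreover have "insert f S \<subseteq> poly_funs X" using S assms(2) by auto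
  ultimately show ?thesis unfolding closedin_zariski by (intro exI[of _ "insert f S"]) simp
qed

lemma closedin_zariski_separate:
  assumes "closedin (zariski V X) Z" "x \<in> V" "x \<notin> Z"
  obtains f where "f \<in> poly_funs X" "\<forall>z\<in>Z. f z = 0" "f x \<noteq> 0"
proof -
  obtain S where S: "S \<subseteq> poly_funs X" "Z = zero_locus V S"
    using assms(1) unfolding closedin_zariski by blast
  then show ?thesis using that assms(2,3) unfolding zero_locus_def by blast
qed

lemma irreducible_space_iff_prime_locus:
  assumes Z: "closedin (zariski V X) Z"
  shows "irreducible_space (subtopology (zariski V X) Z) \<longleftrightarrow> prime_locus X Z"
proof -
  have sub: "Z \<subseteq> V" using Z by (rule closedin_zariski_subset)
  then have top: "topspace (subtopology (zariski V X) Z) = Z" by auto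
  have cl: "closedin (subtopology (zariski V X) Z) W \<longleftrightarrow> closedin (zariski V X) W \<and> W \<subseteq> Z" for W
    using closedin_closed_subtopology[OF Z] .
  show ?thesis
  proof
    assume irr: "irreducible_space (subtopology (zariski V X) Z)"
    show "prime_locus X Z"
      unfolding prime_locus_def
    proof (intro conjI ballI impI)
      show "Z \<noteq> {}" using irr top unfolding irreducible_space_def by simp
      fix f g assume fg: "f \<in> poly_funs X" "g \<in> poly_funs X" "\<forall>s\<in>Z. f s * g s = 0"
      let ?F = "{z \<in> Z. f z = 0}" and ?G = "{z \<in> Z. g z = 0}"
      have "closedin (zariski V X) ?F" "closedin (zariski V X) ?G"
        using closedin_zariski_cut[OF Z] fg by auto
      moreover have "Z = ?F \<union> ?G" using fg(3) by auto
      moreover have "?F \<subseteq> Z" "?G \<subseteq> Z" by auto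
      ultimately have "?F = Z \<or> ?G = Z"
        using irr[unfolded irreducible_space_def top cl, THEN conjunct2, rule_format, of ?F ?G]
        by simp
      then show "(\<forall>s\<in>Z. f s = 0) \<or> (\<forall>s\<in>Z. g s = 0)" by blast
    qed
  next
    assume pr: "prime_locus X Z"
    show "irreducible_space (subtopology (zariski V X) Z)"
      unfolding irreducible_space_def top cl
    proof (intro conjI allI impI)
      show "Z \<noteq> {}" using pr unfolding prime_locus_def by simp
      fix F G
      assume FG: "(closedin (zariski V X) F \<and> F \<subseteq> Z) \<and> (closedin (zariski V X) G \<and> G \<subseteq> Z) \<and> Z = F \<union> G"
      show "F = Z \<or> G = Z"
      proof (rule ccontr)
        assume "\<not> (F = Z \<or> G = Z)"
        then obtain x y where xy: "x \<in> Z" "x \<notin> F" "y \<in> Z" "y \<notin> G" using FG by blast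
        obtain f where f: "f \<in> poly_funs X" "\<forall>z\<in>F. f z = 0" "f x \<noteq> 0"
          using closedin_zariski_separate[of V X F x] FG xy sub by blast
        obtain g where g: "g \<in> poly_funs X" "\<forall>z\<in>G. g z = 0" "g y \<noteq> 0"
          using closedin_zariski_separate[of V X G y] FG xy sub by blast
        have "\<forall>s\<in>Z. f s * g s = 0" using f g FG by auto
        then show False using prime_locusD[OF pr f(1) g(1)] f(3) g(3) xy by blast
      qed
    qed
  qed
qed

definition prime_chain :: "'x set \<Rightarrow> ('x \<Rightarrow> 'k::idom) set \<Rightarrow> 'x set \<Rightarrow> nat \<Rightarrow> (nat \<Rightarrow> 'x set) \<Rightarrow> bool" where
  "prime_chain V X C m Z \<longleftrightarrow>
     (\<forall>i\<le>m. closedin (zariski V X) (Z i) \<and> Z i \<subseteq> C \<and> prime_locus X (Z i)) \<and>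
     (\<forall>i<m. Z i \<subset> Z (Suc i))"

lemma krull_dim_zariski:
  assumes C: "closedin (zariski V X) C"
  shows "krull_dim (subtopology (zariski V X) C) = Sup {enat m | m. \<exists>Z. prime_chain V X C m Z}"
proof -
  have "closedin (subtopology (zariski V X) C) W \<and>
          irreducible_space (subtopology (subtopology (zariski V X) C) W) \<longleftrightarrow>
        closedin (zariski V X) W \<and> W \<subseteq> C \<and> prime_locus X W" for W
  proof -
    have "subtopology (subtopology (zariski V X) C) W = subtopology (zariski V X) W" if "W \<subseteq> C"
      using that by (simp add: subtopology_subtopology Int_absorb1)
    then show ?thesis
      using closedin_closed_subtopology[OF C, of W] irreducible_space_iff_prime_locus by metis
  qed
  then show ?thesis unfolding krull_dim_def prime_chain_def by simp
qed

text \<open>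
  On \<open>Z'\<close> only the lowest coefficient \<open>h 0\<close> of the sum remains.  So it vanishes there, and by
  the assumption on the coefficients it vanishes everywhere.  The other terms can be divided by \<open>g\<close>
  because \<open>Z\<close> is irreducible, and the argument is repeated.
\<close>

lemma coeffs_vanish_if_power_sum_vanishes:
  fixes g :: "'x \<Rightarrow> 'k::idom"
  assumes "prime_locus X Z" "Z' \<subseteq> Z" "g \<in> poly_funs X" "\<forall>z\<in>Z'. g z = 0" "\<not> (\<forall>z\<in>Z. g z = 0)"
    and "\<And>k. k < d \<Longrightarrow> h k \<in> poly_funs X"
    and "\<And>k. k < d \<Longrightarrow> (\<forall>z\<in>Z'. h k z = 0) \<Longrightarrow> (\<forall>z. h k z = 0)"
    and "\<forall>z\<in>Z. (\<Sum>k<d. h k z * g z ^ k) = 0"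
  shows "\<forall>k<d. \<forall>z. h k z = 0"
  using assms(6-8)
proof (induction d arbitrary: h)
  case (Suc d)
  let ?S = "\<lambda>z. \<Sum>k<d. h (Suc k) z * g z ^ k"
  have split: "(\<Sum>k<Suc d. h k z * g z ^ k) = h 0 z + g z * ?S z" for z
    unfolding sum.lessThan_Suc_shift by (simp add: sum_distrib_left algebra_simps)
  have "\<forall>z\<in>Z'. h 0 z = 0"
  proof
    fix z assume "z \<in> Z'"
    then have "h 0 z + g z * ?S z = 0" "g z = 0"
      using Suc.prems(3) assms(2,4) unfolding split by blast+
    then show "h 0 z = 0" by simp
  qed
  then have h0: "\<forall>z. h 0 z = 0" using Suc.prems(2)[of 0] by auto
  then have zero: "\<forall>z\<in>Z. g z * ?S z = 0" using Suc.prems(3) unfolding split by auto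
  have mem: "?S \<in> poly_funs X"
    by (intro poly_funs_sum poly_funs.mult poly_funs_power assms(3) Suc.prems(1)) auto
  have rest: "\<forall>z\<in>Z. ?S z = 0"
    using prime_locusD[OF assms(1) assms(3) mem zero] assms(5) by blast
  have "\<forall>k<d. \<forall>z. h (Suc k) z = 0"
  proof (rule Suc.IH)
    show "h (Suc k) \<in> poly_funs X" if "k < d" for k using Suc.prems(1) that by simp
    show "\<forall>z. h (Suc k) z = 0" if "k < d" "\<forall>z\<in>Z'. h (Suc k) z = 0" for k
      using Suc.prems(2)[of "Suc k"] that by simp
    show "\<forall>z\<in>Z. ?S z = 0" by (rule rest)
  qed
  then show ?case using h0 by (metis Suc_less_eq not0_implies_Suc)
qed simp

text \<open>
  Exponent vectors are extensional functions, so that there are exactly \<open>d ^ card I\<close> of them.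
\<close>

abbreviation exponents :: "'i set \<Rightarrow> nat \<Rightarrow> ('i \<Rightarrow> nat) set" where
  "exponents I d \<equiv> PiE I (\<lambda>_. {..<d})"

lemma sum_exponents_lessThan_Suc:
  "(\<Sum>\<alpha>\<in>exponents {..<Suc m} d. F \<alpha>) = (\<Sum>k<d. \<Sum>\<beta>\<in>exponents {..<m} d. F (\<beta>(m := k)))"
proof -
  have "exponents {..<Suc m} d = (\<lambda>(k, \<beta>). \<beta>(m := k)) ` ({..<d} \<times> exponents {..<m} d)"
    unfolding lessThan_Suc by (rule PiE_insert_eq)
  moreover have "inj_on (\<lambda>(k, \<beta>). \<beta>(m := k)) ({..<d} \<times> exponents {..<m} d)"
    by (rule inj_combinator) simp
  ultimately have "(\<Sum>\<alpha>\<in>exponents {..<Suc m} d. F \<alpha>)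
      = (\<Sum>(k, \<beta>)\<in>{..<d} \<times> exponents {..<m} d. F (\<beta>(m := k)))"
    by (simp add: sum.reindex case_prod_unfold)
  then show ?thesis by (simp add: sum.cartesian_product)
qed

text \<open>
  Choose \<open>g i\<close> vanishing on \<open>Z i\<close> but not on \<open>Z (Suc i)\<close>.  These functions are algebraically
  independent on the top of the chain: sort a relation by powers of the last function; its
  coefficients are relations between the other functions on the next smaller set.
\<close>

lemma prime_chain_algebraically_independent:
  fixes X :: "('x \<Rightarrow> 'k::idom) set"
  assumes "prime_chain V X C m Z"
  obtains g where "\<And>i. i < m \<Longrightarrow> g i \<in> poly_funs X"
    and "\<And>d c. \<forall>z\<in>Z m. (\<Sum>\<alpha>\<in>exponents {..<m} d. c \<alpha> * (\<Prod>i<m. g i z ^ \<alpha> i)) = 0 \<Longrightarrow>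
           \<forall>\<alpha>\<in>exponents {..<m} d. c \<alpha> = 0"
  using assms
proof (induction m arbitrary: thesis)
  case 0
  then obtain z where "z \<in> Z 0" unfolding prime_chain_def prime_locus_def by auto
  then show ?case using "0.prems"(1)[of "\<lambda>_ _. 0"] by auto
next
  case (Suc m)
  have ch: "prime_chain V X C m Z" using Suc.prems(2) unfolding prime_chain_def by auto
  obtain g where g: "\<And>i. i < m \<Longrightarrow> g i \<in> poly_funs X"
    and ind: "\<And>d c. \<forall>z\<in>Z m. (\<Sum>\<alpha>\<in>exponents {..<m} d. c \<alpha> * (\<Prod>i<m. g i z ^ \<alpha> i)) = 0 \<Longrightarrow>
           \<forall>\<alpha>\<in>exponents {..<m} d. c \<alpha> = 0"
    using Suc.IH[OF _ ch] by blast
  have Z: "closedin (zariski V X) (Z m)" "Z m \<subset> Z (Suc m)" "prime_locus X (Z (Suc m))"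
    "Z (Suc m) \<subseteq> V"
    using Suc.prems(2) closedin_zariski_subset unfolding prime_chain_def by auto
  then obtain x where x: "x \<in> Z (Suc m)" "x \<notin> Z m" by blast
  then obtain f where f: "f \<in> poly_funs X" "\<forall>z\<in>Z m. f z = 0" "f x \<noteq> 0"
    using closedin_zariski_separate[OF Z(1)] Z(4) by blast
  define g' where "g' = g(m := f)"
  show ?case
  proof (rule Suc.prems(1)[of g'])
    show "g' i \<in> poly_funs X" if "i < Suc m" for i
      using that f g unfolding g'_def by (auto simp: less_Suc_eq)
    fix d c
    assume zero: "\<forall>z\<in>Z (Suc m). (\<Sum>\<alpha>\<in>exponents {..<Suc m} d. c \<alpha> * (\<Prod>i<Suc m. g' i z ^ \<alpha> i)) = 0"
    define h where "h k z = (\<Sum>\<beta>\<in>exponents {..<m} d. c (\<beta>(m := k)) * (\<Prod>i<m. g i z ^ \<beta> i))" for k z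
    have "c (\<beta>(m := k)) * (\<Prod>i<Suc m. g' i z ^ (\<beta>(m := k)) i)
        = c (\<beta>(m := k)) * (\<Prod>i<m. g i z ^ \<beta> i) * f z ^ k" for \<beta> k z
    proof -
      have "(\<Prod>i<m. g' i z ^ (\<beta>(m := k)) i) = (\<Prod>i<m. g i z ^ \<beta> i)"
        by (rule prod.cong) (auto simp: g'_def)
      then show ?thesis by (simp add: g'_def)
    qed
    then have "(\<Sum>\<alpha>\<in>exponents {..<Suc m} d. c \<alpha> * (\<Prod>i<Suc m. g' i z ^ \<alpha> i))
        = (\<Sum>k<d. h k z * f z ^ k)" for z
      unfolding sum_exponents_lessThan_Suc h_def sum_distrib_right by (simp only:)
    then have zero': "\<forall>z\<in>Z (Suc m). (\<Sum>k<d. h k z * f z ^ k) = 0" using zero by simp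
    have hc: "\<forall>\<beta>\<in>exponents {..<m} d. c (\<beta>(m := k)) = 0" if "\<forall>z\<in>Z m. h k z = 0" for k
      using ind[where d = d and c = "\<lambda>\<beta>. c (\<beta>(m := k))"] that unfolding h_def by blast
    have "\<forall>k<d. \<forall>z. h k z = 0"
    proof (rule coeffs_vanish_if_power_sum_vanishes[OF Z(3) _ f(1,2) _ _ _ zero'])
      show "Z m \<subseteq> Z (Suc m)" using Z(2) by blast
      show "\<not> (\<forall>z\<in>Z (Suc m). f z = 0)" using x f by blast
      show "h k \<in> poly_funs X" for k
        unfolding h_def
        by (intro poly_funs_sum poly_funs.mult poly_funs.const poly_funs_prod poly_funs_power g) auto
      show "\<forall>z. h k z = 0" if "\<forall>z\<in>Z m. h k z = 0" for k
        using hc[OF that] unfolding h_def by simp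
    qed
    then have *: "\<forall>k<d. \<forall>\<beta>\<in>exponents {..<m} d. c (\<beta>(m := k)) = 0" using hc by blast
    show "\<forall>\<alpha>\<in>exponents {..<Suc m} d. c \<alpha> = 0"
      using * unfolding lessThan_Suc PiE_insert_eq by auto
  qed
qed

section \<open>Counting monomials\<close>

text \<open>
  Eliminate one unknown by means of an equation in which it occurs.
\<close>

lemma homogeneous_system_nontrivial_solution:
  fixes a :: "'i \<Rightarrow> 'j \<Rightarrow> 'k::field"
  assumes "finite I" "finite J" "card I < card J"
  shows "\<exists>c. (\<exists>j\<in>J. c j \<noteq> 0) \<and> (\<forall>i\<in>I. (\<Sum>j\<in>J. a i j * c j) = 0)"
  using assms
proof (induction I arbitrary: a J)
  case empty
  then have "J \<noteq> {}" by auto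
  then show ?case by (intro exI[of _ "\<lambda>_. 1"]) auto
next
  case (insert i I)
  show ?case
  proof (cases "\<forall>j\<in>J. a i j = 0")
    case True
    have "card I < card J" using insert by simp
    then obtain c where "\<exists>j\<in>J. c j \<noteq> 0" "\<forall>i\<in>I. (\<Sum>j\<in>J. a i j * c j) = 0"
      using insert.IH[of J a] insert.prems by blast
    then show ?thesis using True by (intro exI[of _ c]) auto
  next
    case False
    then obtain j0 where j0: "j0 \<in> J" "a i j0 \<noteq> 0" by blast
    define b where "b i' j = a i' j - a i' j0 * a i j / a i j0" for i' j
    have "card I < card (J - {j0})" using insert j0 by simp
    then obtain c where c: "\<exists>j\<in>J - {j0}. c j \<noteq> 0" "\<forall>i'\<in>I. (\<Sum>j\<in>J - {j0}. b i' j * c j) = 0"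
      using insert.IH[of "J - {j0}" b] insert.prems by blast
    define s where "s = (\<Sum>j\<in>J - {j0}. a i j * c j)"
    define c' where "c' = c(j0 := - s / a i j0)"
    have sum: "(\<Sum>j\<in>J. a i' j * c' j) = (\<Sum>j\<in>J - {j0}. a i' j * c j) - a i' j0 * s / a i j0" for i'
    proof -
      have "(\<Sum>j\<in>J. a i' j * c' j) = a i' j0 * c' j0 + (\<Sum>j\<in>J - {j0}. a i' j * c' j)"
        using insert.prems j0 by (intro sum.remove) auto
      also have "(\<Sum>j\<in>J - {j0}. a i' j * c' j) = (\<Sum>j\<in>J - {j0}. a i' j * c j)"
        by (rule sum.cong) (auto simp: c'_def)
      finally show ?thesis by (simp add: c'_def)
    qed
    have "(\<Sum>j\<in>J. a i' j * c' j) = 0" if "i' \<in> I" for i'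
    proof -
      have "(\<Sum>j\<in>J - {j0}. b i' j * c j)
          = (\<Sum>j\<in>J - {j0}. a i' j * c j - (a i' j0 / a i j0) * (a i j * c j))"
        by (rule sum.cong) (auto simp: b_def algebra_simps)
      also have "\<dots> = (\<Sum>j\<in>J - {j0}. a i' j * c j) - a i' j0 * s / a i j0"
        unfolding s_def sum_subtractf sum_distrib_left[symmetric] by simp
      finally show ?thesis using c(2) that sum by simp
    qed
    moreover have "(\<Sum>j\<in>J. a i j * c' j) = 0"
      using sum[of i] j0 by (simp add: s_def)
    moreover have "\<exists>j\<in>J. c' j \<noteq> 0" using c(1) by (auto simp: c'_def)
    ultimately show ?thesis by (intro exI[of _ c']) auto
  qed
qed

text \<open>
  The exponent of each variable is bounded separately, rather than the total degree: this makes the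
  number of monomials a plain power.
\<close>

definition monomial_span :: "('x \<Rightarrow> 'k::comm_ring_1) set \<Rightarrow> nat \<Rightarrow> ('x \<Rightarrow> 'k) set" where
  "monomial_span X d =
     {f. \<exists>a. \<forall>x. f x = (\<Sum>\<beta>\<in>exponents X (Suc d). a \<beta> * (\<Prod>y\<in>X. y x ^ \<beta> y))}"

lemma finite_exponents: "finite I \<Longrightarrow> finite (exponents I d)"
  by (intro finite_PiE) auto

context
  fixes X :: "('x \<Rightarrow> 'k::comm_ring_1) set"
  assumes finX: "finite X"
begin

lemma monomial_in_span:
  assumes "\<And>y. y \<in> X \<Longrightarrow> \<beta> y \<le> d"
  shows "(\<lambda>x. c * (\<Prod>y\<in>X. y x ^ \<beta> y)) \<in> monomial_span X d"
proof -
  let ?\<beta> = "restrict \<beta> X"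
  let ?a = "\<lambda>\<gamma>. if \<gamma> = ?\<beta> then c else 0"
  have mem: "?\<beta> \<in> exponents X (Suc d)" using assms by (auto simp: less_Suc_eq_le)
  have "c * (\<Prod>y\<in>X. y x ^ \<beta> y)
      = (\<Sum>\<gamma>\<in>exponents X (Suc d). ?a \<gamma> * (\<Prod>y\<in>X. y x ^ \<gamma> y))" for x
  proof -
    have "(\<Sum>\<gamma>\<in>exponents X (Suc d). ?a \<gamma> * (\<Prod>y\<in>X. y x ^ \<gamma> y))
        = (\<Sum>\<gamma>\<in>{?\<beta>}. ?a \<gamma> * (\<Prod>y\<in>X. y x ^ \<gamma> y))"
      using mem by (intro sum.mono_neutral_right finite_exponents finX) auto
    then show ?thesis by simp
  qed
  then show ?thesis unfolding monomial_span_def by (intro CollectI exI[of _ ?a] allI)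
qed

lemma monomial_span_add:
  assumes "f \<in> monomial_span X d" "g \<in> monomial_span X d"
  shows "(\<lambda>x. f x + g x) \<in> monomial_span X d"
proof -
  obtain a b where "\<forall>x. f x = (\<Sum>\<beta>\<in>exponents X (Suc d). a \<beta> * (\<Prod>y\<in>X. y x ^ \<beta> y))"
    "\<forall>x. g x = (\<Sum>\<beta>\<in>exponents X (Suc d). b \<beta> * (\<Prod>y\<in>X. y x ^ \<beta> y))"
    using assms unfolding monomial_span_def by blast
  then have "\<forall>x. f x + g x = (\<Sum>\<beta>\<in>exponents X (Suc d). (a \<beta> + b \<beta>) * (\<Prod>y\<in>X. y x ^ \<beta> y))"
    by (simp add: distrib_right sum.distrib)
  then show ?thesis unfolding monomial_span_def by (intro CollectI exI[of _ "\<lambda>\<beta>. a \<beta> + b \<beta>"])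
qed

lemma monomial_span_const: "(\<lambda>_. c) \<in> monomial_span X d"
  using monomial_in_span[of "\<lambda>_. 0" d c] by simp

lemma monomial_span_sum:
  assumes "\<And>i. i \<in> I \<Longrightarrow> f i \<in> monomial_span X d"
  shows "(\<lambda>x. \<Sum>i\<in>I. f i x) \<in> monomial_span X d"
  using assms
  by (induction I rule: infinite_finite_induct) (auto intro: monomial_span_add monomial_span_const)

lemma monomial_span_mult:
  assumes "f \<in> monomial_span X d" "g \<in> monomial_span X e"
  shows "(\<lambda>x. f x * g x) \<in> monomial_span X (d + e)"
proof -
  obtain a b where ab: "\<forall>x. f x = (\<Sum>\<beta>\<in>exponents X (Suc d). a \<beta> * (\<Prod>y\<in>X. y x ^ \<beta> y))"
    "\<forall>x. g x = (\<Sum>\<gamma>\<in>exponents X (Suc e). b \<gamma> * (\<Prod>y\<in>X. y x ^ \<gamma> y))"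
    using assms unfolding monomial_span_def by blast
  have "f x * g x = (\<Sum>\<beta>\<in>exponents X (Suc d). \<Sum>\<gamma>\<in>exponents X (Suc e).
      (a \<beta> * b \<gamma>) * (\<Prod>y\<in>X. y x ^ (\<beta> y + \<gamma> y)))" for x
    unfolding ab(1)[rule_format] ab(2)[rule_format] sum_product
    by (simp add: power_add prod.distrib algebra_simps)
  moreover have "(\<lambda>x. \<Sum>\<beta>\<in>exponents X (Suc d). \<Sum>\<gamma>\<in>exponents X (Suc e).
      (a \<beta> * b \<gamma>) * (\<Prod>y\<in>X. y x ^ (\<beta> y + \<gamma> y))) \<in> monomial_span X (d + e)"
    by (intro monomial_span_sum monomial_in_span add_mono) (auto simp: PiE_iff less_Suc_eq_le)
  ultimately show ?thesis by simp
qed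

lemma monomial_span_mono:
  assumes "f \<in> monomial_span X d" "d \<le> e"
  shows "f \<in> monomial_span X e"
  using monomial_span_mult[OF assms(1) monomial_span_const[of 1 "e - d"]] assms(2) by simp

lemma monomial_span_power:
  assumes "f \<in> monomial_span X d"
  shows "(\<lambda>x. f x ^ e) \<in> monomial_span X (e * d)"
proof (induction e)
  case 0
  then show ?case using monomial_span_const by simp
next
  case (Suc e)
  then show ?case using monomial_span_mult[OF assms Suc] by simp
qed

lemma monomial_span_prod:
  assumes "\<And>i. i \<in> I \<Longrightarrow> f i \<in> monomial_span X d"
  shows "(\<lambda>x. \<Prod>i\<in>I. f i x) \<in> monomial_span X (card I * d)"
  using assms
proof (induction I rule: infinite_finite_induct)
  case (insert i I)
  have "(\<lambda>x. f i x * (\<Prod>i\<in>I. f i x)) \<in> monomial_span X (d + card I * d)"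
    using insert by (intro monomial_span_mult) auto
  then show ?case using insert.hyps by simp
qed (use monomial_span_const in auto)

lemma poly_funs_in_monomial_span:
  assumes "f \<in> poly_funs X"
  shows "\<exists>d. f \<in> monomial_span X d"
  using assms
proof (induction rule: poly_funs.induct)
  case (const c)
  then show ?case using monomial_span_const by blast
next
  case (coord f)
  let ?\<beta> = "\<lambda>y. if y = f then 1 else 0"
  have "(\<Prod>y\<in>X. y x ^ ?\<beta> y) = f x" for x
  proof -
    have "(\<Prod>y\<in>X. y x ^ ?\<beta> y) = (\<Prod>y\<in>X. if y = f then y x else 1)"
      by (rule prod.cong) auto
    then show ?thesis using coord finX by (simp add: prod.delta)
  qed
  then have "f \<in> monomial_span X 1"
    using monomial_in_span[of ?\<beta> 1 1] by simp
  then show ?case by blast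
next
  case (add f g)
  then obtain d e where "f \<in> monomial_span X d" "g \<in> monomial_span X e" by blast
  then have "(\<lambda>x. f x + g x) \<in> monomial_span X (d + e)"
    by (intro monomial_span_add) (auto elim: monomial_span_mono)
  then show ?case by blast
next
  case (mult f g)
  then show ?case using monomial_span_mult by blast
qed

end

lemma card_exponents: "finite I \<Longrightarrow> card (exponents I d) = d ^ card I"
  by (simp add: card_PiE)

lemma power_outgrows_linear_power:
  fixes L N m :: nat
  assumes "N < m"
  shows "\<exists>d. (L * d + 1) ^ N < d ^ m"
proof -
  define d where "d = (L + 1) ^ N + 1"
  have "(L * d + 1) ^ N \<le> ((L + 1) * d) ^ N"
    by (intro power_mono) (auto simp: d_def)
  also have "\<dots> = (L + 1) ^ N * d ^ N" by (rule power_mult_distrib)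
  also have "\<dots> < d * d ^ N" by (rule mult_strict_right_mono) (auto simp: d_def)
  also have "\<dots> = d ^ Suc N" by simp
  also have "\<dots> \<le> d ^ m" using assms by (intro power_increasing) (auto simp: d_def)
  finally show ?thesis by blast
qed

text \<open>
  More than \<open>card X\<close> fractions are algebraically dependent, since \<open>d ^ m\<close> monomials in the
  fractions become, after clearing denominators, polynomials with \<open>O(d ^ card X)\<close> coefficients.
\<close>

lemma fractions_algebraically_dependent:
  fixes X :: "('x \<Rightarrow> 'k::field) set"
  assumes X: "finite X" "card X < m" and \<delta>: "\<delta> \<in> poly_funs X"
    and nz: "\<And>x. x \<in> D \<Longrightarrow> \<delta> x \<noteq> 0"
    and u: "\<And>i. i < m \<Longrightarrow> u i \<in> fractions X \<delta> D"
  shows "\<exists>d c. (\<exists>\<alpha>\<in>exponents {..<m} d. c \<alpha> \<noteq> 0) \<and>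
    (\<forall>x\<in>D. (\<Sum>\<alpha>\<in>exponents {..<m} d. c \<alpha> * (\<Prod>i<m. u i x ^ \<alpha> i)) = 0)"
proof -
  have "\<forall>i. \<exists>e. \<exists>P. i < m \<longrightarrow> P \<in> poly_funs X \<and> (\<forall>x\<in>D. u i x * \<delta> x ^ e = P x)"
    using u unfolding fractions_def by blast
  then obtain e P where eP: "\<And>i. i < m \<Longrightarrow> P i \<in> poly_funs X"
    "\<And>i x. i < m \<Longrightarrow> x \<in> D \<Longrightarrow> u i x * \<delta> x ^ e i = P i x" by metis
  define E where "E = (\<Sum>i<m. e i)"
  define Q where "Q i x = P i x * \<delta> x ^ (E - e i)" for i x
  have Q: "Q i \<in> poly_funs X" if "i < m" for i
    unfolding Q_def by (intro poly_funs.mult eP poly_funs_power \<delta> that)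
  have uQ: "u i x * \<delta> x ^ E = Q i x" if "i < m" "x \<in> D" for i x
  proof -
    have "e i \<le> E" unfolding E_def using that by (intro member_le_sum) auto
    then have "\<delta> x ^ E = \<delta> x ^ e i * \<delta> x ^ (E - e i)" by (simp flip: power_add)
    then show ?thesis using eP(2)[OF that] unfolding Q_def by (metis mult.assoc)
  qed
  have "\<forall>i. \<exists>k. i < m \<longrightarrow> Q i \<in> monomial_span X k"
    using poly_funs_in_monomial_span[OF X(1) Q] by blast
  then obtain k where k: "\<And>i. i < m \<Longrightarrow> Q i \<in> monomial_span X (k i)" by metis
  obtain k' where k': "\<delta> \<in> monomial_span X k'"
    using poly_funs_in_monomial_span[OF X(1) \<delta>] by blast
  define K where "K = k' + (\<Sum>i<m. k i)"
  have QK: "Q i \<in> monomial_span X K" if "i < m" for i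
  proof -
    have "k i \<le> K" unfolding K_def using that member_le_sum[of i "{..<m}" k] by auto
    then show ?thesis using monomial_span_mono[OF X(1) k[OF that]] by blast
  qed
  have \<delta>K: "\<delta> \<in> monomial_span X K" using monomial_span_mono[OF X(1) k'] K_def by simp
  define L where "L = m * (K + E * K)"
  obtain d where d: "(L * d + 1) ^ card X < d ^ m"
    using power_outgrows_linear_power[OF X(2)] by blast
  \<comment> \<open>The factors \<open>\<delta> x ^ (E * (d - \<alpha> i))\<close> give all monomials the same denominator.\<close>
  define R where "R \<alpha> x = (\<Prod>i<m. Q i x ^ \<alpha> i * \<delta> x ^ (E * (d - \<alpha> i)))" for \<alpha> x
  have "R \<alpha> \<in> monomial_span X (L * d)" if \<alpha>: "\<alpha> \<in> exponents {..<m} d" for \<alpha>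
  proof -
    have "(\<lambda>x. Q i x ^ \<alpha> i * \<delta> x ^ (E * (d - \<alpha> i))) \<in> monomial_span X (d * (K + E * K))"
      if i: "i < m" for i
    proof -
      have "\<alpha> i \<le> d" using \<alpha> i by (auto simp: PiE_iff intro: less_imp_le)
      then have "\<alpha> i * K \<le> d * K" "(d - \<alpha> i) * (E * K) \<le> d * (E * K)"
        by (intro mult_right_mono; simp)+
      moreover have "E * (d - \<alpha> i) * K = (d - \<alpha> i) * (E * K)"
        by (simp only: mult.assoc mult.left_commute)
      ultimately have le: "\<alpha> i * K + E * (d - \<alpha> i) * K \<le> d * (K + E * K)"
        unfolding distrib_left by (simp only: add_mono)
      show ?thesis
        by (rule monomial_span_mono[OF X(1) _ le])
           (intro monomial_span_mult[OF X(1)] monomial_span_power[OF X(1)] QK i \<delta>K)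
    qed
    then have "R \<alpha> \<in> monomial_span X (card {..<m} * (d * (K + E * K)))"
      unfolding R_def by (intro monomial_span_prod[OF X(1)]) auto
    then show ?thesis by (simp add: L_def algebra_simps)
  qed
  then have "\<forall>\<alpha>\<in>exponents {..<m} d. \<exists>a. \<forall>x.
      R \<alpha> x = (\<Sum>\<beta>\<in>exponents X (Suc (L * d)). a \<beta> * (\<Prod>y\<in>X. y x ^ \<beta> y))"
    unfolding monomial_span_def by blast
  from bchoice[OF this] obtain a where a: "\<And>\<alpha> x. \<alpha> \<in> exponents {..<m} d \<Longrightarrow>
      R \<alpha> x = (\<Sum>\<beta>\<in>exponents X (Suc (L * d)). a \<alpha> \<beta> * (\<Prod>y\<in>X. y x ^ \<beta> y))" by blast
  have "card (exponents X (Suc (L * d))) < card (exponents {..<m} d)"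
    using d by (simp add: card_exponents X(1))
  then obtain c where c: "\<exists>\<alpha>\<in>exponents {..<m} d. c \<alpha> \<noteq> 0"
    "\<forall>\<beta>\<in>exponents X (Suc (L * d)). (\<Sum>\<alpha>\<in>exponents {..<m} d. a \<alpha> \<beta> * c \<alpha>) = 0"
    using homogeneous_system_nontrivial_solution[OF finite_exponents[OF X(1)]
        finite_exponents[OF finite_lessThan], where a = "\<lambda>\<beta> \<alpha>. a \<alpha> \<beta>"] by blast
  have "(\<Sum>\<alpha>\<in>exponents {..<m} d. c \<alpha> * (\<Prod>i<m. u i x ^ \<alpha> i)) = 0" if x: "x \<in> D" for x
  proof -
    have "\<delta> x ^ (E * d * m) * (\<Prod>i<m. u i x ^ \<alpha> i) = R \<alpha> x" if \<alpha>: "\<alpha> \<in> exponents {..<m} d" for \<alpha>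
    proof -
      have "\<delta> x ^ (E * d) * u i x ^ \<alpha> i = Q i x ^ \<alpha> i * \<delta> x ^ (E * (d - \<alpha> i))" if i: "i < m" for i
      proof -
        have "\<alpha> i \<le> d" using \<alpha> i by (auto simp: PiE_iff intro: less_imp_le)
        then have "E * d = E * \<alpha> i + E * (d - \<alpha> i)" by (simp flip: distrib_left)
        then have "\<delta> x ^ (E * d) = (\<delta> x ^ E) ^ \<alpha> i * \<delta> x ^ (E * (d - \<alpha> i))"
          by (simp add: power_add power_mult)
        then show ?thesis
          unfolding uQ[OF i x, symmetric] by (simp add: power_mult_distrib algebra_simps)
      qed
      then have "R \<alpha> x = (\<Prod>i<m. \<delta> x ^ (E * d) * u i x ^ \<alpha> i)" unfolding R_def by simp
      also have "\<dots> = \<delta> x ^ (E * d * m) * (\<Prod>i<m. u i x ^ \<alpha> i)"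
        by (simp add: prod.distrib power_mult)
      finally show ?thesis by simp
    qed
    then have "\<delta> x ^ (E * d * m) * (\<Sum>\<alpha>\<in>exponents {..<m} d. c \<alpha> * (\<Prod>i<m. u i x ^ \<alpha> i))
        = (\<Sum>\<alpha>\<in>exponents {..<m} d. c \<alpha> * R \<alpha> x)"
      unfolding sum_distrib_left by (intro sum.cong) (auto simp: algebra_simps)
    also have "\<dots> = (\<Sum>\<alpha>\<in>exponents {..<m} d. \<Sum>\<beta>\<in>exponents X (Suc (L * d)).
        c \<alpha> * (a \<alpha> \<beta> * (\<Prod>y\<in>X. y x ^ \<beta> y)))"
      by (intro sum.cong refl) (simp add: a sum_distrib_left)
    also have "\<dots> = (\<Sum>\<beta>\<in>exponents X (Suc (L * d)). \<Sum>\<alpha>\<in>exponents {..<m} d.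
        c \<alpha> * (a \<alpha> \<beta> * (\<Prod>y\<in>X. y x ^ \<beta> y)))"
      by (rule sum.swap)
    also have "\<dots> = (\<Sum>\<beta>\<in>exponents X (Suc (L * d)).
        (\<Sum>\<alpha>\<in>exponents {..<m} d. a \<alpha> \<beta> * c \<alpha>) * (\<Prod>y\<in>X. y x ^ \<beta> y))"
      by (intro sum.cong refl) (simp add: sum_distrib_right sum_distrib_left mult_ac)
    also have "\<dots> = 0" using c(2) by simp
    finally show ?thesis using nz[OF x] by simp
  qed
  then show ?thesis using c(1) by blast
qed

section \<open>Varieties with a rational chart\<close>

definition coords :: "'i set \<Rightarrow> (('i \<Rightarrow> 'k) \<Rightarrow> 'k) set" where
  "coords I = (\<lambda>i \<xi>. \<xi> i) ` I"

lemma coord_poly_fun: "i \<in> I \<Longrightarrow> (\<lambda>\<xi>. \<xi> i) \<in> poly_funs (coords I)"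
  by (rule poly_funs.coord) (simp add: coords_def)

definition line_point :: "('i \<Rightarrow> 'k::comm_ring_1) \<Rightarrow> ('i \<Rightarrow> 'k) \<Rightarrow> 'k \<Rightarrow> 'i \<Rightarrow> 'k" where
  "line_point \<xi> \<eta> t = (\<lambda>i. \<xi> i + t * (\<eta> i - \<xi> i))"

lemma line_point_0 [simp]: "line_point \<xi> \<eta> 0 = \<xi>"
  and line_point_1 [simp]: "line_point \<xi> \<eta> 1 = \<eta>"
  by (auto simp: line_point_def)

lemma poly_funs_along_line:
  fixes f :: "('i \<Rightarrow> 'k::comm_ring_1) \<Rightarrow> 'k"
  assumes "f \<in> poly_funs (coords I)"
  shows "(\<lambda>t. f (line_point \<xi> \<eta> t)) \<in> poly_funs {\<lambda>t. t}"
proof (rule poly_funs_compose[OF assms])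
  fix y :: "('i \<Rightarrow> 'k) \<Rightarrow> 'k" assume "y \<in> coords I"
  then obtain i where "y = (\<lambda>\<xi>. \<xi> i)" by (auto simp: coords_def)
  then show "(\<lambda>t. y (line_point \<xi> \<eta> t)) \<in> poly_funs {\<lambda>t. t}"
    unfolding line_point_def
    by (simp only:) (intro poly_funs.add poly_funs.mult poly_funs.const poly_funs.coord, simp)
qed

lemma common_nonzero_on_line:
  fixes f g :: "('i \<Rightarrow> 'k::idom) \<Rightarrow> 'k"
  assumes "infinite (UNIV :: 'k set)" "f \<in> poly_funs (coords I)" "g \<in> poly_funs (coords I)"
    and "f \<xi> \<noteq> 0" "g \<eta> \<noteq> 0"
  shows "\<exists>t. f (line_point \<xi> \<eta> t) \<noteq> 0 \<and> g (line_point \<xi> \<eta> t) \<noteq> 0"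
proof -
  have "finite {t. f (line_point \<xi> \<eta> t) = 0}"
    using assms by (intro poly_funs_id_finite_zeros[where s = 0] poly_funs_along_line) auto
  moreover have "finite {t. g (line_point \<xi> \<eta> t) = 0}"
    using assms by (intro poly_funs_id_finite_zeros[where s = 1] poly_funs_along_line) auto
  ultimately show ?thesis by (rule finite_zeros_imp_common_nonzero[OF assms(1)])
qed

text \<open>
  \<open>\<phi>\<close> parametrises a dense part of the closed set \<open>C\<close> by the open set \<open>\<Delta> \<noteq> 0\<close> of affine space, and
  the parameters are recovered as quotients \<open>q i / h\<close> of polynomial functions.
\<close>

locale rational_chart =
  fixes V :: "'x set" and Y :: "('x \<Rightarrow> 'k::field) set" and C :: "'x set"
    and I :: "'i set" and \<Delta> :: "('i \<Rightarrow> 'k) \<Rightarrow> 'k" and \<phi> :: "('i \<Rightarrow> 'k) \<Rightarrow> 'x"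
    and q :: "'i \<Rightarrow> 'x \<Rightarrow> 'k" and h :: "'x \<Rightarrow> 'k" and \<xi>0 :: "'i \<Rightarrow> 'k"
  assumes inf: "infinite (UNIV :: 'k set)"
    and finI: "finite I"
    and closed: "closedin (zariski V Y) C"
    and \<Delta>: "\<Delta> \<in> poly_funs (coords I)"
    and base: "\<Delta> \<xi>0 \<noteq> 0"
    and range: "\<Delta> \<xi> \<noteq> 0 \<Longrightarrow> \<phi> \<xi> \<in> C"
    and regular: "y \<in> Y \<Longrightarrow> (\<lambda>\<xi>. y (\<phi> \<xi>)) \<in> fractions (coords I) \<Delta> {\<xi>. \<Delta> \<xi> \<noteq> 0}"
    and dense: "f \<in> poly_funs Y \<Longrightarrow> \<forall>\<xi>. \<Delta> \<xi> \<noteq> 0 \<longrightarrow> f (\<phi> \<xi>) = 0 \<Longrightarrow> z \<in> C \<Longrightarrow> f z = 0"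
    and param: "i \<in> I \<Longrightarrow> q i \<in> poly_funs Y" "h \<in> poly_funs Y"
      "\<Delta> \<xi> \<noteq> 0 \<Longrightarrow> h (\<phi> \<xi>) \<noteq> 0" "\<Delta> \<xi> \<noteq> 0 \<Longrightarrow> i \<in> I \<Longrightarrow> q i (\<phi> \<xi>) = \<xi> i * h (\<phi> \<xi>)"
begin

lemma C_subset: "C \<subseteq> V"
  using closed by (rule closedin_zariski_subset)

lemma pullback:
  assumes "f \<in> poly_funs Y"
  obtains e P where "P \<in> poly_funs (coords I)" "\<And>\<xi>. \<Delta> \<xi> \<noteq> 0 \<Longrightarrow> f (\<phi> \<xi>) * \<Delta> \<xi> ^ e = P \<xi>"
proof -
  have "(\<lambda>\<xi>. f (\<phi> \<xi>)) \<in> fractions (coords I) \<Delta> {\<xi>. \<Delta> \<xi> \<noteq> 0}"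
    by (rule fractions_compose[OF \<Delta> assms]) (rule regular)
  then show thesis using that unfolding fractions_def by blast
qed

text \<open>
  Two functions that do not vanish identically are compared on the line through a point where the
  first one is nonzero and a point where the second one is: a polynomial in one variable has
  only finitely many zeros.
\<close>

lemma prime_locus_image:
  assumes "\<xi>1 \<in> L" "\<Delta> \<xi>1 \<noteq> 0"
    and line: "\<And>\<xi> \<eta> t. \<xi> \<in> L \<Longrightarrow> \<eta> \<in> L \<Longrightarrow> line_point \<xi> \<eta> t \<in> L"
  shows "prime_locus Y (\<phi> ` {\<xi> \<in> L. \<Delta> \<xi> \<noteq> 0})"
  unfolding prime_locus_def
proof (intro conjI ballI impI)
  show "\<phi> ` {\<xi> \<in> L. \<Delta> \<xi> \<noteq> 0} \<noteq> {}" using assms by blast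
  fix f g assume f: "f \<in> poly_funs Y" and g: "g \<in> poly_funs Y"
    and zero: "\<forall>s\<in>\<phi> ` {\<xi> \<in> L. \<Delta> \<xi> \<noteq> 0}. f s * g s = 0"
  obtain d P where P: "P \<in> poly_funs (coords I)" "\<And>\<xi>. \<Delta> \<xi> \<noteq> 0 \<Longrightarrow> f (\<phi> \<xi>) * \<Delta> \<xi> ^ d = P \<xi>"
    using pullback[OF f] by blast
  obtain e Q where Q: "Q \<in> poly_funs (coords I)" "\<And>\<xi>. \<Delta> \<xi> \<noteq> 0 \<Longrightarrow> g (\<phi> \<xi>) * \<Delta> \<xi> ^ e = Q \<xi>"
    using pullback[OF g] by blast
  show "(\<forall>s\<in>\<phi> ` {\<xi> \<in> L. \<Delta> \<xi> \<noteq> 0}. f s = 0) \<or> (\<forall>s\<in>\<phi> ` {\<xi> \<in> L. \<Delta> \<xi> \<noteq> 0}. g s = 0)"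
  proof (rule ccontr)
    assume "\<not> ?thesis"
    then obtain \<xi> \<eta> where \<xi>: "\<xi> \<in> L" "\<Delta> \<xi> \<noteq> 0" "f (\<phi> \<xi>) \<noteq> 0"
      and \<eta>: "\<eta> \<in> L" "\<Delta> \<eta> \<noteq> 0" "g (\<phi> \<eta>) \<noteq> 0" by blast
    have "P \<xi> \<noteq> 0" "Q \<eta> \<noteq> 0"
      using P(2)[OF \<xi>(2)] Q(2)[OF \<eta>(2)] \<xi> \<eta> by auto
    then obtain t where "\<Delta> (line_point \<xi> \<eta> t) * P (line_point \<xi> \<eta> t) \<noteq> 0" "Q (line_point \<xi> \<eta> t) \<noteq> 0"
      using common_nonzero_on_line[OF inf poly_funs.mult[OF \<Delta> P(1)] Q(1), of \<xi> \<eta>] \<xi> by auto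
    moreover define \<zeta> where "\<zeta> = line_point \<xi> \<eta> t"
    ultimately have \<zeta>: "\<zeta> \<in> L" "\<Delta> \<zeta> \<noteq> 0" "P \<zeta> \<noteq> 0" "Q \<zeta> \<noteq> 0"
      using line \<xi> \<eta> by auto
    then have "f (\<phi> \<zeta>) \<noteq> 0" "g (\<phi> \<zeta>) \<noteq> 0" using P(2)[of \<zeta>] Q(2)[of \<zeta>] by auto
    then show False using zero \<zeta> by auto
  qed
qed

lemma zariski_closure_image_subset:
  assumes "S \<subseteq> {\<xi>. \<Delta> \<xi> \<noteq> 0}"
  shows "zariski_closure V Y (\<phi> ` S) \<subseteq> C"
proof
  fix x assume x: "x \<in> zariski_closure V Y (\<phi> ` S)"
  have sub: "\<phi> ` S \<subseteq> C" using assms range by auto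
  show "x \<in> C"
  proof (rule ccontr)
    assume "x \<notin> C"
    moreover have "x \<in> V" using x unfolding zariski_closure_def zero_locus_def by auto
    ultimately obtain f where "f \<in> poly_funs Y" "\<forall>z\<in>C. f z = 0" "f x \<noteq> 0"
      using closedin_zariski_separate[OF closed] by blast
    moreover from this sub have "\<forall>z\<in>zariski_closure V Y (\<phi> ` S). f z = 0"
      using vanish_on_zariski_closure[of "\<phi> ` S" V f Y] C_subset by blast
    ultimately show False using x by blast
  qed
qed

lemma prime_locus_C: "prime_locus Y C"
proof -
  have pr: "prime_locus Y (\<phi> ` {\<xi> \<in> UNIV. \<Delta> \<xi> \<noteq> 0})"
    using base by (intro prime_locus_image) auto
  have iff: "(\<forall>z\<in>C. f z = 0) \<longleftrightarrow> (\<forall>s\<in>\<phi> ` {\<xi> \<in> UNIV. \<Delta> \<xi> \<noteq> 0}. f s = 0)" if "f \<in> poly_funs Y" for f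
    using dense[OF that] range by auto
  show ?thesis
    unfolding prime_locus_def
  proof (intro conjI ballI impI)
    show "C \<noteq> {}" using range base by blast
    fix f g assume fg: "f \<in> poly_funs Y" "g \<in> poly_funs Y" "\<forall>s\<in>C. f s * g s = 0"
    then show "(\<forall>s\<in>C. f s = 0) \<or> (\<forall>s\<in>C. g s = 0)"
      using prime_locusD[OF pr fg(1,2)] iff[OF poly_funs.mult[OF fg(1,2)]] iff[OF fg(1)] iff[OF fg(2)]
      by blast
  qed
qed

text \<open>
  Independent functions on \<open>C\<close> pull back to fractions in \<open>card I\<close> variables.  If there are too many of
  them, they satisfy a relation on the chart, and by density also on \<open>C\<close>.
\<close>

lemma chain_length_le:
  assumes "prime_chain V Y C m Z"
  shows "m \<le> card I"
proof (rule ccontr)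
  assume "\<not> m \<le> card I"
  moreover have "card (coords I :: (('i \<Rightarrow> 'k) \<Rightarrow> 'k) set) \<le> card I"
    unfolding coords_def using finI by (rule card_image_le)
  ultimately have m: "card (coords I :: (('i \<Rightarrow> 'k) \<Rightarrow> 'k) set) < m" by simp
  obtain g where g: "\<And>i. i < m \<Longrightarrow> g i \<in> poly_funs Y"
    and ind: "\<And>d c. \<forall>z\<in>Z m. (\<Sum>\<alpha>\<in>exponents {..<m} d. c \<alpha> * (\<Prod>i<m. g i z ^ \<alpha> i)) = 0 \<Longrightarrow>
           \<forall>\<alpha>\<in>exponents {..<m} d. c \<alpha> = 0"
    using prime_chain_algebraically_independent[OF assms] by blast
  have "(\<lambda>\<xi>. g i (\<phi> \<xi>)) \<in> fractions (coords I) \<Delta> {\<xi>. \<Delta> \<xi> \<noteq> 0}" if "i < m" for i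
    by (rule fractions_compose[OF \<Delta> g[OF that]]) (rule regular)
  then obtain d c where c: "\<exists>\<alpha>\<in>exponents {..<m} d. c \<alpha> \<noteq> 0"
    "\<forall>\<xi>\<in>{\<xi>. \<Delta> \<xi> \<noteq> 0}. (\<Sum>\<alpha>\<in>exponents {..<m} d. c \<alpha> * (\<Prod>i<m. g i (\<phi> \<xi>) ^ \<alpha> i)) = 0"
    using fractions_algebraically_dependent[OF _ m \<Delta>, of "{\<xi>. \<Delta> \<xi> \<noteq> 0}" "\<lambda>i \<xi>. g i (\<phi> \<xi>)"] finI
    by (auto simp: coords_def)
  have "(\<lambda>z. \<Sum>\<alpha>\<in>exponents {..<m} d. c \<alpha> * (\<Prod>i<m. g i z ^ \<alpha> i)) \<in> poly_funs Y"
    by (intro poly_funs_sum poly_funs.mult poly_funs.const poly_funs_prod poly_funs_power g) auto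
  from dense[OF this] c(2)
  have "\<forall>z\<in>C. (\<Sum>\<alpha>\<in>exponents {..<m} d. c \<alpha> * (\<Prod>i<m. g i z ^ \<alpha> i)) = 0" by blast
  moreover have "Z m \<subseteq> C" using assms unfolding prime_chain_def by simp
  ultimately show False using ind[where d = d and c = c] c(1) by blast
qed

text \<open>
  Release the parameters one at a time, starting from the base point.  The function
  \<open>q i - \<xi>0 i * h\<close> detects on \<open>C\<close> whether parameter \<open>i\<close> still has its base value.
\<close>

lemma chain_of_length_card: "\<exists>Z. prime_chain V Y C (card I) Z"
proof -
  obtain w where w: "bij_betw w {..<card I} I"
    using ex_bij_betw_nat_finite[OF finI] by (auto simp: lessThan_atLeast0)
  define L where "L s = {\<xi>. \<forall>j<card I. s \<le> j \<longrightarrow> \<xi> (w j) = \<xi>0 (w j)}" for s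
  define S where "S s = {\<xi> \<in> L s. \<Delta> \<xi> \<noteq> 0}" for s
  define Z where "Z s = zariski_closure V Y (\<phi> ` S s)" for s
  have SV: "\<phi> ` S s \<subseteq> V" for s using range C_subset by (auto simp: S_def)
  have "prime_locus Y (\<phi> ` S s)" for s
    unfolding S_def
  proof (rule prime_locus_image)
    show "\<xi>0 \<in> L s" by (simp add: L_def)
    show "line_point \<xi> \<eta> t \<in> L s" if "\<xi> \<in> L s" "\<eta> \<in> L s" for \<xi> \<eta> t
      using that by (simp add: L_def line_point_def)
  qed (rule base)
  then have "prime_locus Y (Z s)" for s
    unfolding Z_def using SV by (intro prime_locus_zariski_closure)
  moreover have "Z s \<subseteq> C" for s
    unfolding Z_def by (rule zariski_closure_image_subset) (auto simp: S_def)
  moreover have "closedin (zariski V Y) (Z s)" for s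
    unfolding Z_def by (rule closedin_zariski_closure)
  moreover have "Z s \<subset> Z (Suc s)" if s: "s < card I" for s
  proof -
    define f where "f z = q (w s) z - \<xi>0 (w s) * h z" for z
    have ws: "w s \<in> I" using w s by (auto simp: bij_betw_def)
    have f: "f \<in> poly_funs Y"
      unfolding f_def by (intro poly_funs_diff poly_funs.mult poly_funs.const param ws)
    have f\<phi>: "f (\<phi> \<xi>) = (\<xi> (w s) - \<xi>0 (w s)) * h (\<phi> \<xi>)" if "\<Delta> \<xi> \<noteq> 0" for \<xi>
      using param(4)[OF that ws] by (simp add: f_def algebra_simps)
    have "\<forall>z\<in>Z s. f z = 0"
      unfolding Z_def vanish_on_zariski_closure[OF SV f]
      using f\<phi> s by (auto simp: S_def L_def)
    moreover have "\<not> (\<forall>z\<in>Z (Suc s). f z = 0)"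
    proof -
      define \<eta> where "\<eta> = \<xi>0(w s := \<xi>0 (w s) + 1)"
      obtain t where t: "\<Delta> (line_point \<xi>0 \<eta> t) \<noteq> 0" "line_point \<xi>0 \<eta> t (w s) - \<xi>0 (w s) \<noteq> 0"
        using common_nonzero_on_line[OF inf \<Delta>
            poly_funs_diff[OF coord_poly_fun[OF ws] poly_funs.const[of "\<xi>0 (w s)"]], of \<xi>0 \<eta>] base
        by (auto simp: \<eta>_def)
      have "line_point \<xi>0 \<eta> t \<in> L (Suc s)"
        unfolding L_def
      proof (intro CollectI allI impI)
        fix j assume j: "j < card I" "Suc s \<le> j"
        then have "w j \<noteq> w s" using w s by (auto simp: bij_betw_def dest: inj_onD)
        then show "line_point \<xi>0 \<eta> t (w j) = \<xi>0 (w j)" by (simp add: line_point_def \<eta>_def)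
      qed
      then have "line_point \<xi>0 \<eta> t \<in> S (Suc s)" using t by (simp add: S_def)
      moreover have "f (\<phi> (line_point \<xi>0 \<eta> t)) \<noteq> 0"
        using f\<phi>[OF t(1)] t param(3) by simp
      ultimately show ?thesis
        unfolding Z_def vanish_on_zariski_closure[OF SV f] by blast
    qed
    moreover have "Z s \<subseteq> Z (Suc s)"
    proof -
      have "S s \<subseteq> S (Suc s)" by (auto simp: S_def L_def)
      then show ?thesis unfolding Z_def zariski_closure_def zero_locus_def by blast
    qed
    ultimately show ?thesis by blast
  qed
  ultimately show ?thesis unfolding prime_chain_def by blast
qed

theorem irreducible: "irreducible_space (subtopology (zariski V Y) C)"
  using irreducible_space_iff_prime_locus[OF closed] prime_locus_C by blast

theorem krull_dim_eq: "krull_dim (subtopology (zariski V Y) C) = enat (card I)"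
proof -
  have "krull_dim (subtopology (zariski V Y) C) = Sup {enat m | m. \<exists>Z. prime_chain V Y C m Z}"
    by (rule krull_dim_zariski[OF closed])
  also have "\<dots> = enat (card I)"
  proof (rule antisym)
    show "Sup {enat m | m. \<exists>Z. prime_chain V Y C m Z} \<le> enat (card I)"
      using chain_length_le by (intro Sup_least) auto
    show "enat (card I) \<le> Sup {enat m | m. \<exists>Z. prime_chain V Y C m Z}"
      using chain_of_length_card by (intro Sup_upper) auto
  qed
  finally show ?thesis .
qed

end

section \<open>Matrices with a cyclic vector\<close>

lemma pow_mat_add:
  assumes "(B :: 'k::semiring_1 mat) \<in> carrier_mat n n"
  shows "B ^\<^sub>m (i + j) = B ^\<^sub>m i * B ^\<^sub>m j"
proof (induction j)
  case 0
  then show ?case using assms by simp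
next
  case (Suc j)
  have "B ^\<^sub>m (i + Suc j) = (B ^\<^sub>m i * B ^\<^sub>m j) * B" using Suc by simp
  also have "\<dots> = B ^\<^sub>m i * (B ^\<^sub>m j * B)"
    using assms by (intro assoc_mult_mat) auto
  finally show ?case by simp
qed

lemma pow_mat_add_vec:
  assumes "(B :: 'k::semiring_1 mat) \<in> carrier_mat n n" "v \<in> carrier_vec n"
  shows "B ^\<^sub>m (i + j) *\<^sub>v v = B ^\<^sub>m i *\<^sub>v (B ^\<^sub>m j *\<^sub>v v)"
  unfolding pow_mat_add[OF assms(1)] using assms by (intro assoc_mult_mat_vec) auto

lemma pow_mat_Suc_vec:
  assumes "(B :: 'k::semiring_1 mat) \<in> carrier_mat n n" "v \<in> carrier_vec n"
  shows "B ^\<^sub>m Suc j *\<^sub>v v = B *\<^sub>v (B ^\<^sub>m j *\<^sub>v v)"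
  using pow_mat_add_vec[OF assms, of 1 j] assms by simp

lemma index_mult_mat_vec_sum:
  assumes "A \<in> carrier_mat m n" "v \<in> carrier_vec n" "i < m"
  shows "(A *\<^sub>v v) $ i = (\<Sum>k<n. A $$ (i, k) * v $ k)"
  using assms by (simp add: scalar_prod_def lessThan_atLeast0)

lemma index_mult_mat_sum:
  assumes "A \<in> carrier_mat m n" "B \<in> carrier_mat n l" "i < m" "j < l"
  shows "(A * B) $$ (i, j) = (\<Sum>k<n. A $$ (i, k) * B $$ (k, j))"
  using assms by (simp add: scalar_prod_def lessThan_atLeast0)

definition krylov :: "nat \<Rightarrow> 'k::semiring_1 mat \<Rightarrow> 'k vec \<Rightarrow> 'k mat" where
  "krylov n B v = mat n n (\<lambda>(i, j). (B ^\<^sub>m j *\<^sub>v v) $ i)"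

lemma krylov_carrier [simp]: "krylov n B v \<in> carrier_mat n n"
  and krylov_index [simp]: "i < n \<Longrightarrow> j < n \<Longrightarrow> krylov n B v $$ (i, j) = (B ^\<^sub>m j *\<^sub>v v) $ i"
  and dim_krylov [simp]: "dim_row (krylov n B v) = n" "dim_col (krylov n B v) = n"
  by (auto simp: krylov_def)

lemma det_nonzero_iff_injective:
  fixes M :: "'k::field mat"
  assumes "M \<in> carrier_mat n n"
  shows "det M \<noteq> 0 \<longleftrightarrow> (\<forall>x. (\<forall>i<n. (\<Sum>j<n. M $$ (i, j) * x j) = 0) \<longrightarrow> (\<forall>j<n. x j = 0))"
proof -
  have "det M = 0 \<longleftrightarrow> (\<exists>v. v \<in> carrier_vec n \<and> v \<noteq> 0\<^sub>v n \<and> M *\<^sub>v v = 0\<^sub>v n)"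
    by (rule det_0_iff_vec_prod_zero_field[OF assms])
  also have "\<dots> \<longleftrightarrow> (\<exists>x. (\<forall>i<n. (\<Sum>j<n. M $$ (i, j) * x j) = 0) \<and> (\<exists>j<n. x j \<noteq> 0))"
  proof
    assume "\<exists>v. v \<in> carrier_vec n \<and> v \<noteq> 0\<^sub>v n \<and> M *\<^sub>v v = 0\<^sub>v n"
    then obtain v where v: "v \<in> carrier_vec n" "v \<noteq> 0\<^sub>v n" "M *\<^sub>v v = 0\<^sub>v n" by blast
    have "(\<Sum>j<n. M $$ (i, j) * v $ j) = 0" if "i < n" for i
      using index_mult_mat_vec_sum[OF assms v(1) that] v(3) that by simp
    moreover have "\<exists>j<n. v $ j \<noteq> 0"
      using v(1,2) by (metis carrier_vecD eq_vecI index_zero_vec)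
    ultimately show "\<exists>x. (\<forall>i<n. (\<Sum>j<n. M $$ (i, j) * x j) = 0) \<and> (\<exists>j<n. x j \<noteq> 0)" by blast
  next
    assume "\<exists>x. (\<forall>i<n. (\<Sum>j<n. M $$ (i, j) * x j) = 0) \<and> (\<exists>j<n. x j \<noteq> 0)"
    then obtain x where x: "\<forall>i<n. (\<Sum>j<n. M $$ (i, j) * x j) = 0" "\<exists>j<n. x j \<noteq> 0" by blast
    have "(M *\<^sub>v vec n x) $ i = 0" if "i < n" for i
      using index_mult_mat_vec_sum[OF assms vec_carrier that, of x] x(1) that by simp
    then have "M *\<^sub>v vec n x = 0\<^sub>v n" using assms by (intro eq_vecI) auto
    moreover have "vec n x \<noteq> 0\<^sub>v n" using x(2) by (metis index_vec index_zero_vec(1))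
    ultimately show "\<exists>v. v \<in> carrier_vec n \<and> v \<noteq> 0\<^sub>v n \<and> M *\<^sub>v v = 0\<^sub>v n"
      using vec_carrier by blast
  qed
  finally show ?thesis by blast
qed

lemma invertible_solve:
  fixes M :: "'k::field mat"
  assumes "M \<in> carrier_mat n n" "det M \<noteq> 0"
  shows "\<exists>a. \<forall>i<n. (\<Sum>j<n. M $$ (i, j) * a j) = u i"
proof -
  let ?a = "(1 / det M) \<cdot>\<^sub>v (adj_mat M *\<^sub>v vec n u)"
  have adj: "adj_mat M \<in> carrier_mat n n" "M * adj_mat M = det M \<cdot>\<^sub>m 1\<^sub>m n"
    using adj_mat[OF assms(1)] by auto
  have "M *\<^sub>v ?a = (1 / det M) \<cdot>\<^sub>v (M *\<^sub>v (adj_mat M *\<^sub>v vec n u))"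
    using assms adj by (intro mult_mat_vec) auto
  also have "M *\<^sub>v (adj_mat M *\<^sub>v vec n u) = (M * adj_mat M) *\<^sub>v vec n u"
    using assms adj by (intro assoc_mult_mat_vec[symmetric]) auto
  also have "\<dots> = det M \<cdot>\<^sub>v vec n u"
  proof (rule eq_vecI)
    fix i assume "i < dim_vec (det M \<cdot>\<^sub>v vec n u)"
    then have i: "i < n" by simp
    have "((M * adj_mat M) *\<^sub>v vec n u) $ i = (\<Sum>k<n. (det M \<cdot>\<^sub>m 1\<^sub>m n) $$ (i, k) * vec n u $ k)"
      unfolding adj using i by (intro index_mult_mat_vec_sum) auto
    also have "\<dots> = (\<Sum>k<n. if k = i then det M * u k else 0)"
      using i by (intro sum.cong) auto
    also have "\<dots> = det M * u i" using i by simp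
    finally show "((M * adj_mat M) *\<^sub>v vec n u) $ i = (det M \<cdot>\<^sub>v vec n u) $ i" using i by simp
  qed (use assms adj in auto)
  finally have eq: "M *\<^sub>v ?a = vec n u"
    using assms(2) by (simp add: smult_smult_assoc)
  have "(\<Sum>j<n. M $$ (i, j) * ?a $ j) = u i" if "i < n" for i
  proof -
    have "?a \<in> carrier_vec n" using adj by auto
    from index_mult_mat_vec_sum[OF assms(1) this that] show ?thesis unfolding eq using that by simp
  qed
  then show ?thesis by blast
qed

text \<open>
  A polynomial in \<open>B\<close> that kills \<open>v\<close> commutes with \<open>B\<close>, hence kills all \<open>B\<^sup>j v\<close>, and these span.
\<close>

lemma krylov_relation_propagates:
  fixes B :: "'k::field mat"
  assumes B: "B \<in> carrier_mat n n" and v: "v \<in> carrier_vec n" and u: "u \<in> carrier_vec n"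
    and cyc: "det (krylov n B v) \<noteq> 0"
    and rel: "\<And>i. i < n \<Longrightarrow> (\<Sum>j\<in>F. d j * (B ^\<^sub>m j *\<^sub>v v) $ i) = 0"
    and i: "i < n"
  shows "(\<Sum>j\<in>F. d j * (B ^\<^sub>m j *\<^sub>v u) $ i) = 0"
proof -
  obtain a where a: "\<forall>k<n. (\<Sum>s<n. krylov n B v $$ (k, s) * a s) = u $ k"
    using invertible_solve[OF krylov_carrier cyc, of "\<lambda>k. u $ k"] by blast
  have idx: "(B ^\<^sub>m j *\<^sub>v x) $ i = (\<Sum>k<n. (B ^\<^sub>m j) $$ (i, k) * x $ k)" if "x \<in> carrier_vec n" for j x
    using index_mult_mat_vec_sum[of "B ^\<^sub>m j" n n x i] B that i by simp
  have shift: "(\<Sum>k<n. (B ^\<^sub>m j) $$ (i, k) * (B ^\<^sub>m s *\<^sub>v v) $ k)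
      = (\<Sum>k<n. (B ^\<^sub>m s) $$ (i, k) * (B ^\<^sub>m j *\<^sub>v v) $ k)" for j s
  proof -
    have "B ^\<^sub>m j *\<^sub>v v \<in> carrier_vec n" "B ^\<^sub>m s *\<^sub>v v \<in> carrier_vec n"
      using B v by (auto intro!: mult_mat_vec_carrier)
    then show ?thesis
      using idx pow_mat_add_vec[OF B v, of j s] pow_mat_add_vec[OF B v, of s j]
      by (metis add.commute)
  qed
  have "(\<Sum>j\<in>F. d j * (B ^\<^sub>m j *\<^sub>v u) $ i)
      = (\<Sum>j\<in>F. d j * (\<Sum>k<n. (B ^\<^sub>m j) $$ (i, k) * (\<Sum>s<n. (B ^\<^sub>m s *\<^sub>v v) $ k * a s)))"
    unfolding idx[OF u] using a by (intro sum.cong arg_cong2[of _ _ _ _ "(*)"] refl) auto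
  also have "\<dots> = (\<Sum>j\<in>F. d j * (\<Sum>s<n. a s * (\<Sum>k<n. (B ^\<^sub>m j) $$ (i, k) * (B ^\<^sub>m s *\<^sub>v v) $ k)))"
  proof (rule sum.cong[OF refl], rule arg_cong2[of _ _ _ _ "(*)", OF refl])
    fix j
    have "(\<Sum>k<n. (B ^\<^sub>m j) $$ (i, k) * (\<Sum>s<n. (B ^\<^sub>m s *\<^sub>v v) $ k * a s))
        = (\<Sum>k<n. \<Sum>s<n. a s * ((B ^\<^sub>m j) $$ (i, k) * (B ^\<^sub>m s *\<^sub>v v) $ k))"
      by (simp add: sum_distrib_left mult_ac)
    also have "\<dots> = (\<Sum>s<n. \<Sum>k<n. a s * ((B ^\<^sub>m j) $$ (i, k) * (B ^\<^sub>m s *\<^sub>v v) $ k))"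
      by (rule sum.swap)
    finally show "(\<Sum>k<n. (B ^\<^sub>m j) $$ (i, k) * (\<Sum>s<n. (B ^\<^sub>m s *\<^sub>v v) $ k * a s))
        = (\<Sum>s<n. a s * (\<Sum>k<n. (B ^\<^sub>m j) $$ (i, k) * (B ^\<^sub>m s *\<^sub>v v) $ k))"
      by (simp add: sum_distrib_left)
  qed
  also have "\<dots> = (\<Sum>j\<in>F. \<Sum>s<n. \<Sum>k<n. a s * (B ^\<^sub>m s) $$ (i, k) * (d j * (B ^\<^sub>m j *\<^sub>v v) $ k))"
  proof -
    have "(\<Sum>j\<in>F. d j * (\<Sum>s<n. a s * (\<Sum>k<n. (B ^\<^sub>m j) $$ (i, k) * (B ^\<^sub>m s *\<^sub>v v) $ k)))
        = (\<Sum>j\<in>F. d j * (\<Sum>s<n. a s * (\<Sum>k<n. (B ^\<^sub>m s) $$ (i, k) * (B ^\<^sub>m j *\<^sub>v v) $ k)))"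
      by (intro shift sum.cong refl arg_cong2[of _ _ _ _ "(*)"])
    then show ?thesis by (simp add: sum_distrib_left mult_ac)
  qed
  also have "\<dots> = (\<Sum>s<n. \<Sum>j\<in>F. \<Sum>k<n. a s * (B ^\<^sub>m s) $$ (i, k) * (d j * (B ^\<^sub>m j *\<^sub>v v) $ k))"
    by (rule sum.swap)
  also have "\<dots> = (\<Sum>s<n. \<Sum>k<n. \<Sum>j\<in>F. a s * (B ^\<^sub>m s) $$ (i, k) * (d j * (B ^\<^sub>m j *\<^sub>v v) $ k))"
    by (rule sum.cong[OF refl]) (rule sum.swap)
  also have "\<dots> = (\<Sum>s<n. \<Sum>k<n. a s * (B ^\<^sub>m s) $$ (i, k) * (\<Sum>j\<in>F. d j * (B ^\<^sub>m j *\<^sub>v v) $ k))"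
    by (simp add: sum_distrib_left)
  also have "\<dots> = 0" using rel by simp
  finally show ?thesis .
qed

lemma conjugate_mult:
  fixes P Q X Y :: "'k::semiring_1 mat"
  assumes "P \<in> carrier_mat n n" "Q \<in> carrier_mat n n" "Q * P = 1\<^sub>m n"
    and "X \<in> carrier_mat n n" "Y \<in> carrier_mat n n"
  shows "(P * X * Q) * (P * Y * Q) = P * (X * Y) * Q"
proof -
  have YQ: "Y * Q \<in> carrier_mat n n" using assms by simp
  have "Q * (P * (Y * Q)) = (Q * P) * (Y * Q)"
    using assms(2,1) YQ by (rule assoc_mult_mat[symmetric])
  then have "Q * (P * (Y * Q)) = Y * Q" using assms(3) left_mult_one_mat[OF YQ] by simp
  then show ?thesis
    using assms(1,2,4,5) by (simp add: assoc_mult_mat[of _ n n _ n _ n])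
qed

lemma krylov_conjugate:
  fixes B :: "'k::field mat"
  assumes "similar_mat_wit B B' P Q" "B \<in> carrier_mat n n" "v \<in> carrier_vec n"
  shows "krylov n B (P *\<^sub>v v) = P * krylov n B' v"
proof (rule eq_matI)
  note w = similar_mat_witD2[OF assms(2,1)]
  fix i j assume ij: "i < dim_row (P * krylov n B' v)" "j < dim_col (P * krylov n B' v)"
  then have i: "i < n" and j: "j < n" using w by auto
  have B': "B' ^\<^sub>m j \<in> carrier_mat n n" using w by simp
  have "B ^\<^sub>m j *\<^sub>v (P *\<^sub>v v) = (P * B' ^\<^sub>m j * Q) *\<^sub>v (P *\<^sub>v v)"
    using similar_mat_wit_pow_id[OF assms(1)] by simp
  also have "\<dots> = (P * B' ^\<^sub>m j * Q * P) *\<^sub>v v"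
    using w B' assms(3) by (intro assoc_mult_mat_vec[symmetric]) auto
  also have "P * B' ^\<^sub>m j * Q * P = P * B' ^\<^sub>m j * (Q * P)"
    using w B' by (intro assoc_mult_mat) auto
  also have "\<dots> = P * B' ^\<^sub>m j" using w B' by simp
  also have "(P * B' ^\<^sub>m j) *\<^sub>v v = P *\<^sub>v (B' ^\<^sub>m j *\<^sub>v v)"
    using w B' assms(3) by (intro assoc_mult_mat_vec) auto
  finally have "(B ^\<^sub>m j *\<^sub>v (P *\<^sub>v v)) $ i = (P *\<^sub>v (B' ^\<^sub>m j *\<^sub>v v)) $ i" by simp
  also have "\<dots> = (\<Sum>k<n. P $$ (i, k) * (B' ^\<^sub>m j *\<^sub>v v) $ k)"
    using w(6) mult_mat_vec_carrier[OF B' assms(3)] i by (rule index_mult_mat_vec_sum)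
  also have "\<dots> = (P * krylov n B' v) $$ (i, j)"
    using index_mult_mat_sum[OF w(6) krylov_carrier i j] j by simp
  finally show "krylov n B (P *\<^sub>v v) $$ (i, j) = (P * krylov n B' v) $$ (i, j)"
    using i j by simp
qed (use similar_mat_witD2[OF assms(2,1)] in auto)

section \<open>Every matrix commutes with a matrix having a cyclic vector\<close>

lemma extend_to_invertible:
  fixes v :: "'k::field vec"
  assumes v: "v \<in> carrier_vec n" and "v \<noteq> 0\<^sub>v n"
  obtains P Q where "P \<in> carrier_mat n n" "Q \<in> carrier_mat n n" "P * Q = 1\<^sub>m n" "Q * P = 1\<^sub>m n"
    "col P 0 = v"
proof -
  obtain k where k: "k < n" "v $ k \<noteq> 0"
    using assms by (metis carrier_vecD eq_vecI index_zero_vec)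
  \<comment> \<open>Column \<open>0\<close> is \<open>v\<close>; the unit vector that it displaces takes the place of the one with index \<open>k\<close>.\<close>
  define \<sigma> where "\<sigma> j = (if j = k then 0 else j)" for j
  define P where "P = mat n n (\<lambda>(i, j). if j = 0 then v $ i else if i = \<sigma> j then 1 else 0)"
  have P: "P \<in> carrier_mat n n" by (simp add: P_def)
  have n: "n > 0" using k by simp
  have "det P \<noteq> 0"
    unfolding det_nonzero_iff_injective[OF P]
  proof (intro allI impI)
    fix x j assume zero: "\<forall>i<n. (\<Sum>j<n. P $$ (i, j) * x j) = 0" and j: "j < n"
    have row: "v $ i * x 0 + (\<Sum>j\<in>{1..<n}. (if i = \<sigma> j then x j else 0)) = 0" if i: "i < n" for i
    proof -
      have "(\<Sum>j<n. P $$ (i, j) * x j) = P $$ (i, 0) * x 0 + (\<Sum>j\<in>{1..<n}. P $$ (i, j) * x j)"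
        using n by (simp add: lessThan_atLeast0 sum.atLeast_Suc_lessThan)
      also have "(\<Sum>j\<in>{1..<n}. P $$ (i, j) * x j) = (\<Sum>j\<in>{1..<n}. (if i = \<sigma> j then x j else 0))"
        using i by (intro sum.cong) (auto simp: P_def)
      finally show ?thesis using zero i n by (simp add: P_def)
    qed
    have "(\<Sum>j\<in>{1..<n}. (if k = \<sigma> j then x j else 0)) = 0"
      by (rule sum.neutral) (auto simp: \<sigma>_def)
    then have x0: "x 0 = 0" using row[OF k(1)] k(2) by simp
    show "x j = 0"
    proof (cases "j = 0")
      case False
      have "\<sigma> j < n" using j n by (simp add: \<sigma>_def)
      have "(\<Sum>l\<in>{1..<n}. (if \<sigma> j = \<sigma> l then x l else 0)) = (\<Sum>l\<in>{j}. (if \<sigma> j = \<sigma> l then x l else 0))"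
        using j False by (intro sum.mono_neutral_right) (auto simp: \<sigma>_def split: if_splits)
      then show ?thesis using row[OF \<open>\<sigma> j < n\<close>] x0 by simp
    qed (use x0 in simp)
  qed
  then obtain Q where Q: "Q \<in> carrier_mat n n" "P * Q = 1\<^sub>m n" "Q * P = 1\<^sub>m n"
    using det_non_zero_imp_unit[OF P, of n] unfolding Units_def ring_mat_def by auto
  moreover have "col P 0 = v" using v n by (intro eq_vecI) (auto simp: P_def)
  ultimately show ?thesis using that P by blast
qed

text \<open>
  Split off one eigenvector at a time.
\<close>

lemma similar_to_upper_triangular:
  fixes A :: "'k::alg_closed_field mat"
  assumes "A \<in> carrier_mat n n"
  shows "\<exists>T. T \<in> carrier_mat n n \<and> upper_triangular T \<and> similar_mat A T"
  using assms
proof (induction n arbitrary: A)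
  case 0
  then show ?case by (intro exI[of _ A]) (auto intro: similar_mat_refl)
next
  case (Suc n)
  let ?N = "Suc n"
  have "degree (char_poly A) > 0" using degree_monic_char_poly[OF Suc.prems] by simp
  then obtain e where "poly (char_poly A) e = 0" using alg_closed_imp_poly_has_root by blast
  then obtain v where v: "v \<in> carrier_vec ?N" "v \<noteq> 0\<^sub>v ?N" "A *\<^sub>v v = e \<cdot>\<^sub>v v"
    using eigenvalue_root_char_poly[OF Suc.prems] Suc.prems
    unfolding eigenvalue_def eigenvector_def by auto
  obtain P Q where PQ: "P \<in> carrier_mat ?N ?N" "Q \<in> carrier_mat ?N ?N" "P * Q = 1\<^sub>m ?N" "Q * P = 1\<^sub>m ?N"
    "col P 0 = v"
    using extend_to_invertible[OF v(1,2)] by blast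
  define A' where "A' = Q * A * P"
  have A': "A' \<in> carrier_mat ?N ?N" using PQ Suc.prems by (simp add: A'_def)
  have "P * A' * Q = (P * Q) * A * (P * Q)"
    unfolding A'_def using PQ(1,2) Suc.prems by (simp add: assoc_mult_mat[of _ ?N ?N _ ?N _ ?N])
  then have "A = P * A' * Q" using PQ Suc.prems by simp
  then have sim: "similar_mat A A'"
    using PQ A' Suc.prems by (intro similar_matI[of _ _ P Q ?N]) auto
  have colA': "col A' 0 = e \<cdot>\<^sub>v col (1\<^sub>m ?N) 0"
  proof -
    have "col A' 0 = Q *\<^sub>v (A *\<^sub>v col P 0)"
      unfolding A'_def using PQ Suc.prems
      by (simp add: assoc_mult_mat[of _ ?N ?N _ ?N _ ?N] col_mult2[of _ ?N ?N _ ?N])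
    also have "\<dots> = e \<cdot>\<^sub>v (Q *\<^sub>v col P 0)"
      unfolding PQ(5) v(3) using PQ v by (intro mult_mat_vec) auto
    also have "Q *\<^sub>v col P 0 = col (Q * P) 0"
      using PQ by (intro col_mult2[symmetric]) auto
    finally show ?thesis unfolding PQ(4) .
  qed
  obtain A1 A2 A3 A4 where split: "split_block A' 1 1 = (A1, A2, A3, A4)"
    by (cases "split_block A' 1 1") auto
  have dims: "dim_row A' = 1 + n" "dim_col A' = 1 + n" using A' by auto
  note sb = split_block[OF split dims]
  have "A3 = 0\<^sub>m n 1"
  proof (rule eq_matI)
    fix i j assume ij: "i < dim_row (0\<^sub>m n 1 :: 'k mat)" "j < dim_col (0\<^sub>m n 1 :: 'k mat)"
    then have "A3 $$ (i, j) = A' $$ (Suc i, 0)"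
      using sb by (auto simp: sb(5))
    also have "\<dots> = col A' 0 $ Suc i" using ij A' by auto
    also have "\<dots> = 0" unfolding colA' using ij by simp
    finally show "A3 $$ (i, j) = 0\<^sub>m n 1 $$ (i, j)" using ij by simp
  qed (use sb in auto)
  then have A'eq: "A' = four_block_mat A1 A2 (0\<^sub>m n 1) A4" using sb(5) by simp
  obtain T where T: "T \<in> carrier_mat n n" "upper_triangular T" "similar_mat A4 T"
    using Suc.IH[OF sb(4)] by blast
  obtain B0 where B0: "B0 \<in> carrier_mat 1 n"
    "similar_mat A' (four_block_mat A1 B0 (0\<^sub>m n 1) T)"
    using similar_mat_four_block_0_ex[OF similar_mat_refl[OF sb(1)] T(3) sb(2) sb(1) sb(4)]
    unfolding A'eq by blast
  have "upper_triangular A1" using sb(1) by auto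
  then have "upper_triangular (four_block_mat A1 B0 (0\<^sub>m n 1) T)"
    using upper_triangular_four_block[OF sb(1) T(1) _ T(2)] by blast
  moreover have "four_block_mat A1 B0 (0\<^sub>m n 1) T \<in> carrier_mat ?N ?N"
    using four_block_carrier_mat[OF sb(1) T(1)] by simp
  ultimately show ?case using similar_mat_trans[OF sim B0(2)] by blast
qed

lemma pcompose_power:
  fixes q :: "'k::comm_ring_1 poly"
  shows "(q ^ m) \<circ>\<^sub>p r = (q \<circ>\<^sub>p r) ^ m"
  by (induction m) (simp_all add: pcompose_mult pcompose_1)

text \<open>
  The sums in the hypothesis are the Taylor coefficients of \<open>q\<close> at \<open>a\<close>, that is, the coefficients
  of \<open>q(x + a)\<close>.
\<close>

lemma linear_power_dvd_if_taylor_vanishes: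
  fixes q :: "'k::field poly"
  assumes deg: "degree q < N"
    and zero: "\<And>s. s < m \<Longrightarrow> (\<Sum>j<N. coeff q j * (of_nat (j choose s) * a ^ (j - s))) = 0"
  shows "[:- a, 1:] ^ m dvd q"
proof -
  have qsum: "q = (\<Sum>j<N. Polynomial.smult (coeff q j) ([:0, 1:] ^ j))"
  proof -
    have "q = (\<Sum>j\<le>N - 1. monom (coeff q j) j)"
      using deg by (intro poly_as_sum_of_monoms'[symmetric]) auto
    also have "{..N - 1} = {..<N}" using deg by auto
    finally show ?thesis by (simp add: monom_altdef)
  qed
  have comp: "q \<circ>\<^sub>p [:a, 1:] = (\<Sum>j<N. Polynomial.smult (coeff q j) ([:a, 1:] ^ j))"
    by (subst qsum) (simp add: pcompose_sum pcompose_smult pcompose_power pcompose_pCons)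
  have "coeff (q \<circ>\<^sub>p [:a, 1:]) s = 0" if "s < m" for s
  proof -
    have "coeff ([:a, 1:] ^ j) s = of_nat (j choose s) * a ^ (j - s)" for j
    proof (cases "s \<le> j")
      case True
      then show ?thesis by (simp add: coeff_linear_poly_power)
    next
      case False
      then have "degree ([:a, 1:] ^ j) < s" by (simp add: degree_linear_power)
      then show ?thesis using False by (simp add: coeff_eq_0 binomial_eq_0)
    qed
    then show ?thesis unfolding comp coeff_sum using zero[OF that] by simp
  qed
  then have "monom 1 m dvd q \<circ>\<^sub>p [:a, 1:]" unfolding monom_1_dvd_iff' by blast
  then obtain r where "q \<circ>\<^sub>p [:a, 1:] = monom 1 m * r" by (elim dvdE)
  then have "(q \<circ>\<^sub>p [:a, 1:]) \<circ>\<^sub>p [:- a, 1:] = (monom 1 m * r) \<circ>\<^sub>p [:- a, 1:]" by simp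
  then have "q = [:- a, 1:] ^ m * (r \<circ>\<^sub>p [:- a, 1:])"
    by (simp add: pcompose_assoc[symmetric] pcompose_pCons pcompose_mult monom_altdef
        pcompose_power)
  then show ?thesis by (rule dvdI)
qed

text \<open>
  For the sum \<open>v\<close> of the last basis vectors of the Jordan blocks, the coordinates of \<open>q(J) v\<close> are
  the Taylor coefficients of \<open>q\<close> at the eigenvalues.
\<close>

lemma jordan_matrix_cyclic_vector:
  fixes ns :: "(nat \<times> 'k::field) list"
  shows "\<exists>v\<in>carrier_vec (sum_list (map fst ns)). \<forall>q N. degree q < N \<longrightarrow>
    (\<forall>l<sum_list (map fst ns). (\<Sum>j<N. coeff q j * ((jordan_matrix ns ^\<^sub>m j) *\<^sub>v v) $ l) = 0) \<longrightarrow>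
    (\<forall>(m, a)\<in>set ns. [:- a, 1:] ^ m dvd q)"
proof (induction ns)
  case Nil
  show ?case by (rule bexI[of _ "0\<^sub>v 0"]) auto
next
  case (Cons x ns)
  obtain m a where x: "x = (m, a)" by (cases x)
  let ?M = "sum_list (map fst ns)"
  let ?e = "unit_vec m (m - 1) :: 'k vec"
  obtain v where v: "v \<in> carrier_vec ?M"
    and IH: "\<And>q N. degree q < N \<Longrightarrow>
      (\<forall>l<?M. (\<Sum>j<N. coeff q j * ((jordan_matrix ns ^\<^sub>m j) *\<^sub>v v) $ l) = 0) \<Longrightarrow>
      (\<forall>(m, a)\<in>set ns. [:- a, 1:] ^ m dvd q)"
    using Cons.IH by blast
  let ?w = "?e @\<^sub>v v"
  have "jordan_matrix (x # ns) = four_block_mat (jordan_block m a) (0\<^sub>m m ?M) (0\<^sub>m ?M m) (jordan_matrix ns)"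
    using jordan_matrix_dim[of ns] unfolding x jordan_matrix_def by (simp add: Let_def)
  then have "jordan_matrix (x # ns) ^\<^sub>m j
      = four_block_mat (jordan_block m a ^\<^sub>m j) (0\<^sub>m m ?M) (0\<^sub>m ?M m) (jordan_matrix ns ^\<^sub>m j)" for j
    using pow_four_block_mat[OF jordan_block_carrier jordan_matrix_carrier] by simp
  then have pow: "jordan_matrix (x # ns) ^\<^sub>m j *\<^sub>v ?w
      = (jordan_block m a ^\<^sub>m j *\<^sub>v ?e) @\<^sub>v (jordan_matrix ns ^\<^sub>m j *\<^sub>v v)" for j
    using mult_mat_vec_split[of "jordan_block m a ^\<^sub>m j" m "jordan_matrix ns ^\<^sub>m j" ?M ?e v] v by simp
  have block: "(jordan_block m a ^\<^sub>m j *\<^sub>v ?e) $ l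
      = of_nat (j choose (m - 1 - l)) * a ^ (j - (m - 1 - l))" if l: "l < m" for j l
  proof -
    have "(jordan_block m a ^\<^sub>m j *\<^sub>v ?e) $ l = (\<Sum>k<m. (jordan_block m a ^\<^sub>m j) $$ (l, k) * ?e $ k)"
      using l by (intro index_mult_mat_vec_sum) auto
    also have "\<dots> = (\<Sum>k<m. if k = m - 1 then (jordan_block m a ^\<^sub>m j) $$ (l, k) else 0)"
      by (intro sum.cong) auto
    also have "\<dots> = (jordan_block m a ^\<^sub>m j) $$ (l, m - 1)"
      using l by simp
    also have "\<dots> = of_nat (j choose (m - 1 - l)) * a ^ (j + l - (m - 1))"
      unfolding jordan_block_pow using l by simp
    also have "j + l - (m - 1) = j - (m - 1 - l)" using l by simp
    finally show ?thesis .
  qed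
  show ?case
  proof (rule bexI[of _ ?w], intro allI impI)
    show "?w \<in> carrier_vec (sum_list (map fst (x # ns)))" using v x by simp
    fix q :: "'k poly" and N assume deg: "degree q < N"
      and zero: "\<forall>l<sum_list (map fst (x # ns)).
        (\<Sum>j<N. coeff q j * ((jordan_matrix (x # ns) ^\<^sub>m j) *\<^sub>v ?w) $ l) = 0"
    have "[:- a, 1:] ^ m dvd q"
    proof (rule linear_power_dvd_if_taylor_vanishes[OF deg])
      fix s assume s: "s < m"
      let ?l = "m - 1 - s"
      have l: "?l < m" "m - 1 - ?l = s" using s by auto
      have eq: "(jordan_matrix (x # ns) ^\<^sub>m j *\<^sub>v ?w) $ ?l = of_nat (j choose s) * a ^ (j - s)" for j
        unfolding pow using l block[OF l(1)] by (subst index_append_vec) auto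
      have "?l < sum_list (map fst (x # ns))" using l x by simp
      from zero[rule_format, OF this]
      show "(\<Sum>j<N. coeff q j * (of_nat (j choose s) * a ^ (j - s))) = 0"
        unfolding eq .
    qed
    moreover have "\<forall>(m, a)\<in>set ns. [:- a, 1:] ^ m dvd q"
    proof (rule IH[OF deg], intro allI impI)
      fix l assume l: "l < ?M"
      have eq: "(jordan_matrix (x # ns) ^\<^sub>m j *\<^sub>v ?w) $ (m + l) = (jordan_matrix ns ^\<^sub>m j *\<^sub>v v) $ l" for j
        unfolding pow using l by (subst index_append_vec) auto
      have "m + l < sum_list (map fst (x # ns))" using l x by simp
      from zero[rule_format, OF this]
      show "(\<Sum>j<N. coeff q j * ((jordan_matrix ns ^\<^sub>m j) *\<^sub>v v) $ l) = 0"
        unfolding eq .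
    qed
    ultimately show "\<forall>(m, a)\<in>set (x # ns). [:- a, 1:] ^ m dvd q" using x by auto
  qed
qed

lemma sum_multiplicities_le_degree:
  fixes q :: "'k::field poly"
  assumes "q \<noteq> 0" "distinct (map snd ns)" "\<forall>(m, a)\<in>set ns. [:- a, 1:] ^ m dvd q"
  shows "sum_list (map fst ns) \<le> degree q"
proof -
  have dist: "distinct ns" and inj: "inj_on snd (set ns)"
    using assms(2) by (auto simp: distinct_map)
  have "sum_list (map fst ns) = (\<Sum>x\<in>set ns. fst x)"
    using dist by (simp add: sum_list_distinct_conv_sum_set)
  also have "\<dots> \<le> (\<Sum>x\<in>set ns. count (proots q) (snd x))"
  proof (rule sum_mono)
    fix x assume "x \<in> set ns"
    then have "[:- snd x, 1:] ^ fst x dvd q" using assms(3) by auto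
    then show "fst x \<le> count (proots q) (snd x)" using assms(1) by (simp add: order_max)
  qed
  also have "\<dots> = (\<Sum>a\<in>snd ` set ns. count (proots q) a)"
    using inj by (simp add: sum.reindex)
  also have "\<dots> = (\<Sum>a\<in>snd ` set ns \<inter> set_mset (proots q). count (proots q) a)"
    by (rule sum.mono_neutral_right) (auto simp: not_in_iff)
  also have "\<dots> \<le> (\<Sum>a\<in>set_mset (proots q). count (proots q) a)"
    by (rule sum_mono2) auto
  also have "\<dots> = size (proots q)" by (simp add: size_multiset_overloaded_eq)
  also have "\<dots> \<le> degree q" by (rule size_proots_le)
  finally show ?thesis .
qed

text \<open>
  A relation of degree less than \<open>n\<close> for \<open>v\<close> would be divisible by coprime polynomials whose degrees
  add up to \<open>n\<close>.
\<close>

lemma jordan_matrix_distinct_cyclic: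
  fixes ns :: "(nat \<times> 'k::field) list"
  assumes "distinct (map snd ns)" and n: "n = sum_list (map fst ns)"
  shows "\<exists>v\<in>carrier_vec n. det (krylov n (jordan_matrix ns) v) \<noteq> 0"
proof -
  obtain v where v: "v \<in> carrier_vec n"
    and div: "\<And>q N. degree q < N \<Longrightarrow>
      (\<forall>l<n. (\<Sum>j<N. coeff q j * ((jordan_matrix ns ^\<^sub>m j) *\<^sub>v v) $ l) = 0) \<Longrightarrow>
      (\<forall>(m, a)\<in>set ns. [:- a, 1:] ^ m dvd q)"
    using jordan_matrix_cyclic_vector[of ns] unfolding n by blast
  have "det (krylov n (jordan_matrix ns) v) \<noteq> 0"
    unfolding det_nonzero_iff_injective[OF krylov_carrier]
  proof (intro allI impI)
    fix x j assume zero: "\<forall>i<n. (\<Sum>j<n. krylov n (jordan_matrix ns) v $$ (i, j) * x j) = 0"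
      and j: "j < n"
    define q where "q = (\<Sum>i<n. monom (x i) i)"
    have cq: "coeff q i = (if i < n then x i else 0)" for i
      unfolding q_def coeff_sum by (simp add: sum.delta)
    have deg: "degree q < n"
    proof (cases n)
      case (Suc k)
      have "degree q \<le> k" by (rule degree_le) (auto simp: cq Suc)
      then show ?thesis by (simp add: Suc)
    qed (use j in simp)
    have "\<forall>l<n. (\<Sum>j<n. coeff q j * ((jordan_matrix ns ^\<^sub>m j) *\<^sub>v v) $ l) = 0"
      using zero by (simp add: cq mult.commute)
    from div[OF deg this] have "q = 0"
      using sum_multiplicities_le_degree[OF _ assms(1)] deg n by fastforce
    then show "x j = 0" using cq[of j] j by simp
  qed
  then show ?thesis using v by blast
qed

lemma jordan_block_shift: "jordan_block m b = jordan_block m a + (b - a) \<cdot>\<^sub>m 1\<^sub>m m"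
  for a b :: "'k::comm_ring_1"
  by (rule eq_matI) (auto simp: jordan_block_def)

lemma jordan_block_commute:
  "jordan_block m a * jordan_block m b = jordan_block m b * jordan_block m (a :: 'k::comm_ring_1)"
proof -
  have J: "jordan_block m a \<in> carrier_mat m m" by simp
  show ?thesis
    unfolding jordan_block_shift[of m b a]
    by (simp add: mult_add_distrib_mat[OF J J] add_mult_distrib_mat[OF J _ J]
        mult_smult_distrib[OF J one_carrier_mat] mult_smult_assoc_mat[OF one_carrier_mat J])
qed

lemma mult_block_diag:
  assumes "A \<in> carrier_mat m m" "A' \<in> carrier_mat m m" "B \<in> carrier_mat l l" "B' \<in> carrier_mat l l"
  shows "four_block_mat A (0\<^sub>m m l) (0\<^sub>m l m) B * four_block_mat A' (0\<^sub>m m l) (0\<^sub>m l m) B'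
    = four_block_mat (A * A') (0\<^sub>m m l) (0\<^sub>m l m) (B * (B' :: 'k::comm_ring_1 mat))"
  using assms by (subst mult_four_block_mat[of _ m m _ l _ l _ _ m _ l]) auto

lemma jordan_matrix_commute:
  fixes ts :: "(nat \<times> 'k::comm_ring_1 \<times> 'k) list"
  shows "jordan_matrix (map (\<lambda>(m, a, b). (m, a)) ts) * jordan_matrix (map (\<lambda>(m, a, b). (m, b)) ts)
    = jordan_matrix (map (\<lambda>(m, a, b). (m, b)) ts) * jordan_matrix (map (\<lambda>(m, a, b). (m, a)) ts)"
proof (induction ts)
  case Nil
  then show ?case by simp
next
  case (Cons t ts)
  obtain m a b where t: "t = (m, a, b)" by (cases t)
  let ?A = "jordan_matrix (map (\<lambda>(m, a, b). (m, a)) ts)"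
  let ?B = "jordan_matrix (map (\<lambda>(m, a, b). (m, b)) ts)"
  let ?M = "sum_list (map fst ts)"
  have fst: "map fst (map (\<lambda>(m, a, b). (m, a)) ts) = map fst ts"
    "map fst (map (\<lambda>(m, a, b). (m, b)) ts) = map fst ts" by auto
  have C: "?A \<in> carrier_mat ?M ?M" "?B \<in> carrier_mat ?M ?M"
    using jordan_matrix_carrier[of "map (\<lambda>(m, a, b). (m, a)) ts"]
      jordan_matrix_carrier[of "map (\<lambda>(m, a, b). (m, b)) ts"] unfolding fst by auto
  have four: "jordan_matrix ((m, c) # ks) = four_block_mat (jordan_block m c)
      (0\<^sub>m m (sum_list (map fst ks))) (0\<^sub>m (sum_list (map fst ks)) m) (jordan_matrix ks)"
    for c and ks :: "(nat \<times> 'k) list"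
    using jordan_matrix_dim[of ks] unfolding jordan_matrix_def by (simp add: Let_def)
  have eqs: "jordan_matrix (map (\<lambda>(m, a, b). (m, a)) (t # ts))
      = four_block_mat (jordan_block m a) (0\<^sub>m m ?M) (0\<^sub>m ?M m) ?A"
    "jordan_matrix (map (\<lambda>(m, a, b). (m, b)) (t # ts))
      = four_block_mat (jordan_block m b) (0\<^sub>m m ?M) (0\<^sub>m ?M m) ?B"
    using four[of a "map (\<lambda>(m, a, b). (m, a)) ts"] four[of b "map (\<lambda>(m, a, b). (m, b)) ts"]
    unfolding fst by (simp_all add: t)
  show ?case
    unfolding eqs mult_block_diag[OF jordan_block_carrier jordan_block_carrier C]
      mult_block_diag[OF jordan_block_carrier jordan_block_carrier C(2,1)]
      Cons.IH jordan_block_commute[of m a b] ..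
qed

text \<open>
  Replace the eigenvalues of the Jordan blocks of \<open>A\<close> by pairwise distinct ones.  Each block changes by
  a scalar matrix, so the result commutes with \<open>A\<close>.
\<close>

lemma exists_commuting_cyclic:
  fixes A :: "'k::alg_closed_field mat"
  assumes A: "A \<in> carrier_mat n n"
  obtains R v where "R \<in> carrier_mat n n" "v \<in> carrier_vec n" "A * R = R * A"
    "det (krylov n R v) \<noteq> 0"
proof -
  obtain T where T: "T \<in> carrier_mat n n" "upper_triangular T" "similar_mat A T"
    using similar_to_upper_triangular[OF A] by blast
  obtain ns where "similar_mat T (jordan_matrix ns)"
    using triangular_to_jnf_vector[OF T(1,2)] unfolding jordan_nf_def by blast
  then have "similar_mat A (jordan_matrix ns)" using similar_mat_trans T(3) by blast
  then obtain P Q where wit: "similar_mat_wit A (jordan_matrix ns) P Q"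
    unfolding similar_mat_def by blast
  note w = similar_mat_witD2[OF A wit]
  have n: "n = sum_list (map fst ns)" using w(5) by auto
  obtain f :: "nat \<Rightarrow> 'k" where f: "inj f"
    using infinite_countable_subset[OF infinite_UNIV_alg_closed] by blast
  define ts where "ts = map (\<lambda>i. (fst (ns ! i), snd (ns ! i), f i)) [0..<length ns]"
  define ns' where "ns' = map (\<lambda>(m, a, b). (m, b)) ts"
  have ns: "ns = map (\<lambda>(m, a, b). (m, a)) ts"
    by (rule nth_equalityI) (auto simp: ts_def)
  have n': "n = sum_list (map fst ns')"
    unfolding n by (intro arg_cong[of _ _ sum_list] nth_equalityI) (auto simp: ns'_def ts_def)
  have "distinct (map snd ns')"
    using f by (auto simp: ns'_def ts_def o_def distinct_map inj_on_def)
  then obtain v where v: "v \<in> carrier_vec n" "det (krylov n (jordan_matrix ns') v) \<noteq> 0"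
    using jordan_matrix_distinct_cyclic[OF _ n'] by blast
  let ?J = "jordan_matrix ns" and ?J' = "jordan_matrix ns'"
  have J': "?J' \<in> carrier_mat n n" using jordan_matrix_carrier[of ns'] n' by simp
  have comm: "?J * ?J' = ?J' * ?J" using jordan_matrix_commute[of ts] ns ns'_def by simp
  define R where "R = P * ?J' * Q"
  have R: "R \<in> carrier_mat n n" using w J' by (simp add: R_def)
  have wit': "similar_mat_wit R ?J' P Q"
    using w J' R by (intro similar_mat_witI[of _ _ n]) (auto simp: R_def)
  have "A * R = P * (?J * ?J') * Q"
    unfolding R_def using conjugate_mult[OF w(6,7,2,5) J'] w(3) by simp
  also have "\<dots> = R * A"
    unfolding R_def comm using conjugate_mult[OF w(6,7,2) J' w(5)] w(3) by simp
  finally have "A * R = R * A" .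
  moreover have "det (krylov n R (P *\<^sub>v v)) \<noteq> 0"
  proof -
    have "det (P * Q) \<noteq> 0" using w(1) by simp
    then have "det P \<noteq> 0" using det_mult[OF w(6,7)] by auto
    moreover have "det (krylov n R (P *\<^sub>v v)) = det P * det (krylov n ?J' v)"
      unfolding krylov_conjugate[OF wit' R v(1)] by (rule det_mult[OF w(6) krylov_carrier])
    ultimately show ?thesis using v(2) by simp
  qed
  moreover have "P *\<^sub>v v \<in> carrier_vec n" using w v by auto
  ultimately show ?thesis using that R by blast
qed

section \<open>Matrices of functions\<close>

text \<open>
  Matrices whose entries belong to a ring of functions are closed under the usual operations.  Both
  polynomial functions and fractions are such rings.
\<close>

locale function_algebra =
  fixes F :: "('x \<Rightarrow> 'k::comm_ring_1) set"
  assumes const: "(\<lambda>_. c) \<in> F"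
    and add: "f \<in> F \<Longrightarrow> g \<in> F \<Longrightarrow> (\<lambda>x. f x + g x) \<in> F"
    and mult: "f \<in> F \<Longrightarrow> g \<in> F \<Longrightarrow> (\<lambda>x. f x * g x) \<in> F"
begin

lemma sum: "(\<And>i. i \<in> I \<Longrightarrow> f i \<in> F) \<Longrightarrow> (\<lambda>x. \<Sum>i\<in>I. f i x) \<in> F"
  by (induction I rule: infinite_finite_induct) (auto intro: const add)

lemma prod: "(\<And>i. i \<in> I \<Longrightarrow> f i \<in> F) \<Longrightarrow> (\<lambda>x. \<Prod>i\<in>I. f i x) \<in> F"
  by (induction I rule: infinite_finite_induct) (auto intro: const mult)

lemma uminus: "f \<in> F \<Longrightarrow> (\<lambda>x. - f x) \<in> F"
  using mult[OF const[of "-1"], of f] by simp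

definition mats :: "nat \<Rightarrow> nat \<Rightarrow> ('x \<Rightarrow> 'k mat) set" where
  "mats n m = {M. (\<forall>x. M x \<in> carrier_mat n m) \<and> (\<forall>i<n. \<forall>j<m. (\<lambda>x. M x $$ (i, j)) \<in> F)}"

definition vecs :: "nat \<Rightarrow> ('x \<Rightarrow> 'k vec) set" where
  "vecs n = {v. (\<forall>x. v x \<in> carrier_vec n) \<and> (\<forall>i<n. (\<lambda>x. v x $ i) \<in> F)}"

lemma matsD: "M \<in> mats n m \<Longrightarrow> M x \<in> carrier_mat n m"
  "M \<in> mats n m \<Longrightarrow> i < n \<Longrightarrow> j < m \<Longrightarrow> (\<lambda>x. M x $$ (i, j)) \<in> F"
  by (auto simp: mats_def)

lemma vecsD: "v \<in> vecs n \<Longrightarrow> v x \<in> carrier_vec n"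
  "v \<in> vecs n \<Longrightarrow> i < n \<Longrightarrow> (\<lambda>x. v x $ i) \<in> F"
  by (auto simp: vecs_def)

lemma mats_mat:
  assumes "\<And>i j. i < n \<Longrightarrow> j < m \<Longrightarrow> (\<lambda>x. f x i j) \<in> F"
  shows "(\<lambda>x. mat n m (\<lambda>(i, j). f x i j)) \<in> mats n m"
  using assms by (auto simp: mats_def)

lemma vecs_vec:
  assumes "\<And>i. i < n \<Longrightarrow> (\<lambda>x. f x i) \<in> F"
  shows "(\<lambda>x. vec n (f x)) \<in> vecs n"
  using assms by (auto simp: vecs_def)

lemma mats_const: "M \<in> carrier_mat n m \<Longrightarrow> (\<lambda>_. M) \<in> mats n m"
  by (auto simp: mats_def const)

lemma vecs_const: "v \<in> carrier_vec n \<Longrightarrow> (\<lambda>_. v) \<in> vecs n"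
  by (auto simp: vecs_def const)

lemma mats_add:
  assumes "M \<in> mats n m" "N \<in> mats n m"
  shows "(\<lambda>x. M x + N x) \<in> mats n m"
  unfolding mats_def
proof (intro CollectI conjI allI impI)
  note c = matsD(1)[OF assms(1)] matsD(1)[OF assms(2)]
  show "M x + N x \<in> carrier_mat n m" for x using c by auto
  fix i j assume ij: "i < n" "j < m"
  have "(M x + N x) $$ (i, j) = M x $$ (i, j) + N x $$ (i, j)" for x
    using c[of x] ij by simp
  then show "(\<lambda>x. (M x + N x) $$ (i, j)) \<in> F"
    using add[OF matsD(2)[OF assms(1) ij] matsD(2)[OF assms(2) ij]] by simp
qed

lemma mats_smult:
  assumes "c \<in> F" "M \<in> mats n m"
  shows "(\<lambda>x. c x \<cdot>\<^sub>m M x) \<in> mats n m"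
  unfolding mats_def
proof (intro CollectI conjI allI impI)
  note cM = matsD(1)[OF assms(2)]
  show "c x \<cdot>\<^sub>m M x \<in> carrier_mat n m" for x using cM by auto
  fix i j assume ij: "i < n" "j < m"
  have "(c x \<cdot>\<^sub>m M x) $$ (i, j) = c x * M x $$ (i, j)" for x
    using cM[of x] ij by simp
  then show "(\<lambda>x. (c x \<cdot>\<^sub>m M x) $$ (i, j)) \<in> F"
    using mult[OF assms(1) matsD(2)[OF assms(2) ij]] by simp
qed

lemma mats_mult:
  assumes "M \<in> mats n m" "N \<in> mats m l"
  shows "(\<lambda>x. M x * N x) \<in> mats n l"
  unfolding mats_def
proof (intro CollectI conjI allI impI)
  note c = matsD(1)[OF assms(1)] matsD(1)[OF assms(2)]
  show "M x * N x \<in> carrier_mat n l" for x using c by (rule mult_carrier_mat)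
  fix i j assume ij: "i < n" "j < l"
  have "(\<lambda>x. (M x * N x) $$ (i, j)) = (\<lambda>x. \<Sum>k<m. M x $$ (i, k) * N x $$ (k, j))"
    using index_mult_mat_sum[OF c ij] by blast
  moreover have "(\<lambda>x. \<Sum>k<m. M x $$ (i, k) * N x $$ (k, j)) \<in> F"
    by (intro sum mult matsD(2)[OF assms(1)] matsD(2)[OF assms(2)] ij) auto
  ultimately show "(\<lambda>x. (M x * N x) $$ (i, j)) \<in> F" by simp
qed

lemma vecs_mult:
  assumes "M \<in> mats n m" "v \<in> vecs m"
  shows "(\<lambda>x. M x *\<^sub>v v x) \<in> vecs n"
  unfolding vecs_def
proof (intro CollectI conjI allI impI)
  note c = matsD(1)[OF assms(1)] vecsD(1)[OF assms(2)]
  show "M x *\<^sub>v v x \<in> carrier_vec n" for x using c by (rule mult_mat_vec_carrier)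
  fix i assume i: "i < n"
  have "(\<lambda>x. (M x *\<^sub>v v x) $ i) = (\<lambda>x. \<Sum>k<m. M x $$ (i, k) * v x $ k)"
    using index_mult_mat_vec_sum[OF c i] by blast
  moreover have "(\<lambda>x. \<Sum>k<m. M x $$ (i, k) * v x $ k) \<in> F"
    by (intro sum mult matsD(2)[OF assms(1)] vecsD(2)[OF assms(2)] i) auto
  ultimately show "(\<lambda>x. (M x *\<^sub>v v x) $ i) \<in> F" by simp
qed

lemma mats_pow:
  assumes "M \<in> mats n n"
  shows "(\<lambda>x. M x ^\<^sub>m j) \<in> mats n n"
proof (induction j)
  case 0
  have "(\<lambda>x. M x ^\<^sub>m 0) = (\<lambda>_. 1\<^sub>m n)" using carrier_matD(1)[OF matsD(1)[OF assms]] by simp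
  then show ?case using mats_const[of "1\<^sub>m n"] by simp
next
  case (Suc j)
  then show ?case using mats_mult[OF Suc assms] by simp
qed

lemma det:
  assumes "M \<in> mats n n"
  shows "(\<lambda>x. det (M x)) \<in> F"
proof -
  have "(\<lambda>x. det (M x)) =
      (\<lambda>x. \<Sum>p\<in>{p. p permutes {0..<n}}. signof p * (\<Prod>i = 0..<n. M x $$ (i, p i)))"
    using det_def'[OF matsD(1)[OF assms]] by blast
  moreover have "(\<lambda>x. \<Sum>p\<in>{p. p permutes {0..<n}}. signof p * (\<Prod>i = 0..<n. M x $$ (i, p i))) \<in> F"
  proof (intro sum mult const prod)
    fix p i assume "p \<in> {p. p permutes {0..<n}}" "i \<in> {0..<n}"
    then have "i < n" "p i < n" by (auto dest: permutes_in_image)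
    then show "(\<lambda>x. M x $$ (i, p i)) \<in> F" by (rule matsD(2)[OF assms])
  qed
  ultimately show ?thesis by simp
qed

lemma mats_adj:
  assumes "M \<in> mats n n"
  shows "(\<lambda>x. adj_mat (M x)) \<in> mats n n"
proof -
  have dim: "dim_row (M x) = n" "dim_col (M x) = n" for x using matsD(1)[OF assms, of x] by auto
  have "(\<lambda>x. cofactor (M x) j i) \<in> F" if ij: "i < n" "j < n" for i j
  proof -
    have "(\<lambda>x. mat_delete (M x) j i) \<in> mats (n - 1) (n - 1)"
      unfolding mat_delete_def dim
      by (intro mats_mat matsD(2)[OF assms]) (use ij in auto)
    then show ?thesis unfolding cofactor_def by (intro mult const det)
  qed
  then show ?thesis unfolding adj_mat_def dim by (intro mats_mat)
qed

lemma mats_krylov: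
  assumes "B \<in> mats n n" "v \<in> vecs n"
  shows "(\<lambda>x. krylov n (B x) (v x)) \<in> mats n n"
  unfolding krylov_def
  by (intro mats_mat vecsD(2)[OF vecs_mult[OF mats_pow[OF assms(1)] assms(2)]])

end

lemma function_algebra_poly_funs: "function_algebra (poly_funs X)"
  by unfold_locales (auto intro: poly_funs.intros)

lemma function_algebra_fractions:
  "\<delta> \<in> poly_funs X \<Longrightarrow> function_algebra (fractions X \<delta> D)"
  by unfold_locales (auto intro: poly_funs_in_fractions poly_funs.const fractions_add fractions_mult)

section \<open>Pairs with bracket one and a cyclic vector\<close>

text \<open>
  The quotient is written with the adjugate so that its entries are visibly fractions with
  denominator \<open>det g\<close>.
\<close>

lemma divide_by_invertible:
  fixes g :: "'k::field mat"
  assumes g: "g \<in> carrier_mat n n" "det g \<noteq> 0" and M: "M \<in> carrier_mat n n" and X: "X \<in> carrier_mat n n"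
  shows "X = (1 / det g) \<cdot>\<^sub>m (M * adj_mat g) \<longleftrightarrow> X * g = M"
proof
  note a = adj_mat[OF g(1)]
  assume "X = (1 / det g) \<cdot>\<^sub>m (M * adj_mat g)"
  then have "X * g = (1 / det g) \<cdot>\<^sub>m (M * adj_mat g * g)"
    using mult_smult_assoc_mat[of "M * adj_mat g" n n g n] a g M by auto
  also have "M * adj_mat g * g = M * (adj_mat g * g)"
    using M a(1) g(1) by (rule assoc_mult_mat)
  also have "\<dots> = det g \<cdot>\<^sub>m M"
    unfolding a(3) using mult_smult_distrib[OF M one_carrier_mat] right_mult_one_mat[OF M] by simp
  finally show "X * g = M" using g(2) M by (auto intro!: eq_matI)
next
  note a = adj_mat[OF g(1)]
  assume eq: "X * g = M"
  have "M * adj_mat g = X * (g * adj_mat g)"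
    unfolding eq[symmetric] using X g(1) a(1) by (rule assoc_mult_mat)
  also have "\<dots> = det g \<cdot>\<^sub>m X"
    unfolding a(2) using mult_smult_distrib[OF X one_carrier_mat] right_mult_one_mat[OF X] by simp
  finally show "X = (1 / det g) \<cdot>\<^sub>m (M * adj_mat g)" using g(2) X by (auto intro!: eq_matI)
qed

lemma bracket_one_pairs_iff:
  "(A, B) \<in> bracket_one_pairs n \<longleftrightarrow>
     A \<in> carrier_mat n n \<and> B \<in> carrier_mat n n \<and> A * B - B * A = 1\<^sub>m n"
  by (auto simp: bracket_one_pairs_def gl_pairs_def lie_bracket_def)

text \<open>
  This is \<open>[A, B\<^sup>j] = j B\<^bsup>j - 1\<^esup>\<close>: the bracket with \<open>A\<close> is a derivation that maps \<open>B\<close> to \<open>1\<close>.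
\<close>

lemma bracket_one_power:
  fixes A B :: "'k::field mat"
  assumes A: "A \<in> carrier_mat n n" and B: "B \<in> carrier_mat n n" and br: "A * B - B * A = 1\<^sub>m n"
    and v: "v \<in> carrier_vec n"
  shows "A *\<^sub>v (B ^\<^sub>m j *\<^sub>v v) = B ^\<^sub>m j *\<^sub>v (A *\<^sub>v v) + of_nat j \<cdot>\<^sub>v (B ^\<^sub>m (j - 1) *\<^sub>v v)"
proof -
  have AB: "A * B = B * A + 1\<^sub>m n"
  proof (rule eq_matI)
    fix i j assume ij: "i < dim_row (B * A + 1\<^sub>m n)" "j < dim_col (B * A + 1\<^sub>m n)"
    then have "(A * B - B * A) $$ (i, j) = (1\<^sub>m n :: 'k mat) $$ (i, j)" using br by simp
    then show "(A * B) $$ (i, j) = (B * A + 1\<^sub>m n) $$ (i, j)"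
      using ij A B by (auto simp: diff_eq_eq)
  qed (use A B in auto)
  have step: "A *\<^sub>v (B *\<^sub>v u) = B *\<^sub>v (A *\<^sub>v u) + u" if u: "u \<in> carrier_vec n" for u
  proof -
    have "A *\<^sub>v (B *\<^sub>v u) = (B * A + 1\<^sub>m n) *\<^sub>v u"
      using assoc_mult_mat_vec[OF A B u] AB by simp
    also have "\<dots> = (B * A) *\<^sub>v u + 1\<^sub>m n *\<^sub>v u"
      using A B u by (intro add_mult_distrib_mat_vec) auto
    finally show ?thesis using A B u by (simp add: assoc_mult_mat_vec[OF B A u])
  qed
  have Bv: "B ^\<^sub>m i *\<^sub>v u \<in> carrier_vec n" if "u \<in> carrier_vec n" for i u
    using pow_carrier_mat[OF B] that by (rule mult_mat_vec_carrier)
  have Av: "A *\<^sub>v v \<in> carrier_vec n" using A v by (rule mult_mat_vec_carrier)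
  show ?thesis
  proof (induction j)
    case 0
    then show ?case using A B v Av by (auto intro!: eq_vecI)
  next
    case (Suc j)
    have "A *\<^sub>v (B ^\<^sub>m Suc j *\<^sub>v v) = B *\<^sub>v (A *\<^sub>v (B ^\<^sub>m j *\<^sub>v v)) + B ^\<^sub>m j *\<^sub>v v"
      unfolding pow_mat_Suc_vec[OF B v] using Bv[OF v] by (rule step)
    also have "B *\<^sub>v (A *\<^sub>v (B ^\<^sub>m j *\<^sub>v v))
        = B *\<^sub>v (B ^\<^sub>m j *\<^sub>v (A *\<^sub>v v)) + B *\<^sub>v (of_nat j \<cdot>\<^sub>v (B ^\<^sub>m (j - 1) *\<^sub>v v))"
      unfolding Suc using B Bv[OF Av] Bv[OF v] by (intro mult_add_distrib_mat_vec) auto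
    also have "B *\<^sub>v (B ^\<^sub>m j *\<^sub>v (A *\<^sub>v v)) = B ^\<^sub>m Suc j *\<^sub>v (A *\<^sub>v v)"
      by (rule pow_mat_Suc_vec[OF B Av, symmetric])
    also have "B *\<^sub>v (of_nat j \<cdot>\<^sub>v (B ^\<^sub>m (j - 1) *\<^sub>v v)) = of_nat j \<cdot>\<^sub>v (B ^\<^sub>m j *\<^sub>v v)"
    proof -
      have "B *\<^sub>v (of_nat j \<cdot>\<^sub>v (B ^\<^sub>m (j - 1) *\<^sub>v v)) = of_nat j \<cdot>\<^sub>v (B *\<^sub>v (B ^\<^sub>m (j - 1) *\<^sub>v v))"
        using B Bv[OF v] by (intro mult_mat_vec) auto
      also have "\<dots> = of_nat j \<cdot>\<^sub>v (B ^\<^sub>m j *\<^sub>v v)"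
      proof (cases j)
        case 0
        then show ?thesis using B v by (auto intro!: eq_vecI)
      next
        case (Suc l)
        then show ?thesis using pow_mat_Suc_vec[OF B v, of l] by simp
      qed
      finally show ?thesis .
    qed
    finally have eq: "A *\<^sub>v (B ^\<^sub>m Suc j *\<^sub>v v)
        = B ^\<^sub>m Suc j *\<^sub>v (A *\<^sub>v v) + of_nat j \<cdot>\<^sub>v (B ^\<^sub>m j *\<^sub>v v) + B ^\<^sub>m j *\<^sub>v v" .
    show ?case
      unfolding eq
    proof (rule eq_vecI)
      fix i assume i: "i < dim_vec (B ^\<^sub>m Suc j *\<^sub>v (A *\<^sub>v v) + of_nat (Suc j) \<cdot>\<^sub>v (B ^\<^sub>m (Suc j - 1) *\<^sub>v v))"
      then have "i < n" using B by auto
      then show "(B ^\<^sub>m Suc j *\<^sub>v (A *\<^sub>v v) + of_nat j \<cdot>\<^sub>v (B ^\<^sub>m j *\<^sub>v v) + B ^\<^sub>m j *\<^sub>v v) $ i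
          = (B ^\<^sub>m Suc j *\<^sub>v (A *\<^sub>v v) + of_nat (Suc j) \<cdot>\<^sub>v (B ^\<^sub>m (Suc j - 1) *\<^sub>v v)) $ i"
        using carrier_vecD[OF Bv[OF v, of j]] carrier_vecD[OF Bv[OF Av, of "Suc j"]]
        by (simp del: pow_mat.simps index_mult_mat_vec add: algebra_simps)
    qed (use carrier_vecD[OF Bv[OF v, of j]] carrier_vecD[OF Bv[OF Av, of "Suc j"]] in
        \<open>simp del: pow_mat.simps\<close>)
  qed
qed

text \<open>
  It suffices to test the bracket on the Krylov basis.  The derivation rule is also required for
  \<open>j = n\<close>, because \<open>B\<close> maps the last basis vector to \<open>B\<^sup>n v\<close>.
\<close>

lemma bracket_oneI:
  fixes A B :: "'k::field mat"
  assumes A: "A \<in> carrier_mat n n" and B: "B \<in> carrier_mat n n"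
    and v: "v \<in> carrier_vec n" and w: "w \<in> carrier_vec n" and cyc: "det (krylov n B v) \<noteq> 0"
    and der: "\<And>i j. j \<le> n \<Longrightarrow> i < n \<Longrightarrow>
      (A *\<^sub>v (B ^\<^sub>m j *\<^sub>v v)) $ i = (B ^\<^sub>m j *\<^sub>v w) $ i + of_nat j * (B ^\<^sub>m (j - 1) *\<^sub>v v) $ i"
  shows "A * B - B * A = 1\<^sub>m n"
proof -
  let ?K = "krylov n B v" and ?X = "A * B - B * A"
  have X: "?X \<in> carrier_mat n n" using A B by auto
  have Bv: "B ^\<^sub>m i *\<^sub>v u \<in> carrier_vec n" if "u \<in> carrier_vec n" for i u
    using pow_carrier_mat[OF B] that by (rule mult_mat_vec_carrier)
  have "?X * ?K = ?K"
  proof (rule eq_matI)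
    fix i j assume "i < dim_row ?K" "j < dim_col ?K"
    then have i: "i < n" and j: "j < n" by auto
    let ?u = "B ^\<^sub>m j *\<^sub>v v"
    have Au: "A *\<^sub>v ?u \<in> carrier_vec n" using A Bv[OF v] by (rule mult_mat_vec_carrier)
    have "(?X * ?K) $$ (i, j) = (\<Sum>k<n. ?X $$ (i, k) * ?u $ k)"
      using index_mult_mat_sum[OF X krylov_carrier i j] j by simp
    also have "\<dots> = (?X *\<^sub>v ?u) $ i"
      by (rule index_mult_mat_vec_sum[OF X Bv[OF v] i, symmetric])
    also have "?X *\<^sub>v ?u = (A * B) *\<^sub>v ?u - (B * A) *\<^sub>v ?u"
      using A B Bv[OF v] by (intro minus_mult_distrib_mat_vec) auto
    also have "(A * B) *\<^sub>v ?u = A *\<^sub>v (B ^\<^sub>m Suc j *\<^sub>v v)"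
      unfolding pow_mat_Suc_vec[OF B v] using A B Bv[OF v] by (rule assoc_mult_mat_vec)
    also have "(B * A) *\<^sub>v ?u = B *\<^sub>v (A *\<^sub>v ?u)"
      using B A Bv[OF v] by (rule assoc_mult_mat_vec)
    also have "(A *\<^sub>v (B ^\<^sub>m Suc j *\<^sub>v v) - B *\<^sub>v (A *\<^sub>v ?u)) $ i
        = (A *\<^sub>v (B ^\<^sub>m Suc j *\<^sub>v v)) $ i - (B *\<^sub>v (A *\<^sub>v ?u)) $ i"
      using B Au i by (intro index_minus_vec) auto
    also have "(B *\<^sub>v (A *\<^sub>v ?u)) $ i = (B ^\<^sub>m Suc j *\<^sub>v w) $ i + of_nat j * ?u $ i"
    proof -
      have "(B *\<^sub>v (A *\<^sub>v ?u)) $ i = (\<Sum>k<n. B $$ (i, k) * (A *\<^sub>v ?u) $ k)"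
        by (rule index_mult_mat_vec_sum[OF B Au i])
      also have "\<dots> = (\<Sum>k<n. B $$ (i, k) * ((B ^\<^sub>m j *\<^sub>v w) $ k + of_nat j * (B ^\<^sub>m (j - 1) *\<^sub>v v) $ k))"
        using der[of j] j by (intro sum.cong) auto
      also have "\<dots> = (\<Sum>k<n. B $$ (i, k) * (B ^\<^sub>m j *\<^sub>v w) $ k)
          + of_nat j * (\<Sum>k<n. B $$ (i, k) * (B ^\<^sub>m (j - 1) *\<^sub>v v) $ k)"
        by (simp add: distrib_left sum.distrib sum_distrib_left mult_ac)
      also have "(\<Sum>k<n. B $$ (i, k) * (B ^\<^sub>m j *\<^sub>v w) $ k) = (B ^\<^sub>m Suc j *\<^sub>v w) $ i"
        unfolding pow_mat_Suc_vec[OF B w] by (rule index_mult_mat_vec_sum[OF B Bv[OF w] i, symmetric])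
      also have "of_nat j * (\<Sum>k<n. B $$ (i, k) * (B ^\<^sub>m (j - 1) *\<^sub>v v) $ k) = of_nat j * ?u $ i"
      proof (cases j)
        case (Suc l)
        have "(\<Sum>k<n. B $$ (i, k) * (B ^\<^sub>m l *\<^sub>v v) $ k) = (B ^\<^sub>m Suc l *\<^sub>v v) $ i"
          unfolding pow_mat_Suc_vec[OF B v] by (rule index_mult_mat_vec_sum[OF B Bv[OF v] i, symmetric])
        then show ?thesis by (simp only: Suc diff_Suc_1)
      qed simp
      finally show ?thesis .
    qed
    also have "(A *\<^sub>v (B ^\<^sub>m Suc j *\<^sub>v v)) $ i = (B ^\<^sub>m Suc j *\<^sub>v w) $ i + of_nat (Suc j) * ?u $ i"
      using der[of "Suc j" i] i j by (simp del: pow_mat.simps)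
    finally show "(?X * ?K) $$ (i, j) = ?K $$ (i, j)"
      using i j by (simp del: pow_mat.simps add: algebra_simps)
  qed (use A B in auto)
  then have "?X = (1 / det ?K) \<cdot>\<^sub>m (?K * adj_mat ?K)"
    using divide_by_invertible[OF krylov_carrier cyc krylov_carrier X] by blast
  moreover have "1\<^sub>m n = (1 / det ?K) \<cdot>\<^sub>m (?K * adj_mat ?K)"
    using divide_by_invertible[OF krylov_carrier cyc krylov_carrier one_carrier_mat]
      left_mult_one_mat[OF krylov_carrier] by blast
  ultimately show ?thesis by simp
qed

section \<open>A chart of the variety\<close>

text \<open>
  A pair for which the first unit vector is cyclic under \<open>B\<close> is determined by the Krylov basis of
  that vector, by its image under \<open>A\<close>, and by the characteristic polynomial of \<open>B\<close>, which has
  only powers of \<open>x\<^sup>p\<close>.  A parameter \<open>\<xi>\<close> stores column \<open>j > 0\<close> of the basis in \<open>\<xi> (i, j)\<close>, the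
  image under \<open>A\<close> in the free column \<open>\<xi> (i, 0)\<close>, and the coefficient of \<open>x\<^bsup>p l\<^esup>\<close> in \<open>\<xi> (n, l)\<close>.
  The matrices \<open>shifted_frame\<close> and \<open>image_frame\<close> are what the products of \<open>B\<close> and of \<open>A\<close> with \<open>frame\<close>
  have to be; the coordinates of \<open>B\<^sup>n e\<close> in the Krylov basis are given by \<open>relation_coeff\<close>.
\<close>

definition frame :: "nat \<Rightarrow> (nat \<times> nat \<Rightarrow> 'k::field) \<Rightarrow> 'k mat" where
  "frame n \<xi> = mat n n (\<lambda>(i, j). if j = 0 then if i = 0 then 1 else 0 else \<xi> (i, j))"

definition relation_coeff :: "nat \<Rightarrow> nat \<Rightarrow> (nat \<times> nat \<Rightarrow> 'k::field) \<Rightarrow> nat \<Rightarrow> 'k" where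
  "relation_coeff n p \<xi> l = (if p dvd l then - \<xi> (n, l div p) else 0)"

definition shifted_frame :: "nat \<Rightarrow> nat \<Rightarrow> (nat \<times> nat \<Rightarrow> 'k::field) \<Rightarrow> 'k mat" where
  "shifted_frame n p \<xi> = mat n n (\<lambda>(i, j). if Suc j < n then frame n \<xi> $$ (i, Suc j)
     else \<Sum>l<n. frame n \<xi> $$ (i, l) * relation_coeff n p \<xi> l)"

definition chart_B :: "nat \<Rightarrow> nat \<Rightarrow> (nat \<times> nat \<Rightarrow> 'k::field) \<Rightarrow> 'k mat" where
  "chart_B n p \<xi> = (1 / det (frame n \<xi>)) \<cdot>\<^sub>m (shifted_frame n p \<xi> * adj_mat (frame n \<xi>))"

definition image_frame :: "nat \<Rightarrow> 'k mat \<Rightarrow> 'k vec \<Rightarrow> 'k vec \<Rightarrow> 'k::field mat" where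
  "image_frame n B v w = mat n n (\<lambda>(i, j).
     (B ^\<^sub>m j *\<^sub>v w) $ i + of_nat j * (B ^\<^sub>m (j - 1) *\<^sub>v v) $ i)"

definition chart_A :: "nat \<Rightarrow> nat \<Rightarrow> (nat \<times> nat \<Rightarrow> 'k::field) \<Rightarrow> 'k mat" where
  "chart_A n p \<xi> = (1 / det (frame n \<xi>)) \<cdot>\<^sub>m
     (image_frame n (chart_B n p \<xi>) (unit_vec n 0) (vec n (\<lambda>i. \<xi> (i, 0))) * adj_mat (frame n \<xi>))"

lemma frame_carrier [simp]: "frame n \<xi> \<in> carrier_mat n n"
  and shifted_frame_carrier [simp]: "shifted_frame n p \<xi> \<in> carrier_mat n n"
  and image_frame_carrier [simp]: "image_frame n B v w \<in> carrier_mat n n"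
  by (auto simp: frame_def shifted_frame_def image_frame_def)

lemma chart_B_carrier [simp]: "chart_B n p \<xi> \<in> carrier_mat n n"
  and chart_A_carrier [simp]: "chart_A n p \<xi> \<in> carrier_mat n n"
  unfolding chart_A_def chart_B_def
  by (intro smult_carrier_mat mult_carrier_mat[of _ n n] adj_mat(1) frame_carrier
      shifted_frame_carrier image_frame_carrier)+

context
  fixes n p :: nat and \<xi> :: "nat \<times> nat \<Rightarrow> 'k::field"
  assumes det: "det (frame n \<xi>) \<noteq> 0" and n: "n > 0"
begin

lemma chart_B_frame: "chart_B n p \<xi> * frame n \<xi> = shifted_frame n p \<xi>"
  by (rule iffD1[OF divide_by_invertible[OF frame_carrier det shifted_frame_carrier chart_B_carrier]
        chart_B_def])

lemma chart_A_frame: "chart_A n p \<xi> * frame n \<xi> =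
    image_frame n (chart_B n p \<xi>) (unit_vec n 0) (vec n (\<lambda>i. \<xi> (i, 0)))"
  by (rule iffD1[OF divide_by_invertible[OF frame_carrier det image_frame_carrier chart_A_carrier]
        chart_A_def])

lemma chart_B_pow_carrier: "v \<in> carrier_vec n \<Longrightarrow> chart_B n p \<xi> ^\<^sub>m j *\<^sub>v v \<in> carrier_vec n"
  by (rule mult_mat_vec_carrier[OF pow_carrier_mat[OF chart_B_carrier]])

lemma chart_B_Suc:
  assumes "\<And>k. k < n \<Longrightarrow> (chart_B n p \<xi> ^\<^sub>m j *\<^sub>v unit_vec n 0) $ k = frame n \<xi> $$ (k, j)"
    and "i < n" "j < n"
  shows "(chart_B n p \<xi> ^\<^sub>m Suc j *\<^sub>v unit_vec n 0) $ i = shifted_frame n p \<xi> $$ (i, j)"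
proof -
  have "(chart_B n p \<xi> ^\<^sub>m Suc j *\<^sub>v unit_vec n 0) $ i
      = (\<Sum>k<n. chart_B n p \<xi> $$ (i, k) * frame n \<xi> $$ (k, j))"
    unfolding pow_mat_Suc_vec[OF chart_B_carrier unit_vec_carrier]
      index_mult_mat_vec_sum[OF chart_B_carrier chart_B_pow_carrier[OF unit_vec_carrier] assms(2)]
    using assms(1) by (intro sum.cong) auto
  also have "\<dots> = (chart_B n p \<xi> * frame n \<xi>) $$ (i, j)"
    by (rule index_mult_mat_sum[OF chart_B_carrier frame_carrier assms(2,3), symmetric])
  finally show ?thesis unfolding chart_B_frame .
qed

lemma chart_B_pow_index:
  "j < n \<Longrightarrow> i < n \<Longrightarrow> (chart_B n p \<xi> ^\<^sub>m j *\<^sub>v unit_vec n 0) $ i = frame n \<xi> $$ (i, j)"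
proof (induction j arbitrary: i)
  case 0
  have "chart_B n p \<xi> ^\<^sub>m 0 *\<^sub>v unit_vec n 0 = (unit_vec n 0 :: 'k vec)"
    using carrier_matD(1)[OF chart_B_carrier, of n p \<xi>] by simp
  then show ?case using 0 by (simp add: frame_def)
next
  case (Suc j)
  then show ?case using chart_B_Suc[of j i] by (simp add: shifted_frame_def del: pow_mat.simps)
qed

lemma chart_krylov: "krylov n (chart_B n p \<xi>) (unit_vec n 0) = frame n \<xi>"
  using carrier_matD[OF frame_carrier, of n \<xi>] by (intro eq_matI) (simp_all add: chart_B_pow_index)

lemma chart_B_pow_n:
  assumes i: "i < n"
  shows "(chart_B n p \<xi> ^\<^sub>m n *\<^sub>v unit_vec n 0) $ i
    = (\<Sum>l<n. frame n \<xi> $$ (i, l) * relation_coeff n p \<xi> l)"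
proof -
  obtain m where m: "n = Suc m" using n by (cases n) auto
  have "(chart_B n p \<xi> ^\<^sub>m Suc m *\<^sub>v unit_vec n 0) $ i = shifted_frame n p \<xi> $$ (i, m)"
    using i m by (intro chart_B_Suc chart_B_pow_index) auto
  then show ?thesis using i by (simp add: shifted_frame_def m del: pow_mat.simps)
qed

lemma chart_A_pow_index:
  assumes j: "j < n" and i: "i < n"
  shows "(chart_A n p \<xi> *\<^sub>v (chart_B n p \<xi> ^\<^sub>m j *\<^sub>v unit_vec n 0)) $ i
    = (chart_B n p \<xi> ^\<^sub>m j *\<^sub>v vec n (\<lambda>i. \<xi> (i, 0))) $ i
      + of_nat j * (chart_B n p \<xi> ^\<^sub>m (j - 1) *\<^sub>v unit_vec n 0) $ i"
proof -
  have "(chart_A n p \<xi> *\<^sub>v (chart_B n p \<xi> ^\<^sub>m j *\<^sub>v unit_vec n 0)) $ i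
      = (\<Sum>k<n. chart_A n p \<xi> $$ (i, k) * frame n \<xi> $$ (k, j))"
    unfolding index_mult_mat_vec_sum[OF chart_A_carrier chart_B_pow_carrier[OF unit_vec_carrier] i]
    using j by (intro sum.cong) (auto simp: chart_B_pow_index)
  also have "\<dots> = (chart_A n p \<xi> * frame n \<xi>) $$ (i, j)"
    by (rule index_mult_mat_sum[OF chart_A_carrier frame_carrier i j, symmetric])
  finally show ?thesis unfolding chart_A_frame using i j by (simp add: image_frame_def)
qed

text \<open>
  The derivation rule holds on the basis by construction of \<open>A\<close>.  On \<open>B\<^sup>n e\<close> it follows by applying
  \<open>A\<close> to the relation between the powers of \<open>B\<close>: only exponents divisible by \<open>p\<close> occur there, and
  the derivatives of these powers vanish.
\<close>

lemma chart_in_variety: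
  assumes char: "CHAR('k) = p" and pn: "p dvd n"
  shows "(chart_A n p \<xi>, chart_B n p \<xi>) \<in> bracket_one_pairs n"
proof -
  let ?A = "chart_A n p \<xi>" and ?B = "chart_B n p \<xi>" and ?v = "unit_vec n 0 :: 'k vec"
  let ?w = "vec n (\<lambda>i. \<xi> (i, 0))" and ?x = "relation_coeff n p \<xi>"
  have cyc: "det (krylov n ?B ?v) \<noteq> 0" unfolding chart_krylov by (rule det)
  have nat0: "of_nat l = (0 :: 'k)" if "p dvd l" for l
    using that char by (simp add: of_nat_eq_0_iff_char_dvd)
  have der_n: "(?A *\<^sub>v (?B ^\<^sub>m n *\<^sub>v ?v)) $ i
      = (?B ^\<^sub>m n *\<^sub>v ?w) $ i + of_nat n * (?B ^\<^sub>m (n - 1) *\<^sub>v ?v) $ i" if i: "i < n" for i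
  proof -
    have "(?A *\<^sub>v (?B ^\<^sub>m n *\<^sub>v ?v)) $ i
        = (\<Sum>k<n. ?A $$ (i, k) * (\<Sum>l<n. frame n \<xi> $$ (k, l) * ?x l))"
      unfolding index_mult_mat_vec_sum[OF chart_A_carrier chart_B_pow_carrier[OF unit_vec_carrier] i]
      by (intro sum.cong) (auto simp: chart_B_pow_n)
    also have "\<dots> = (\<Sum>k<n. \<Sum>l<n. ?x l * (?A $$ (i, k) * frame n \<xi> $$ (k, l)))"
      by (simp add: sum_distrib_left mult_ac)
    also have "\<dots> = (\<Sum>l<n. \<Sum>k<n. ?x l * (?A $$ (i, k) * frame n \<xi> $$ (k, l)))"
      by (rule sum.swap)
    also have "\<dots> = (\<Sum>l<n. ?x l * (?B ^\<^sub>m l *\<^sub>v ?w) $ i)"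
    proof (rule sum.cong[OF refl])
      fix l assume "l \<in> {..<n}"
      then have l: "l < n" by simp
      have "(\<Sum>k<n. ?x l * (?A $$ (i, k) * frame n \<xi> $$ (k, l))) = ?x l * (?A * frame n \<xi>) $$ (i, l)"
        unfolding index_mult_mat_sum[OF chart_A_carrier frame_carrier i l] by (simp add: sum_distrib_left)
      also have "\<dots> = ?x l * (?B ^\<^sub>m l *\<^sub>v ?w) $ i + (?x l * of_nat l) * (?B ^\<^sub>m (l - 1) *\<^sub>v ?v) $ i"
        unfolding chart_A_frame using i l by (simp add: image_frame_def algebra_simps)
      also have "?x l * of_nat l = 0" using nat0 by (simp add: relation_coeff_def)
      finally show "(\<Sum>k<n. ?x l * (?A $$ (i, k) * frame n \<xi> $$ (k, l))) = ?x l * (?B ^\<^sub>m l *\<^sub>v ?w) $ i"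
        by simp
    qed
    also have "\<dots> = (?B ^\<^sub>m n *\<^sub>v ?w) $ i"
    proof -
      let ?d = "\<lambda>j. if j = n then - 1 else ?x j"
      have "(\<Sum>j\<in>{..<Suc n}. ?d j * (?B ^\<^sub>m j *\<^sub>v ?w) $ i) = 0"
      proof (rule krylov_relation_propagates[OF chart_B_carrier unit_vec_carrier _ cyc _ i])
        fix k assume k: "k < n"
        have "(\<Sum>j<n. ?x j * (?B ^\<^sub>m j *\<^sub>v ?v) $ k) = (?B ^\<^sub>m n *\<^sub>v ?v) $ k"
          unfolding chart_B_pow_n[OF k] using k by (intro sum.cong) (auto simp: chart_B_pow_index)
        then show "(\<Sum>j\<in>{..<Suc n}. ?d j * (?B ^\<^sub>m j *\<^sub>v ?v) $ k) = 0" by simp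
      qed simp
      then show ?thesis by simp
    qed
    finally show ?thesis using nat0[OF pn] by simp
  qed
  have "?A * ?B - ?B * ?A = 1\<^sub>m n"
  proof (rule bracket_oneI[OF chart_A_carrier chart_B_carrier unit_vec_carrier _ cyc])
    show "(?A *\<^sub>v (?B ^\<^sub>m j *\<^sub>v ?v)) $ i = (?B ^\<^sub>m j *\<^sub>v ?w) $ i + of_nat j * (?B ^\<^sub>m (j - 1) *\<^sub>v ?v) $ i"
      if "j \<le> n" "i < n" for i j
      using chart_A_pow_index[OF _ that(2), of j] der_n[OF that(2)] that(1) by (cases "j = n") auto
  qed simp
  then show ?thesis by (simp add: bracket_one_pairs_iff)
qed

end

text \<open>
  Let \<open>f\<close> be monic of degree \<open>n\<close> with \<open>f(B) = 0\<close>.  Then \<open>f'(B) = [A, f(B)] = 0\<close>, and \<open>f'\<close> has degree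
  less than \<open>n - 1\<close> as \<open>p\<close> divides \<open>n\<close>, so \<open>f' = 0\<close> because \<open>B\<close> is cyclic.  Only powers of \<open>x\<^sup>p\<close> occur
  in such a polynomial.
\<close>

lemma cyclic_pair_in_chart:
  fixes A B :: "'k::field mat"
  assumes char: "CHAR('k) = p" and n: "n > 0" and pn: "p dvd n" and p: "p > 0"
    and AB: "(A, B) \<in> bracket_one_pairs n"
    and cyc: "det (krylov n B (unit_vec n 0)) \<noteq> 0"
  shows "\<exists>\<xi>. det (frame n \<xi>) \<noteq> 0 \<and> chart_A n p \<xi> = A \<and> chart_B n p \<xi> = B"
proof -
  let ?v = "unit_vec n 0 :: 'k vec"
  let ?w = "A *\<^sub>v ?v" and ?K = "krylov n B ?v"
  have A: "A \<in> carrier_mat n n" and B: "B \<in> carrier_mat n n" and br: "A * B - B * A = 1\<^sub>m n"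
    using AB by (auto simp: bracket_one_pairs_iff)
  have w: "?w \<in> carrier_vec n" using A unit_vec_carrier by (rule mult_mat_vec_carrier)
  have Bu: "B ^\<^sub>m i *\<^sub>v u \<in> carrier_vec n" if "u \<in> carrier_vec n" for i u
    using pow_carrier_mat[OF B] that by (rule mult_mat_vec_carrier)
  have der: "(A *\<^sub>v (B ^\<^sub>m j *\<^sub>v ?v)) $ i = (B ^\<^sub>m j *\<^sub>v ?w) $ i + of_nat j * (B ^\<^sub>m (j - 1) *\<^sub>v ?v) $ i"
    if "i < n" for i j
    using bracket_one_power[OF A B br unit_vec_carrier, of j 0] that
      carrier_vecD[OF Bu[OF w, of j]] carrier_vecD[OF Bu[OF unit_vec_carrier[of n 0], of "j - 1"]]
    by (simp del: index_mult_mat_vec)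
  obtain x where x: "\<forall>i<n. (\<Sum>l<n. ?K $$ (i, l) * x l) = (B ^\<^sub>m n *\<^sub>v ?v) $ i"
    using invertible_solve[OF krylov_carrier cyc, of "\<lambda>i. (B ^\<^sub>m n *\<^sub>v ?v) $ i"] by blast
  define d where "d j = (if j = n then - 1 else x j)" for j
  have rel: "(\<Sum>j<Suc n. d j * (B ^\<^sub>m j *\<^sub>v ?v) $ i) = 0" if "i < n" for i
    using x that by (simp add: d_def mult.commute)
  have deriv0: "of_nat (Suc j) * d (Suc j) = 0" if j: "Suc j < n" for j
  proof -
    \<comment> \<open>The coefficients of \<open>f'\<close>; the one of \<open>x\<^bsup>n - 1\<^esup>\<close> is \<open>n = 0\<close> in the field.\<close>
    define y where "y j = (if Suc j < n then of_nat (Suc j) * d (Suc j) else 0)" for j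
    have rel_y: "(\<Sum>j<n. ?K $$ (i, j) * y j) = 0" if i: "i < n" for i
    proof -
      have "0 = (\<Sum>k<n. A $$ (i, k) * (\<Sum>j<Suc n. d j * (B ^\<^sub>m j *\<^sub>v ?v) $ k))"
        using rel by simp
      also have "\<dots> = (\<Sum>k<n. \<Sum>j<Suc n. d j * (A $$ (i, k) * (B ^\<^sub>m j *\<^sub>v ?v) $ k))"
        unfolding sum_distrib_left by (simp only: mult.left_commute)
      also have "\<dots> = (\<Sum>j<Suc n. \<Sum>k<n. d j * (A $$ (i, k) * (B ^\<^sub>m j *\<^sub>v ?v) $ k))"
        by (rule sum.swap)
      also have "\<dots> = (\<Sum>j<Suc n. d j * (A *\<^sub>v (B ^\<^sub>m j *\<^sub>v ?v)) $ i)"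
        unfolding index_mult_mat_vec_sum[OF A Bu[OF unit_vec_carrier] i] by (simp only: sum_distrib_left)
      also have "\<dots> = (\<Sum>j<Suc n. d j * (B ^\<^sub>m j *\<^sub>v ?w) $ i)
          + (\<Sum>j<Suc n. of_nat j * d j * (B ^\<^sub>m (j - 1) *\<^sub>v ?v) $ i)"
        unfolding der[OF i] sum.distrib[symmetric]
        by (rule sum.cong) (auto simp: algebra_simps)
      also have "(\<Sum>j<Suc n. d j * (B ^\<^sub>m j *\<^sub>v ?w) $ i) = 0"
        by (rule krylov_relation_propagates[OF B unit_vec_carrier w cyc rel i])
      also have "(\<Sum>j<Suc n. of_nat j * d j * (B ^\<^sub>m (j - 1) *\<^sub>v ?v) $ i)
          = (\<Sum>j<n. of_nat (Suc j) * d (Suc j) * (B ^\<^sub>m j *\<^sub>v ?v) $ i)"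
        unfolding sum.lessThan_Suc_shift by simp
      also have "\<dots> = (\<Sum>j<n. ?K $$ (i, j) * y j)"
      proof (rule sum.cong[OF refl])
        fix j assume "j \<in> {..<n}"
        then have "j < n" by simp
        moreover have "of_nat (Suc j) = (0 :: 'k)" if "\<not> Suc j < n"
        proof -
          have "Suc j = n" using that \<open>j < n\<close> by simp
          then show ?thesis using pn char by (simp only: of_nat_eq_0_iff_char_dvd)
        qed
        ultimately show "of_nat (Suc j) * d (Suc j) * (B ^\<^sub>m j *\<^sub>v ?v) $ i = ?K $$ (i, j) * y j"
          using i by (auto simp: y_def simp del: of_nat_Suc)
      qed
      finally show ?thesis by simp
    qed
    have "\<forall>j<n. y j = 0"
      using spec[OF iffD1[OF det_nonzero_iff_injective[OF krylov_carrier] cyc], of y] rel_y by blast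
    then have "y j = 0" using j by simp
    then show ?thesis using j by (simp add: y_def)
  qed
  have x0: "x j = 0" if "j < n" "\<not> p dvd j" for j
  proof -
    from that(2) obtain l where l: "j = Suc l" by (cases j) auto
    have "of_nat j \<noteq> (0 :: 'k)" using that(2) char by (simp add: of_nat_eq_0_iff_char_dvd)
    then show ?thesis using deriv0[of l] that(1) l
      by (simp add: d_def del: of_nat_Suc)
  qed
  define \<xi> where "\<xi> = (\<lambda>(i, j). if i = n then - x (p * j) else if j = 0 then ?w $ i else (B ^\<^sub>m j *\<^sub>v ?v) $ i)"
  have frame: "frame n \<xi> = ?K"
  proof (rule eq_matI)
    fix i j assume "i < dim_row ?K" "j < dim_col ?K"
    then have ij: "i < n" "j < n" by auto
    have "(B ^\<^sub>m 0 *\<^sub>v ?v) $ i = (if i = 0 then 1 else 0)"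
      using B ij n by (simp add: carrier_matD(1)[OF B])
    then show "frame n \<xi> $$ (i, j) = ?K $$ (i, j)"
      using ij by (auto simp: frame_def \<xi>_def simp del: pow_mat.simps index_mult_mat_vec)
  qed (simp_all add: frame_def)
  have coeff: "relation_coeff n p \<xi> l = x l" if "l < n" for l
    using x0[OF that] p by (auto simp: relation_coeff_def \<xi>_def)
  have det: "det (frame n \<xi>) \<noteq> 0" unfolding frame by (rule cyc)
  have "B * frame n \<xi> = shifted_frame n p \<xi>"
    unfolding frame
  proof (rule eq_matI)
    fix i j assume "i < dim_row (shifted_frame n p \<xi>)" "j < dim_col (shifted_frame n p \<xi>)"
    then have i: "i < n" and j: "j < n" by (auto simp: shifted_frame_def)
    have "(B * ?K) $$ (i, j) = (B ^\<^sub>m Suc j *\<^sub>v ?v) $ i"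
      unfolding index_mult_mat_sum[OF B krylov_carrier i j] pow_mat_Suc_vec[OF B unit_vec_carrier]
        index_mult_mat_vec_sum[OF B Bu[OF unit_vec_carrier] i]
      using j by simp
    also have "\<dots> = shifted_frame n p \<xi> $$ (i, j)"
    proof (cases "Suc j < n")
      case True
      then show ?thesis using i j by (simp add: shifted_frame_def frame del: pow_mat.simps)
    next
      case False
      then have "n = Suc j" using j by simp
      then have "(B ^\<^sub>m Suc j *\<^sub>v ?v) $ i = (\<Sum>l<n. ?K $$ (i, l) * x l)" using x i by simp
      also have "\<dots> = (\<Sum>l<n. frame n \<xi> $$ (i, l) * relation_coeff n p \<xi> l)"
        by (intro sum.cong) (auto simp: frame coeff)
      finally show ?thesis using False i j by (simp add: shifted_frame_def del: pow_mat.simps)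
    qed
    finally show "(B * ?K) $$ (i, j) = shifted_frame n p \<xi> $$ (i, j)" .
  qed (use B in \<open>auto simp: shifted_frame_def\<close>)
  from iffD2[OF divide_by_invertible[OF frame_carrier det shifted_frame_carrier B] this]
  have chB: "chart_B n p \<xi> = B" by (simp add: chart_B_def)
  have wvec: "vec n (\<lambda>i. \<xi> (i, 0)) = ?w"
    using A by (intro eq_vecI) (auto simp: \<xi>_def simp del: index_mult_mat_vec)
  have "A * frame n \<xi> = image_frame n B ?v ?w"
    unfolding frame
  proof (rule eq_matI)
    fix i j assume "i < dim_row (image_frame n B ?v ?w)" "j < dim_col (image_frame n B ?v ?w)"
    then have i: "i < n" and j: "j < n" by (auto simp: image_frame_def)
    have "(A * ?K) $$ (i, j) = (A *\<^sub>v (B ^\<^sub>m j *\<^sub>v ?v)) $ i"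
      unfolding index_mult_mat_sum[OF A krylov_carrier i j]
        index_mult_mat_vec_sum[OF A Bu[OF unit_vec_carrier] i]
      using j by simp
    then show "(A * ?K) $$ (i, j) = image_frame n B ?v ?w $$ (i, j)"
      unfolding der[OF i] using i j by (simp add: image_frame_def)
  qed (use A in \<open>auto simp: image_frame_def\<close>)
  from iffD2[OF divide_by_invertible[OF frame_carrier det image_frame_carrier A] this]
  have "chart_A n p \<xi> = A" by (simp add: chart_A_def chB wvec)
  then show ?thesis using det chB by blast
qed

section \<open>Density of the chart\<close>

lemma bracket_one_conjugate:
  fixes A B P Q :: "'k::comm_ring_1 mat"
  assumes P: "P \<in> carrier_mat n n" and Q: "Q \<in> carrier_mat n n" and PQ: "P * Q = 1\<^sub>m n" "Q * P = 1\<^sub>m n"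
    and AB: "(A, B) \<in> bracket_one_pairs n"
  shows "(P * A * Q, P * B * Q) \<in> bracket_one_pairs n"
proof -
  have A: "A \<in> carrier_mat n n" and B: "B \<in> carrier_mat n n" and br: "A * B - B * A = 1\<^sub>m n"
    using AB by (auto simp: bracket_one_pairs_iff)
  have c: "P * A * Q \<in> carrier_mat n n" "P * B * Q \<in> carrier_mat n n"
    using P Q A B by auto
  have "(P * A * Q) * (P * B * Q) - (P * B * Q) * (P * A * Q) = P * (A * B) * Q - P * (B * A) * Q"
    using conjugate_mult[OF P Q PQ(2) A B] conjugate_mult[OF P Q PQ(2) B A] by simp
  also have "\<dots> = (P * (A * B) - P * (B * A)) * Q"
    using P Q A B by (intro minus_mult_distrib_mat[symmetric]) auto
  also have "P * (A * B) - P * (B * A) = P * (A * B - B * A)"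
    using P A B by (intro mult_minus_distrib_mat[symmetric]) auto
  also have "\<dots> = P" unfolding br using P by simp
  finally show ?thesis using c PQ(1) by (simp add: bracket_one_pairs_iff)
qed

lemma bracket_one_add_commuting:
  fixes A B R :: "'k::comm_ring_1 mat"
  assumes AB: "(A, B) \<in> bracket_one_pairs n" and R: "R \<in> carrier_mat n n" and AR: "A * R = R * A"
  shows "(A, B + t \<cdot>\<^sub>m R) \<in> bracket_one_pairs n"
proof -
  have A: "A \<in> carrier_mat n n" and B: "B \<in> carrier_mat n n" and br: "A * B - B * A = 1\<^sub>m n"
    using AB by (auto simp: bracket_one_pairs_iff)
  have "A * (B + t \<cdot>\<^sub>m R) = A * B + t \<cdot>\<^sub>m (A * R)"
    using mult_add_distrib_mat[OF A B, of "t \<cdot>\<^sub>m R"] mult_smult_distrib[OF A R] R by simp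
  moreover have "(B + t \<cdot>\<^sub>m R) * A = B * A + t \<cdot>\<^sub>m (A * R)"
    using add_mult_distrib_mat[OF B _ A, of "t \<cdot>\<^sub>m R"] mult_smult_assoc_mat[OF R A] R AR by simp
  moreover have "A * B + t \<cdot>\<^sub>m (A * R) - (B * A + t \<cdot>\<^sub>m (A * R)) = A * B - B * A"
    using A B R by (intro eq_matI) auto
  ultimately show ?thesis using A B R br by (simp add: bracket_one_pairs_iff)
qed

lemma smult_mat_mult_vec:
  fixes M :: "'k::comm_ring_1 mat"
  assumes "M \<in> carrier_mat m n" "x \<in> carrier_vec n"
  shows "(c \<cdot>\<^sub>m M) *\<^sub>v x = c \<cdot>\<^sub>v (M *\<^sub>v x)"
  using assms by (intro eq_vecI) (auto simp: scalar_prod_def sum_distrib_left mult.assoc)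

lemma pow_mat_smult_vec:
  fixes M :: "'k::field mat"
  assumes M: "M \<in> carrier_mat n n" and x: "x \<in> carrier_vec n"
  shows "(c \<cdot>\<^sub>m M) ^\<^sub>m j *\<^sub>v (c \<cdot>\<^sub>v x) = c ^ Suc j \<cdot>\<^sub>v (M ^\<^sub>m j *\<^sub>v x)"
proof (induction j)
  case 0
  then show ?case using M x by (auto intro!: eq_vecI)
next
  case (Suc j)
  have cM: "c \<cdot>\<^sub>m M \<in> carrier_mat n n" and cx: "c \<cdot>\<^sub>v x \<in> carrier_vec n" using M x by auto
  have Mx: "M ^\<^sub>m j *\<^sub>v x \<in> carrier_vec n"
    using pow_carrier_mat[OF M] x by (rule mult_mat_vec_carrier)
  have "(c \<cdot>\<^sub>m M) ^\<^sub>m Suc j *\<^sub>v (c \<cdot>\<^sub>v x) = (c \<cdot>\<^sub>m M) *\<^sub>v (c ^ Suc j \<cdot>\<^sub>v (M ^\<^sub>m j *\<^sub>v x))"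
    unfolding pow_mat_Suc_vec[OF cM cx] Suc ..
  also have "\<dots> = c \<cdot>\<^sub>v (c ^ Suc j \<cdot>\<^sub>v (M *\<^sub>v (M ^\<^sub>m j *\<^sub>v x)))"
    using smult_mat_mult_vec[OF M, of "c ^ Suc j \<cdot>\<^sub>v (M ^\<^sub>m j *\<^sub>v x)" c] Mx mult_mat_vec[OF M Mx] by simp
  also have "\<dots> = c ^ Suc (Suc j) \<cdot>\<^sub>v (M *\<^sub>v (M ^\<^sub>m j *\<^sub>v x))"
    by (simp add: smult_smult_assoc)
  finally show ?case unfolding pow_mat_Suc_vec[OF M x] .
qed

lemma krylov_smult_cyclic:
  fixes M :: "'k::field mat"
  assumes M: "M \<in> carrier_mat n n" and x: "x \<in> carrier_vec n" and c: "c \<noteq> 0"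
    and cyc: "det (krylov n M x) \<noteq> 0"
  shows "det (krylov n (c \<cdot>\<^sub>m M) (c \<cdot>\<^sub>v x)) \<noteq> 0"
  unfolding det_nonzero_iff_injective[OF krylov_carrier]
proof (intro allI impI)
  fix y j assume zero: "\<forall>i<n. (\<Sum>j<n. krylov n (c \<cdot>\<^sub>m M) (c \<cdot>\<^sub>v x) $$ (i, j) * y j) = 0" and j: "j < n"
  have Mx: "dim_vec (M ^\<^sub>m j *\<^sub>v x) = n" for j using M by simp
  have "(\<Sum>j<n. krylov n M x $$ (i, j) * (c ^ Suc j * y j)) = 0" if i: "i < n" for i
  proof -
    have "(\<Sum>j<n. krylov n M x $$ (i, j) * (c ^ Suc j * y j))
        = (\<Sum>j<n. krylov n (c \<cdot>\<^sub>m M) (c \<cdot>\<^sub>v x) $$ (i, j) * y j)"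
      using i Mx by (intro sum.cong)
        (simp_all add: pow_mat_smult_vec[OF M x] del: index_mult_mat_vec power_Suc)
    then show ?thesis using zero i by simp
  qed
  then have "\<forall>j<n. c ^ Suc j * y j = 0"
    using spec[OF iffD1[OF det_nonzero_iff_injective[OF krylov_carrier] cyc], of "\<lambda>j. c ^ Suc j * y j"]
    by blast
  then show "y j = 0" using j c by simp
qed

text \<open>
  Join an arbitrary pair to the chart by a rational curve.  Adding \<open>t R\<close> to \<open>B\<close>, where \<open>R\<close>
  commutes with \<open>A\<close> and has a cyclic vector \<open>v\<close>, keeps the bracket; conjugation with a matrix
  that moves the first unit vector \<open>e\<close> to \<open>e + t v\<close> makes \<open>e\<close> cyclic for almost all \<open>t\<close>, as the
  limit \<open>t \<rightarrow> \<infinity>\<close> shows.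
\<close>

lemma chart_dense:
  fixes f :: "'k::alg_closed_field mat \<times> 'k mat \<Rightarrow> 'k"
  assumes char: "CHAR('k) = p" and n: "n > 0" and pn: "p dvd n" and p: "p > 0"
    and f: "f \<in> poly_funs (gl_pairs_coords n)"
    and van: "\<forall>\<xi>. det (frame n \<xi>) \<noteq> 0 \<longrightarrow> f (chart_A n p \<xi>, chart_B n p \<xi>) = 0"
    and AB: "(A, B) \<in> bracket_one_pairs n"
  shows "f (A, B) = 0"
proof (rule ccontr)
  assume fAB: "f (A, B) \<noteq> 0"
  have A: "A \<in> carrier_mat n n" and B: "B \<in> carrier_mat n n" and br: "A * B - B * A = 1\<^sub>m n"
    using AB by (auto simp: bracket_one_pairs_iff)
  obtain R v where R: "R \<in> carrier_mat n n" and v: "v \<in> carrier_vec n" and AR: "A * R = R * A"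
    and cyc: "det (krylov n R v) \<noteq> 0"
    using exists_commuting_cyclic[OF A] by blast
  let ?e = "unit_vec n 0 :: 'k vec"
  let ?X = "{\<lambda>t. t} :: ('k \<Rightarrow> 'k) set"
  interpret pf: function_algebra "poly_funs ?X" by (rule function_algebra_poly_funs)
  have t: "(\<lambda>t. t) \<in> poly_funs ?X" by (rule poly_funs.coord) simp
  define H where "H = mat n n (\<lambda>(i, j). if j = 0 then v $ i else 0)"
  have H: "H \<in> carrier_mat n n" by (simp add: H_def)
  have He: "H *\<^sub>v ?e = v"
  proof (rule eq_vecI)
    fix i assume "i < dim_vec v"
    then have i: "i < n" using v by simp
    have "(H *\<^sub>v ?e) $ i = (\<Sum>k<n. H $$ (i, k) * ?e $ k)"
      by (rule index_mult_mat_vec_sum[OF H unit_vec_carrier i])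
    also have "\<dots> = (\<Sum>k<n. if k = 0 then H $$ (i, k) else 0)" by (intro sum.cong) auto
    finally show "(H *\<^sub>v ?e) $ i = v $ i" using n i by (simp add: H_def)
  qed (use H v in simp)
  define G where "G t = 1\<^sub>m n + t \<cdot>\<^sub>m H" for t
  define \<delta> where "\<delta> t = det (G t)" for t
  define Bt where "Bt t = B + t \<cdot>\<^sub>m R" for t
  define \<kappa> where "\<kappa> t = det (krylov n (Bt t) (G t *\<^sub>v ?e))" for t
  have G: "G \<in> pf.mats n n" unfolding G_def
    by (intro pf.mats_add pf.mats_smult pf.mats_const one_carrier_mat H t)
  have Bt: "Bt \<in> pf.mats n n" unfolding Bt_def
    by (intro pf.mats_add pf.mats_smult pf.mats_const B R t)
  note Gc = pf.matsD(1)[OF G] and Btc = pf.matsD(1)[OF Bt]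
  have \<delta>: "\<delta> \<in> poly_funs ?X" unfolding \<delta>_def by (rule pf.det[OF G])
  have \<kappa>: "\<kappa> \<in> poly_funs ?X" unfolding \<kappa>_def
    by (rule pf.det[OF pf.mats_krylov[OF Bt pf.vecs_mult[OF G pf.vecs_const[OF unit_vec_carrier]]]])
  have G0: "G 0 = 1\<^sub>m n" unfolding G_def using H by (intro eq_matI) auto
  have \<delta>0: "\<delta> 0 = 1" by (simp add: \<delta>_def G0)

  have "\<exists>t. \<kappa> t \<noteq> 0"
  proof -
    \<comment> \<open>Up to powers of \<open>u\<close>, the function \<open>\<kappa>'\<close> is \<open>\<kappa>\<close> in the variable \<open>u = 1 / t\<close>.\<close>
    define G' where "G' u = u \<cdot>\<^sub>m 1\<^sub>m n + H" for u
    define B' where "B' u = u \<cdot>\<^sub>m B + R" for u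
    define \<kappa>' where "\<kappa>' u = det (krylov n (B' u) (G' u *\<^sub>v ?e))" for u
    have G': "G' \<in> pf.mats n n" unfolding G'_def
      by (intro pf.mats_add pf.mats_smult pf.mats_const one_carrier_mat H t)
    have B': "B' \<in> pf.mats n n" unfolding B'_def
      by (intro pf.mats_add pf.mats_smult pf.mats_const B R t)
    have "\<kappa>' \<in> poly_funs ?X" unfolding \<kappa>'_def
      by (rule pf.det[OF pf.mats_krylov[OF B' pf.vecs_mult[OF G' pf.vecs_const[OF unit_vec_carrier]]]])
    moreover have "\<kappa>' 0 \<noteq> 0"
    proof -
      have "G' 0 = H" unfolding G'_def using H by (intro eq_matI) auto
      moreover have "B' 0 = R" unfolding B'_def using B R by (intro eq_matI) auto
      ultimately show ?thesis using cyc He by (simp add: \<kappa>'_def)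
    qed
    ultimately have fin: "finite {u. \<kappa>' u = 0}" by (rule poly_funs_id_finite_zeros)
    obtain u where u: "\<kappa>' u \<noteq> 0" "u \<noteq> 0"
      using finite_zeros_imp_common_nonzero[OF infinite_UNIV_alg_closed fin, of "\<lambda>t. t"] by auto
    have "Bt (1 / u) = (1 / u) \<cdot>\<^sub>m B' u"
      unfolding Bt_def B'_def using B R u by (intro eq_matI) (auto simp: field_simps)
    moreover have "G (1 / u) *\<^sub>v ?e = (1 / u) \<cdot>\<^sub>v (G' u *\<^sub>v ?e)"
    proof -
      have "G (1 / u) = (1 / u) \<cdot>\<^sub>m G' u"
        unfolding G_def G'_def using H u by (intro eq_matI) (auto simp: field_simps)
      then show ?thesis
        using pf.matsD(1)[OF G', of u] smult_mat_mult_vec[of "G' u" n n ?e "1 / u"] by simp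
    qed
    ultimately have "\<kappa> (1 / u) \<noteq> 0"
      unfolding \<kappa>_def using krylov_smult_cyclic[OF pf.matsD(1)[OF B'] mult_mat_vec_carrier[OF pf.matsD(1)[OF G'] unit_vec_carrier], of "1 / u"] u
      by (simp add: \<kappa>'_def)
    then show ?thesis by blast
  qed
  then obtain s where s: "\<kappa> s \<noteq> 0" by blast

  interpret fr: function_algebra "fractions ?X \<delta> {t. \<delta> t \<noteq> 0}"
    by (rule function_algebra_fractions[OF \<delta>])
  have lift: "M \<in> fr.mats n n" if "M \<in> pf.mats n n" for M
    using that unfolding fr.mats_def pf.mats_def by (auto intro: poly_funs_in_fractions)
  define Gi where "Gi t = (1 / \<delta> t) \<cdot>\<^sub>m adj_mat (G t)" for t
  have Gi: "Gi \<in> fr.mats n n" unfolding Gi_def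
    by (intro fr.mats_smult fractions_inverse fr.mats_adj lift[OF G]) simp
  note Gic = fr.matsD(1)[OF Gi]
  have inv: "G t * Gi t = 1\<^sub>m n" "Gi t * G t = 1\<^sub>m n" if "\<delta> t \<noteq> 0" for t
  proof -
    have adj: "adj_mat (G t) \<in> carrier_mat n n" by (rule adj_mat(1)[OF Gc])
    show "G t * Gi t = 1\<^sub>m n"
      unfolding Gi_def mult_smult_distrib[OF Gc adj] adj_mat(2)[OF Gc]
      using that by (intro eq_matI) (auto simp: \<delta>_def)
    show "Gi t * G t = 1\<^sub>m n"
      unfolding Gi_def mult_smult_assoc_mat[OF adj Gc] adj_mat(3)[OF Gc]
      using that by (intro eq_matI) (auto simp: \<delta>_def)
  qed
  define \<gamma> where "\<gamma> t = (Gi t * A * G t, Gi t * Bt t * G t)" for t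
  have "(\<lambda>t. f (\<gamma> t)) \<in> fractions ?X \<delta> {t. \<delta> t \<noteq> 0}"
  proof (rule fractions_compose[OF \<delta> f])
    have mats: "(\<lambda>t. Gi t * A * G t) \<in> fr.mats n n" "(\<lambda>t. Gi t * Bt t * G t) \<in> fr.mats n n"
      by (intro fr.mats_mult[of _ n n] Gi lift[OF G] lift[OF Bt] fr.mats_const A)+
    fix y :: "'k mat \<times> 'k mat \<Rightarrow> 'k" assume "y \<in> gl_pairs_coords n"
    then show "(\<lambda>t. y (\<gamma> t)) \<in> fractions ?X \<delta> {t. \<delta> t \<noteq> 0}"
      unfolding gl_pairs_coords_def \<gamma>_def
      using fr.matsD(2)[OF mats(1)] fr.matsD(2)[OF mats(2)] by auto
  qed
  then obtain e P where P: "P \<in> poly_funs ?X" "\<And>t. \<delta> t \<noteq> 0 \<Longrightarrow> f (\<gamma> t) * \<delta> t ^ e = P t"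
    unfolding fractions_def by blast
  have "\<gamma> 0 = (A, B)"
  proof -
    have "Gi 0 = 1\<^sub>m n"
      using inv(2)[of 0] \<delta>0 right_mult_one_mat[OF Gic] unfolding G0 by simp
    moreover have "Bt 0 = B" unfolding Bt_def using B R by (intro eq_matI) auto
    ultimately show ?thesis using A B by (simp add: \<gamma>_def G0)
  qed
  then have "P 0 \<noteq> 0" using P(2)[of 0] \<delta>0 fAB by simp
  then have "finite {t. P t = 0}" by (rule poly_funs_id_finite_zeros[OF P(1)])
  moreover have "finite {t. \<kappa> t = 0}" by (rule poly_funs_id_finite_zeros[OF \<kappa> s])
  moreover have "finite {t. \<delta> t = 0}"
    by (rule poly_funs_id_finite_zeros[OF \<delta>, of 0]) (simp add: \<delta>0)
  moreover have "{t. \<kappa> t * \<delta> t = 0} = {t. \<kappa> t = 0} \<union> {t. \<delta> t = 0}" by auto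
  ultimately obtain t where t: "P t \<noteq> 0" "\<kappa> t * \<delta> t \<noteq> 0"
    using finite_zeros_imp_common_nonzero[OF infinite_UNIV_alg_closed, of P "\<lambda>t. \<kappa> t * \<delta> t"] by auto
  then have \<delta>t: "\<delta> t \<noteq> 0" by auto
  have mem: "(Gi t * A * G t, Gi t * Bt t * G t) \<in> bracket_one_pairs n"
    using bracket_one_conjugate[OF Gic Gc inv(2,1)[OF \<delta>t]]
      bracket_one_add_commuting[OF AB R AR] unfolding Bt_def by blast
  have "det (krylov n (Gi t * Bt t * G t) ?e) \<noteq> 0"
  proof -
    have GtBt: "Gi t * Bt t * G t \<in> carrier_mat n n" using mem by (auto simp: bracket_one_pairs_iff)
    have wit: "similar_mat_wit (Gi t * Bt t * G t) (Bt t) (Gi t) (G t)"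
      using inv[OF \<delta>t] Gic Gc Btc GtBt by (intro similar_mat_witI[of _ _ n]) auto
    have Ge: "G t *\<^sub>v ?e \<in> carrier_vec n" using Gc unit_vec_carrier by (rule mult_mat_vec_carrier)
    have "Gi t *\<^sub>v (G t *\<^sub>v ?e) = ?e"
      using assoc_mult_mat_vec[OF Gic Gc, of ?e t t] inv(2)[OF \<delta>t] by simp
    then have "krylov n (Gi t * Bt t * G t) ?e = Gi t * krylov n (Bt t) (G t *\<^sub>v ?e)"
      using krylov_conjugate[OF wit GtBt Ge] by simp
    then have "det (krylov n (Gi t * Bt t * G t) ?e) = det (Gi t) * \<kappa> t"
      unfolding \<kappa>_def using det_mult[OF Gic krylov_carrier] by simp
    moreover have "det (Gi t) \<noteq> 0"
      using det_mult[OF Gic Gc, of t t] inv(2)[OF \<delta>t] by auto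
    ultimately show ?thesis using t by auto
  qed
  from cyclic_pair_in_chart[OF char n pn p mem this] have "f (\<gamma> t) = 0"
    using van unfolding \<gamma>_def by auto
  then show False using P(2)[OF \<delta>t] t by simp
qed

section \<open>Irreducibility and dimension\<close>

definition parameters :: "nat \<Rightarrow> nat \<Rightarrow> (nat \<times> nat) set" where
  "parameters n r = {..<n} \<times> {..<n} \<union> {n} \<times> {..<r}"

lemma finite_parameters: "finite (parameters n r)"
  by (simp add: parameters_def)

lemma card_parameters: "card (parameters n r) = n ^ 2 + r"
  unfolding parameters_def
  by (subst card_Un_disjoint) (auto simp: card_cartesian_product power2_eq_square)

text \<open>
  Polynomial functions are defined on matrices of all sizes.  Truncation makes the Krylov matrix a
  polynomial function of its argument everywhere.
\<close>

definition truncate_mat :: "nat \<Rightarrow> 'k mat \<Rightarrow> 'k mat" where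
  "truncate_mat n M = mat n n (\<lambda>(i, j). M $$ (i, j))"

lemma truncate_mat_carrier [simp]: "M \<in> carrier_mat n n \<Longrightarrow> truncate_mat n M = M"
  unfolding truncate_mat_def by (intro eq_matI) auto

definition chart_denominator :: "nat \<Rightarrow> 'k::field mat \<times> 'k mat \<Rightarrow> 'k" where
  "chart_denominator n z = det (krylov n (truncate_mat n (snd z)) (unit_vec n 0))"

text \<open>
  Over the denominator \<open>chart_denominator\<close>, the first case is Cramer's rule for the coordinates of
  \<open>B\<^sup>n e\<close> in the Krylov basis; the other two read off \<open>A e\<close> and the basis itself.
\<close>

definition chart_numerator :: "nat \<Rightarrow> nat \<Rightarrow> nat \<times> nat \<Rightarrow> 'k::field mat \<times> 'k mat \<Rightarrow> 'k" where
  "chart_numerator n p = (\<lambda>(i, j) z.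
     if i = n then - (adj_mat (krylov n (truncate_mat n (snd z)) (unit_vec n 0))
       *\<^sub>v (truncate_mat n (snd z) ^\<^sub>m n *\<^sub>v unit_vec n 0)) $ (p * j)
     else chart_denominator n z *
       (if j = 0 then (truncate_mat n (fst z) *\<^sub>v unit_vec n 0) $ i
        else (truncate_mat n (snd z) ^\<^sub>m j *\<^sub>v unit_vec n 0) $ i))"

lemma chart_inverse_poly_funs:
  fixes n p r :: nat
  assumes "n = p * r" "p > 0"
  shows "chart_denominator n \<in> poly_funs (gl_pairs_coords n :: ('k::field mat \<times> 'k mat \<Rightarrow> 'k) set)"
    and "ij \<in> parameters n r \<Longrightarrow>
      chart_numerator n p ij \<in> poly_funs (gl_pairs_coords n :: ('k mat \<times> 'k mat \<Rightarrow> 'k) set)"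
proof -
  let ?Y = "gl_pairs_coords n :: ('k mat \<times> 'k mat \<Rightarrow> 'k) set"
  interpret pf: function_algebra "poly_funs ?Y" by (rule function_algebra_poly_funs)
  have tr: "(\<lambda>z. truncate_mat n (fst z)) \<in> pf.mats n n" "(\<lambda>z. truncate_mat n (snd z)) \<in> pf.mats n n"
    unfolding truncate_mat_def
    by (intro pf.mats_mat poly_funs.coord; force simp: gl_pairs_coords_def case_prod_beta)+
  have e: "(\<lambda>_. unit_vec n 0) \<in> pf.vecs n" by (intro pf.vecs_const unit_vec_carrier)
  have K: "(\<lambda>z. krylov n (truncate_mat n (snd z)) (unit_vec n 0)) \<in> pf.mats n n"
    by (rule pf.mats_krylov[OF tr(2) e])
  show den: "chart_denominator n \<in> poly_funs ?Y"
    unfolding chart_denominator_def[abs_def] by (rule pf.det[OF K])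
  assume ij: "ij \<in> parameters n r"
  obtain i j where ij_eq: "ij = (i, j)" by (cases ij)
  have Bj: "(\<lambda>z. truncate_mat n (snd z) ^\<^sub>m j *\<^sub>v unit_vec n 0) \<in> pf.vecs n" for j
    by (rule pf.vecs_mult[OF pf.mats_pow[OF tr(2)] e])
  show "chart_numerator n p ij \<in> poly_funs ?Y"
  proof (cases "i = n")
    case True
    then have "p * j < n" using ij assms by (auto simp: ij_eq parameters_def)
    from pf.vecsD(2)[OF pf.vecs_mult[OF pf.mats_adj[OF K] Bj] this, of n]
    show ?thesis using True by (simp add: ij_eq chart_numerator_def pf.uminus del: index_mult_mat_vec)
  next
    case False
    then have i: "i < n" using ij by (auto simp: ij_eq parameters_def)
    have "(\<lambda>z. chart_denominator n z * (truncate_mat n (fst z) *\<^sub>v unit_vec n 0) $ i) \<in> poly_funs ?Y"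
      "(\<lambda>z. chart_denominator n z * (truncate_mat n (snd z) ^\<^sub>m j *\<^sub>v unit_vec n 0) $ i) \<in> poly_funs ?Y"
      by (rule pf.mult[OF den pf.vecsD(2)[OF pf.vecs_mult[OF tr(1) e] i]],
          rule pf.mult[OF den pf.vecsD(2)[OF Bj i]])
    then show ?thesis using False
      by (cases "j = 0") (simp_all add: ij_eq chart_numerator_def del: index_mult_mat_vec)
  qed
qed

lemma chart_numerator_chart:
  fixes n p r :: nat and \<xi> :: "nat \<times> nat \<Rightarrow> 'k::field"
  assumes n: "n = p * r" "p > 0" "n > 0" and det: "det (frame n \<xi>) \<noteq> 0"
    and ij: "(i, j) \<in> parameters n r"
  shows "chart_numerator n p (i, j) (chart_A n p \<xi>, chart_B n p \<xi>) = \<xi> (i, j) * det (frame n \<xi>)"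
proof -
  let ?A = "chart_A n p \<xi>" and ?B = "chart_B n p \<xi>" and ?e = "unit_vec n 0 :: 'k vec"
  let ?g = "frame n \<xi>" and ?x = "vec n (relation_coeff n p \<xi>)"
  note K = chart_krylov[OF det n(3), of p]
  have den: "chart_denominator n (?A, ?B) = det ?g" by (simp add: chart_denominator_def K)
  consider "i = n" "j < r" | "i < n" "j = 0" | "i < n" "j \<noteq> 0" "j < n"
    using ij by (auto simp: parameters_def)
  then show ?thesis
  proof cases
    case 1
    have pj: "p * j < n" using 1 n by simp
    have adj: "adj_mat ?g \<in> carrier_mat n n" by (rule adj_mat(1)[OF frame_carrier])
    have "?B ^\<^sub>m n *\<^sub>v ?e = ?g *\<^sub>v ?x"
    proof (rule eq_vecI)
      fix k assume "k < dim_vec (?g *\<^sub>v ?x)"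
      then have k: "k < n" using carrier_matD(1)[OF frame_carrier, of n \<xi>] by simp
      show "(?B ^\<^sub>m n *\<^sub>v ?e) $ k = (?g *\<^sub>v ?x) $ k"
        unfolding chart_B_pow_n[OF det n(3) k] index_mult_mat_vec_sum[OF frame_carrier vec_carrier k]
        by simp
    qed (use carrier_matD(1)[OF frame_carrier, of n \<xi>] carrier_matD(1)[OF chart_B_carrier, of n p \<xi>] in simp)
    then have "adj_mat ?g *\<^sub>v (?B ^\<^sub>m n *\<^sub>v ?e) = (adj_mat ?g * ?g) *\<^sub>v ?x"
      using assoc_mult_mat_vec[OF adj frame_carrier vec_carrier] by simp
    also have "\<dots> = det ?g \<cdot>\<^sub>v ?x"
      unfolding adj_mat(3)[OF frame_carrier]
      using smult_mat_mult_vec[OF one_carrier_mat vec_carrier, of "det ?g"] by simp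
    finally have "(adj_mat ?g *\<^sub>v (?B ^\<^sub>m n *\<^sub>v ?e)) $ (p * j) = det ?g * - \<xi> (n, j)"
      using pj n by (simp add: relation_coeff_def)
    then show ?thesis using 1 by (simp add: chart_numerator_def K del: index_mult_mat_vec)
  next
    case 2
    have "(?A *\<^sub>v ?e) $ i = \<xi> (i, 0)"
      using chart_A_pow_index[OF det n(3,3) 2(1), of p] 2 n carrier_matD(1)[OF chart_B_carrier, of n p \<xi>]
      by (simp del: index_mult_mat_vec)
    then show ?thesis using 2 by (simp add: chart_numerator_def den del: index_mult_mat_vec)
  next
    case 3
    have "(?B ^\<^sub>m j *\<^sub>v ?e) $ i = \<xi> (i, j)"
      using chart_B_pow_index[OF det n(3) 3(3,1), of p] 3 by (simp add: frame_def del: index_mult_mat_vec)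
    then show ?thesis using 3 by (simp add: chart_numerator_def den del: index_mult_mat_vec)
  qed
qed

lemma chart_in_fractions:
  fixes n p r :: nat
  defines "D \<equiv> {\<xi> :: nat \<times> nat \<Rightarrow> 'k::field. det (frame n \<xi>) \<noteq> 0}"
  assumes n: "n = p * r"
  shows "(\<lambda>\<xi> :: nat \<times> nat \<Rightarrow> 'k. det (frame n \<xi>)) \<in> poly_funs (coords (parameters n r))"
    and "i < n \<Longrightarrow> j < n \<Longrightarrow>
      (\<lambda>\<xi>. chart_A n p \<xi> $$ (i, j)) \<in> fractions (coords (parameters n r)) (\<lambda>\<xi>. det (frame n \<xi>)) D"
    and "i < n \<Longrightarrow> j < n \<Longrightarrow>
      (\<lambda>\<xi>. chart_B n p \<xi> $$ (i, j)) \<in> fractions (coords (parameters n r)) (\<lambda>\<xi>. det (frame n \<xi>)) D"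
proof -
  let ?X = "coords (parameters n r) :: ((nat \<times> nat \<Rightarrow> 'k) \<Rightarrow> 'k) set"
  let ?\<Delta> = "\<lambda>\<xi> :: nat \<times> nat \<Rightarrow> 'k. det (frame n \<xi>)"
  interpret pf: function_algebra "poly_funs ?X" by (rule function_algebra_poly_funs)
  have coord: "(\<lambda>\<xi>. \<xi> (i, j)) \<in> poly_funs ?X" if "i < n \<and> j < n \<or> i = n \<and> j < r" for i j
    using that by (intro coord_poly_fun) (auto simp: parameters_def)
  have frame: "frame n \<in> pf.mats n n"
    unfolding frame_def[abs_def]
  proof (rule pf.mats_mat)
    fix i j assume "i < n" "j < n"
    then show "(\<lambda>\<xi>. if j = 0 then if i = 0 then 1 else 0 else \<xi> (i, j)) \<in> poly_funs ?X"
      using coord[of i j] by (cases "j = 0") (simp_all add: pf.const)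
  qed
  show \<Delta>: "?\<Delta> \<in> poly_funs ?X" by (rule pf.det[OF frame])
  interpret fr: function_algebra "fractions ?X ?\<Delta> D" by (rule function_algebra_fractions[OF \<Delta>])
  have lift: "M \<in> fr.mats n n" if "M \<in> pf.mats n n" for M
    using that unfolding fr.mats_def pf.mats_def by (auto intro: poly_funs_in_fractions)
  have inv: "(\<lambda>\<xi>. 1 / ?\<Delta> \<xi>) \<in> fractions ?X ?\<Delta> D"
    by (rule fractions_inverse) (simp add: D_def)
  have rc: "(\<lambda>\<xi>. relation_coeff n p \<xi> l) \<in> poly_funs ?X" if l: "l < n" for l
  proof (cases "p dvd l")
    case True
    then have "l div p < r" using l n by (auto elim!: dvdE)
    then show ?thesis using True coord[of n "l div p"] by (simp add: relation_coeff_def pf.uminus)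
  qed (simp add: relation_coeff_def pf.const)
  have shifted: "shifted_frame n p \<in> pf.mats n n"
    unfolding shifted_frame_def[abs_def]
  proof (rule pf.mats_mat)
    fix i j assume ij: "i < n" "j < n"
    have "(\<lambda>\<xi>. \<Sum>l<n. frame n \<xi> $$ (i, l) * relation_coeff n p \<xi> l) \<in> poly_funs ?X"
      by (intro pf.sum pf.mult pf.matsD(2)[OF frame] rc ij) auto
    then show "(\<lambda>\<xi>. if Suc j < n then frame n \<xi> $$ (i, Suc j)
        else \<Sum>l<n. frame n \<xi> $$ (i, l) * relation_coeff n p \<xi> l) \<in> poly_funs ?X"
      using pf.matsD(2)[OF frame ij(1), of "Suc j"] by (cases "Suc j < n") simp_all
  qed
  have B: "chart_B n p \<in> fr.mats n n"
    unfolding chart_B_def[abs_def]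
    by (intro fr.mats_smult inv fr.mats_mult[of _ n n] lift[OF shifted] fr.mats_adj lift[OF frame])
  have w: "(\<lambda>\<xi>. vec n (\<lambda>i. \<xi> (i, 0))) \<in> fr.vecs n"
    by (intro fr.vecs_vec poly_funs_in_fractions coord) auto
  have image: "(\<lambda>\<xi>. image_frame n (chart_B n p \<xi>) (unit_vec n 0) (vec n (\<lambda>i. \<xi> (i, 0)))) \<in> fr.mats n n"
    unfolding image_frame_def
    by (intro fr.mats_mat fr.add fr.mult fr.const fr.vecsD(2)[OF fr.vecs_mult[OF fr.mats_pow[OF B] w]]
        fr.vecsD(2)[OF fr.vecs_mult[OF fr.mats_pow[OF B] fr.vecs_const[OF unit_vec_carrier]]])
  have A: "chart_A n p \<in> fr.mats n n"
    unfolding chart_A_def[abs_def]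
    by (intro fr.mats_smult inv fr.mats_mult[of _ n n] image fr.mats_adj lift[OF frame])
  show "i < n \<Longrightarrow> j < n \<Longrightarrow> (\<lambda>\<xi>. chart_A n p \<xi> $$ (i, j)) \<in> fractions ?X ?\<Delta> D"
    by (rule fr.matsD(2)[OF A])
  show "i < n \<Longrightarrow> j < n \<Longrightarrow> (\<lambda>\<xi>. chart_B n p \<xi> $$ (i, j)) \<in> fractions ?X ?\<Delta> D"
    by (rule fr.matsD(2)[OF B])
qed

theorem theoremA:
  fixes n p r :: nat
  assumes "CHAR('k::alg_closed_field) = p" and "p > 0"
    and "n > 0" and "n = p * r"
  shows "irreducible_space (bracket_one_variety n :: ('k mat \<times> 'k mat) topology) \<and>
         krull_dim (bracket_one_variety n :: ('k mat \<times> 'k mat) topology) = enat (n ^ 2 + r)"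
proof -
  have pn: "p dvd n" using assms(4) by simp
  interpret rational_chart "gl_pairs n" "gl_pairs_coords n :: ('k mat \<times> 'k mat \<Rightarrow> 'k) set"
    "bracket_one_pairs n" "parameters n r" "\<lambda>\<xi>. det (frame n \<xi>)"
    "\<lambda>\<xi>. (chart_A n p \<xi>, chart_B n p \<xi>)" "chart_numerator n p" "chart_denominator n"
    "\<lambda>(i, j). if i = j then 1 else 0"
  proof
    show "infinite (UNIV :: 'k set)" by (rule infinite_UNIV_alg_closed)
    show "finite (parameters n r)" by (rule finite_parameters)
    show "closedin (zariski (gl_pairs n) (gl_pairs_coords n)) (bracket_one_pairs n :: ('k mat \<times> 'k mat) set)"
      by (rule closedin_bracket_one_pairs)
    show "(\<lambda>\<xi> :: nat \<times> nat \<Rightarrow> 'k. det (frame n \<xi>)) \<in> poly_funs (coords (parameters n r))"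
      by (rule chart_in_fractions(1)[OF assms(4)])
    show "det (frame n (\<lambda>(i, j). if i = j then 1 else 0) :: 'k mat) \<noteq> 0"
    proof -
      have "frame n (\<lambda>(i, j). if i = j then 1 else 0) = (1\<^sub>m n :: 'k mat)"
        by (intro eq_matI) (auto simp: frame_def)
      then show ?thesis by simp
    qed
    show "(chart_A n p \<xi>, chart_B n p \<xi>) \<in> bracket_one_pairs n" if "det (frame n \<xi>) \<noteq> 0"
      for \<xi> :: "nat \<times> nat \<Rightarrow> 'k"
      using chart_in_variety[OF that assms(3,1) pn] .
    show "(\<lambda>\<xi>. y (chart_A n p \<xi>, chart_B n p \<xi>)) \<in>
        fractions (coords (parameters n r)) (\<lambda>\<xi>. det (frame n \<xi>)) {\<xi>. det (frame n \<xi>) \<noteq> 0}"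
      if "y \<in> gl_pairs_coords n" for y :: "'k mat \<times> 'k mat \<Rightarrow> 'k"
      using that chart_in_fractions(2,3)[OF assms(4)] unfolding gl_pairs_coords_def by auto
    show "f z = 0" if "f \<in> poly_funs (gl_pairs_coords n)"
      "\<forall>\<xi>. det (frame n \<xi>) \<noteq> 0 \<longrightarrow> f (chart_A n p \<xi>, chart_B n p \<xi>) = 0" "z \<in> bracket_one_pairs n"
      for f :: "'k mat \<times> 'k mat \<Rightarrow> 'k" and z
      using chart_dense[OF assms(1,3) pn assms(2) that(1,2)] that(3) by (cases z) auto
    show "chart_numerator n p ij \<in> poly_funs (gl_pairs_coords n :: ('k mat \<times> 'k mat \<Rightarrow> 'k) set)"
      if "ij \<in> parameters n r" for ij
      by (rule chart_inverse_poly_funs(2)[OF assms(4,2) that])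
    show "chart_denominator n \<in> poly_funs (gl_pairs_coords n :: ('k mat \<times> 'k mat \<Rightarrow> 'k) set)"
      by (rule chart_inverse_poly_funs(1)[OF assms(4,2)])
    have den: "chart_denominator n (chart_A n p \<xi>, chart_B n p \<xi>) = det (frame n \<xi>)"
      if "det (frame n \<xi>) \<noteq> 0" for \<xi> :: "nat \<times> nat \<Rightarrow> 'k"
      using chart_krylov[OF that assms(3)] by (simp add: chart_denominator_def)
    show "chart_denominator n (chart_A n p \<xi>, chart_B n p \<xi>) \<noteq> 0"
      if "det (frame n \<xi>) \<noteq> 0" for \<xi> :: "nat \<times> nat \<Rightarrow> 'k"
      using den[OF that] that by simp
    show "chart_numerator n p ij (chart_A n p \<xi>, chart_B n p \<xi>) =
        \<xi> ij * chart_denominator n (chart_A n p \<xi>, chart_B n p \<xi>)"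
      if "det (frame n \<xi>) \<noteq> 0" "ij \<in> parameters n r" for \<xi> :: "nat \<times> nat \<Rightarrow> 'k" and ij
      using chart_numerator_chart[OF assms(4,2,3) that(1), of "fst ij" "snd ij"] that(2) den[OF that(1)]
      by simp
  qed
  show ?thesis
    unfolding bracket_one_variety_def using irreducible krull_dim_eq card_parameters[of n r] by simp
qed

end
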